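(* There exists a bounded linear operator $T\colon GM\to GM$ which is strictly singular and not compact, where $GM$ is the (real) Gowers–Maurey space.
   Context: All Banach spaces are over $\mathbb{R}$. An operator is strictly singular if no restriction of it to an infinite dimensional subspace is an isomorphism onto its image. Notation. $c_{00}$ is the space of finitely supported real sequences, $(e_i)$ its unit vector basis, $(e_i^* )$ the coordinate functionals; $\mathrm{supp}(x)=\{i: x_i\neq 0\}$. Finitely supported functionals $z^*$ are identified with elements of $c_{00}$, with $z^*(x)=\sum_i z^*_i x_i$. For $E\subseteq\mathbb{N}$ and $x=\sum x_ie_i$, $E(x)=Ex=\sum_{i\in E}x_ie_i$ (and likewise for functionals). $E<F$ means $\max E<\min F$ ($\max\emptyset=0$, $\min\emptyset=\infty$; chains $E_1<\dots<E_n$ are understood pairwise), and $x<y$ means $\mathrm{supp}(x)<\mathrm{supp}(y)$. $f(x)=\log_2(x+1)$. Definition of $GM$. Fix an infinite set $J=\{j_1<j_2<\dots\}\subset\mathbb{N}$ such that $4n^2\le\log\log\log m$ whenever $n<m$ are in $J$, and $f(\min J)\ge 256$. Put $K=\{j_1,j_3,j_5,\dots\}$ and $L=\{j_2,j_4,j_6,\dots\}$. Let $\mathbf{Q}$ be the set of finitely supported scalar sequences with rational coordinates of absolute value at most one. Fix an injective function $\sigma$ from the collection of all finite sequences of elements of $\mathbf{Q}$ to $L$ such that $\frac1{20}f(\sigma(z_1,\dots,z_i)^{1/40})\ge \#\,\mathrm{supp}(\sum_{j=1}^i z_j)$ for every such sequence. Define sets of functionals recursively: $GM_0^*=\{\lambda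 e_n^*: n\in\mathbb{N}, |\lambda|\le 1\}$; and $GM_{k+1}^*$ is the set of all functionals $Ez^*$ where $E\subseteq\mathbb{N}$ is an interval and $z^*$ has one of the following forms: (1) $z^*=\sum_{i=1}^{\ell}\alpha_i z_i^*$ with $\sum_{i=1}^\ell|\alpha_i|\le1$ and $z_i^*\in GM_k^*$; (2) $z^*=\frac1{f(\ell)}\sum_{i=1}^\ell z_i^*$ with $z_i^*\in GM_k^*$ and $z_1^*<\dots<z_\ell^*$; (3) $z^*=\frac1{\sqrt{f(\ell)}}\sum_{i=1}^\ell z_i^*$ with $\ell\in K$ and $z_i^*=\frac1{f(m_i)}\sum_{j=1}^{m_i}z_{i,j}^*$, where $z_{i,j}^*\in GM_k^*$ for $1\le i\le\ell$, $1\le j\le m_i$, $z_{1,1}^*<\dots<z_{1,m_1}^*<z_{2,1}^*<\dots<z_{\ell,m_\ell}^*$, each $z_i^*$ has rational coordinates, $m_1=j_{2\ell}$, and $m_{i+1}=\sigma(z_1^*,\dots,z_i^* )$ for $i=1,\dots,\ell-1$. Then $\|x\|_{GM}=\sup\{z^*(x): z^*\in\bigcup_{k\ge0}GM_k^*\}$ for $x\in c_{00}$, and $GM$ is the completion of $(c_{00},\|\cdot\|_{GM})$. *)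

theory Defs
  imports "HOL-Analysis.Analysis"
begin

text \<open>
  Scalar sequences, and functionals on \<open>c00\<close> identified with their coefficient sequences, are
  functions \<open>nat \<Rightarrow> real\<close>. Coordinates are numbered from 0; only the order of the
  coordinates matters, so this is a relabelling of the basis \<open>e\<^sub>1, e\<^sub>2, \<dots>\<close>. Chains
  \<open>z\<^sub>1, \<dots>, z\<^sub>l\<close> of functionals, and the enumeration of \<open>J\<close>, are numbered from 1.
\<close>

definition supp :: "(nat \<Rightarrow> real) \<Rightarrow> nat set"
  where "supp x = {i. x i \<noteq> 0}"

definition c00 :: "(nat \<Rightarrow> real) set"
  where "c00 = {x. finite (supp x)}"

definition pairing :: "(nat \<Rightarrow> real) \<Rightarrow> (nat \<Rightarrow> real) \<Rightarrow> real"
  where "pairing z x = (\<Sum>i\<in>supp x. z i * x i)"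

definition restr :: "nat set \<Rightarrow> (nat \<Rightarrow> real) \<Rightarrow> (nat \<Rightarrow> real)"
  where "restr E x = (\<lambda>i. if i \<in> E then x i else 0)"

definition nat_interval :: "nat set \<Rightarrow> bool"
  where "nat_interval E \<longleftrightarrow> (\<forall>a\<in>E. \<forall>b\<in>E. {a..b} \<subseteq> E)"

text \<open>
  This is \<open>max E < min F\<close> with \<open>max {} = 0\<close> and \<open>min {} = \<infinity>\<close> for subsets of
  \<open>{1, 2, \<dots>}\<close>; in particular it holds whenever \<open>E\<close> or \<open>F\<close> is empty. Because of the empty
  set the relation is not transitive, and chains are required to be ordered pairwise.
\<close>

definition set_before :: "nat set \<Rightarrow> nat set \<Rightarrow> bool"
  where "set_before E F \<longleftrightarrow> (\<forall>i\<in>E. \<forall>j\<in>F. i < j)"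

definition vec_before :: "(nat \<Rightarrow> real) \<Rightarrow> (nat \<Rightarrow> real) \<Rightarrow> bool"
  where "vec_before x y \<longleftrightarrow> set_before (supp x) (supp y)"

definition lf :: "real \<Rightarrow> real"
  where "lf x = log 2 (x + 1)"

text \<open>The iterated logarithm is natural; only \<^const>\<open>lf\<close> uses base 2.\<close>

definition GM_index_set :: "nat set \<Rightarrow> bool"
  where "GM_index_set J \<longleftrightarrow>
    infinite J \<and>
    (\<forall>n\<in>J. \<forall>m\<in>J. n < m \<longrightarrow> 4 * (real n)\<^sup>2 \<le> ln (ln (ln (real m)))) \<and>
    lf (real (LEAST n. n \<in> J)) \<ge> 256"

text \<open>For \<open>n \<ge> 1\<close>, the \<open>n\<close>-th element \<open>j\<^sub>n\<close> of \<open>J\<close> (\<^const>\<open>enumerate\<close> starts at 0).\<close>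

definition jelem :: "nat set \<Rightarrow> nat \<Rightarrow> nat"
  where "jelem J n = enumerate J (n - 1)"

definition Kset :: "nat set \<Rightarrow> nat set"
  where "Kset J = {jelem J n |n. 1 \<le> n \<and> odd n}"

definition Lset :: "nat set \<Rightarrow> nat set"
  where "Lset J = {jelem J n |n. 1 \<le> n \<and> even n}"

definition Qseq :: "(nat \<Rightarrow> real) set"
  where "Qseq = {z \<in> c00. \<forall>i. z i \<in> \<rat> \<and> \<bar>z i\<bar> \<le> 1}"

text \<open>
  Finite sequences \<open>(z\<^sub>1, \<dots>, z\<^sub>i)\<close> have length at least 1. The value of \<open>\<sigma>\<close> outside
  these sequences is irrelevant.
\<close>

definition GM_coding :: "nat set \<Rightarrow> ((nat \<Rightarrow> real) list \<Rightarrow> nat) \<Rightarrow> bool"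
  where "GM_coding J \<sigma> \<longleftrightarrow>
    (let S = {zs. zs \<noteq> [] \<and> set zs \<subseteq> Qseq} in
      inj_on \<sigma> S \<and> \<sigma> ` S \<subseteq> Lset J \<and>
      (\<forall>zs\<in>S. 1 / 20 * lf (real (\<sigma> zs) powr (1 / 40))
         \<ge> real (card (supp (\<lambda>n. \<Sum>z\<leftarrow>zs. z n)))))"

definition GM_form1 :: "(nat \<Rightarrow> real) set \<Rightarrow> (nat \<Rightarrow> real) \<Rightarrow> bool"
  where "GM_form1 A z \<longleftrightarrow>
    (\<exists>l \<alpha> w. 1 \<le> l \<and> (\<Sum>i=1..l. \<bar>\<alpha> i\<bar>) \<le> (1::real) \<and> (\<forall>i\<in>{1..l::nat}. w i \<in> A) \<and>
      z = (\<lambda>n. \<Sum>i=1..l. \<alpha> i * w i n))"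

definition GM_form2 :: "(nat \<Rightarrow> real) set \<Rightarrow> (nat \<Rightarrow> real) \<Rightarrow> bool"
  where "GM_form2 A z \<longleftrightarrow>
    (\<exists>l w. 1 \<le> l \<and> (\<forall>i\<in>{1..l::nat}. w i \<in> A) \<and>
      (\<forall>i\<in>{1..l}. \<forall>k\<in>{1..l}. i < k \<longrightarrow> vec_before (w i) (w k)) \<and>
      z = (\<lambda>n. 1 / lf (real l) * (\<Sum>i=1..l. w i n)))"

text \<open>
  Here \<open>w i\<close> is \<open>z\<^sub>i\<^sup>*\<close> and \<open>v i k\<close> is \<open>z\<close> with indices \<open>i, k\<close>; the \<open>v i k\<close> are
  ordered by the lexicographic order of \<open>(i, k)\<close>.
\<close>

definition GM_form3 ::
  "nat set \<Rightarrow> ((nat \<Rightarrow> real) list \<Rightarrow> nat) \<Rightarrow> (nat \<Rightarrow> real) set \<Rightarrow> (nat \<Rightarrow> real) \<Rightarrow> bool"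
  where "GM_form3 J \<sigma> A z \<longleftrightarrow>
    (\<exists>l m v w. l \<in> Kset J \<and>
      (\<forall>i\<in>{1..l}. \<forall>k\<in>{1..m i}. v i k \<in> A) \<and>
      (\<forall>i\<in>{1..l}. \<forall>k\<in>{1..m i}. \<forall>i'\<in>{1..l}. \<forall>k'\<in>{1..m i'}.
         i < i' \<or> i = i' \<and> k < k' \<longrightarrow> vec_before (v i k) (v i' k')) \<and>
      (\<forall>i\<in>{1..l}. w i = (\<lambda>n. 1 / lf (real (m i)) * (\<Sum>k=1..m i. v i k n))) \<and>
      (\<forall>i\<in>{1..l}. \<forall>n. w i n \<in> \<rat>) \<and>
      m 1 = jelem J (2 * l) \<and>
      (\<forall>i\<in>{1..<l}. m (Suc i) = \<sigma> (map w [1..<Suc i])) \<and>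
      z = (\<lambda>n. 1 / sqrt (lf (real l)) * (\<Sum>i=1..l. w i n)))"

primrec GMstar :: "nat set \<Rightarrow> ((nat \<Rightarrow> real) list \<Rightarrow> nat) \<Rightarrow> nat \<Rightarrow> (nat \<Rightarrow> real) set"
  where
    "GMstar J \<sigma> 0 = {(\<lambda>i. if i = n then c else 0) |n c. \<bar>c\<bar> \<le> 1}"
  | "GMstar J \<sigma> (Suc k) = {restr E z |E z. nat_interval E \<and>
      (GM_form1 (GMstar J \<sigma> k) z \<or> GM_form2 (GMstar J \<sigma> k) z \<or> GM_form3 J \<sigma> (GMstar J \<sigma> k) z)}"

text \<open>
  All coefficients of the functionals in \<^const>\<open>GMstar\<close> have absolute value at most one, so for
  \<open>x \<in> c00\<close> the supremum is that of a nonempty bounded set.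
\<close>

definition GM_norm :: "nat set \<Rightarrow> ((nat \<Rightarrow> real) list \<Rightarrow> nat) \<Rightarrow> (nat \<Rightarrow> real) \<Rightarrow> real"
  where "GM_norm J \<sigma> x = (SUP z \<in> (\<Union>k. GMstar J \<sigma> k). pairing z x)"

text \<open>
  The Banach space \<open>'a\<close> together with the map \<open>\<iota>\<close> is a completion of \<open>c00\<close> with the norm
  \<^const>\<open>GM_norm\<close>. Any two completions are linearly isometric, so this determines the space
  \<open>GM\<close> (for given \<open>J\<close> and \<open>\<sigma>\<close>) in the only sense in which a completion is determined.
\<close>

definition GM_completion ::
  "nat set \<Rightarrow> ((nat \<Rightarrow> real) list \<Rightarrow> nat) \<Rightarrow> ((nat \<Rightarrow> real) \<Rightarrow> 'a::banach) \<Rightarrow> bool"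
  where "GM_completion J \<sigma> \<iota> \<longleftrightarrow>
    (\<forall>x\<in>c00. \<forall>y\<in>c00. \<forall>a b. \<iota> (\<lambda>i. a * x i + b * y i) = a *\<^sub>R \<iota> x + b *\<^sub>R \<iota> y) \<and>
    (\<forall>x\<in>c00. norm (\<iota> x) = GM_norm J \<sigma> x) \<and>
    closure (\<iota> ` c00) = UNIV"

definition infinite_dimensional :: "'a::real_vector set \<Rightarrow> bool"
  where "infinite_dimensional M \<longleftrightarrow> \<not> (\<exists>B. finite B \<and> M \<subseteq> span B)"

text \<open>
  For linear \<open>T\<close> the inverse of a restriction of \<open>T\<close> to a subspace is automatically linear, so an
  isomorphism onto the image is the same as a homeomorphism onto the image. Subspaces are not
  required to be closed.
\<close>

definition strictly_singular :: "('a::real_normed_vector \<Rightarrow> 'b::real_normed_vector) \<Rightarrow> bool"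
  where "strictly_singular T \<longleftrightarrow>
    \<not> (\<exists>M. subspace M \<and> infinite_dimensional M \<and> (\<exists>S. homeomorphism M (T ` M) T S))"

definition compact_operator :: "('a::real_normed_vector \<Rightarrow> 'b::real_normed_vector) \<Rightarrow> bool"
  where "compact_operator T \<longleftrightarrow> bounded_linear T \<and> compact (closure (T ` cball 0 1))"

end

theory Submission
  imports Defs
begin

text \<open>
  The operator is \<open>T x = (\<Sum>n. z\<^sub>n x e\<^sub>n)\<close> for successive functionals \<open>z\<^sub>n\<close> in the norming set that come with
  vectors \<open>x\<^sub>n\<close> of norm at most 2 such that \<open>z\<^sub>n x\<^sub>n = 1\<close>; as \<open>T x\<^sub>n = e\<^sub>n\<close>, it is not compact. The pair
  \<open>x\<^sub>n, z\<^sub>n\<close> is a tree of depth \<open>n\<close>: a node averages a rapidly increasing sequence of nodes of the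
  next level, with lengths so far from those in \<open>J\<close> that special functionals do not see \<open>x\<^sub>n\<close>. Cutting
  the trees at a fixed level splits almost all \<open>z\<^sub>n\<close> into a bounded number of successive functionals with
  tiny coefficients. Hence the sums of \<open>\<bar>z\<^sub>n x\<bar>\<close> over \<open>n \<in> A\<close> are \<open>o (log \<bar>A\<bar>)\<close>, and an induction
  over the norming set shows that \<open>T\<close> has norm at most 1 and, more precisely, that \<open>v (T x)\<close> is a sum of
  boundedly many successive functionals at \<open>x\<close>, with small coefficients. Every infinite dimensional subspace
  almost contains \<open>l\<^sub>1\<close>-averages \<open>x\<close>, on which all such sums are at most \<open>4 \<parallel>x\<parallel>\<close>. So \<open>T\<close> is arbitrarily
  small somewhere on the subspace.
\<close>

section \<open>A relaxation of the norming set\<close>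

text \<open>Form (2) alone bounds the sum of \<open>|z_n x|\<close> over \<open>n\<close> in
  \<open>A\<close> by \<open>f |A|\<close> times the norm of \<open>x\<close>, for any successive
  \<open>z_n\<close>, and this is just enough for a single average applied to \<open>T x\<close>. A
  special functional, however, adds up many averages, each of which could contribute the whole norm
  of \<open>x\<close>, and its factor \<open>1 / sqrt (f l)\<close> does not pay for that. So
  averages of \<open>T x\<close> have to decay with their length, which requires strictly less than
  logarithmic sums. This is why \<open>z_n\<close> must split into pieces with small coefficients at
  every level, and why the depth of the trees grows with \<open>n\<close>; the lacunarity of
  \<open>J\<close> makes the decay summable over the lengths in a special functional. Upper and
  lower estimates are kept apart. Functionals acting on \<open>x_n\<close> or on \<open>T x\<close>
  range over the relaxed set \<open>relG\<close>, which forgets the coding. Norms are bounded below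
  through form (2), scaling and restriction only. The coding therefore enters just once, to see that
  lengths hardly repeat.\<close>

lemma lf_one [simp]: "lf 1 = 1"
  by (simp add: lf_def)

lemma lf_mono: "0 \<le> x \<Longrightarrow> x \<le> y \<Longrightarrow> lf x \<le> lf y"
  by (simp add: lf_def)

lemma lf_ge_1: "1 \<le> x \<Longrightarrow> 1 \<le> lf x"
  using lf_mono[of 1 x] by simp

lemma two_powr_lf: "0 \<le> x \<Longrightarrow> 2 powr lf x = x + 1"
  by (simp add: lf_def)

lemma log2_le_lf: "0 < x \<Longrightarrow> log 2 x \<le> lf x"
  by (simp add: lf_def)

text \<open>This is \<open>2 ^ 19 <= 3 ^ 12\<close>. As \<open>lf 2 = log 2 3\<close>, it measures
  the gain from averaging at least two functionals; the recursions below need it to be well above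
  1.\<close>

lemma log2_3: "19 / 12 \<le> log 2 (3::real)"
proof -
  have "(19::real) = log 2 (2 ^ 19)" by (subst log_nat_power) auto
  also have "\<dots> \<le> log 2 (3 ^ 12)" by (subst log_le_cancel_iff) auto
  also have "\<dots> = 12 * log 2 3" by (subst log_nat_power) auto
  finally show ?thesis by simp
qed

lemma lf_ge_2: "2 \<le> x \<Longrightarrow> 19 / 12 \<le> lf x"
  using log2_3 lf_mono[of 2 x] unfolding lf_def by (intro order_trans[OF log2_3]) simp

lemma lf_mult_le:
  assumes "0 \<le> x" "1 \<le> y"
  shows "lf (x * y) \<le> lf x + log 2 y"
proof -
  have "x * y + 1 \<le> (x + 1) * y" using assms by (simp add: algebra_simps)
  then have "lf (x * y) \<le> log 2 ((x + 1) * y)"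
    unfolding lf_def using assms by (subst log_le_cancel_iff) (auto simp: add_nonneg_pos)
  also have "\<dots> = lf x + log 2 y" using assms by (simp add: lf_def log_mult)
  finally show ?thesis .
qed

lemma lf_le_log: "1 \<le> x \<Longrightarrow> lf x \<le> log 2 x + 1"
  using lf_mult_le[of 1 x] by simp

text \<open>The averages of the construction have lengths \<open>2 ^ e - 1\<close>, so that their
  weights are known exactly.\<close>

lemma lf_pow2: "lf (2 ^ e - 1) = real e"
  by (simp add: lf_def log_nat_power)

section \<open>Intervals, restriction and the pairing\<close>

definition ihull :: "nat set \<Rightarrow> nat set"
  where "ihull A = {n. \<exists>a\<in>A. \<exists>b\<in>A. a \<le> n \<and> n \<le> b}"

lemma ihull_superset: "A \<subseteq> ihull A"
  by (auto simp: ihull_def)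

lemma nat_interval_ihull [simp]: "nat_interval (ihull A)"
  unfolding nat_interval_def ihull_def by (auto 0 3 intro: le_trans)

lemma set_before_ihull: "set_before A B \<Longrightarrow> set_before (ihull A) (ihull B)"
  unfolding set_before_def ihull_def by fastforce

lemma nat_interval_Int: "nat_interval A \<Longrightarrow> nat_interval B \<Longrightarrow> nat_interval (A \<inter> B)"
  unfolding nat_interval_def by blast

lemma nat_interval_UNIV [simp]: "nat_interval UNIV"
  by (simp add: nat_interval_def)

lemma nat_interval_atLeastLessThan [simp]: "nat_interval {a..<b}"
  by (auto simp: nat_interval_def)

lemma nat_interval_singleton [simp]: "nat_interval {a}"
  by (auto simp: nat_interval_def)

lemma set_before_mono: "set_before A B \<Longrightarrow> A' \<subseteq> A \<Longrightarrow> B' \<subseteq> B \<Longrightarrow> set_before A' B'"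
  unfolding set_before_def by blast

lemma restr_UNIV [simp]: "restr UNIV x = x"
  by (simp add: restr_def)

lemma supp_restr: "supp (restr E x) = E \<inter> supp x"
  by (auto simp: restr_def supp_def)

lemma restr_id: "supp x \<subseteq> E \<Longrightarrow> restr E x = x"
  by (auto simp: restr_def supp_def fun_eq_iff)

lemma restr_c00: "x \<in> c00 \<Longrightarrow> restr E x \<in> c00"
  by (simp add: c00_def supp_restr)

lemma pairing_eq_sum: "finite S \<Longrightarrow> supp x \<subseteq> S \<Longrightarrow> pairing z x = (\<Sum>i\<in>S. z i * x i)"
  unfolding pairing_def by (rule sum.mono_neutral_left) (auto simp: supp_def)

lemma pairing_restr: "x \<in> c00 \<Longrightarrow> pairing (restr E z) x = pairing z (restr E x)"
proof -
  assume "x \<in> c00"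
  then have f: "finite (supp x)" by (simp add: c00_def)
  show ?thesis
    using pairing_eq_sum[OF f, of x "restr E z"] pairing_eq_sum[OF f, of "restr E x" z]
    by (auto simp: supp_restr) (auto simp: restr_def intro!: sum.cong)
qed

lemma pairing_restr_supp: "E \<inter> supp z = F \<inter> supp z \<Longrightarrow> x \<in> c00 \<Longrightarrow> pairing z (restr E x) = pairing z (restr F x)"
proof -
  assume a: "E \<inter> supp z = F \<inter> supp z" and x: "x \<in> c00"
  have "restr E z = restr F z" using a by (auto simp: restr_def supp_def fun_eq_iff)
  then show ?thesis using pairing_restr[OF x] by metis
qed

lemma pairing_add:
  assumes "x \<in> c00" "y \<in> c00"
  shows "pairing z (\<lambda>i. a * x i + b * y i) = a * pairing z x + b * pairing z y"
proof -
  let ?S = "supp x \<union> supp y"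
  have f: "finite ?S" using assms by (simp add: c00_def)
  have s: "supp (\<lambda>i. a * x i + b * y i) \<subseteq> ?S" by (auto simp: supp_def)
  show ?thesis
    by (simp add: pairing_eq_sum[OF f s] pairing_eq_sum[OF f, of x] pairing_eq_sum[OF f, of y]
      sum.distrib sum_distrib_left algebra_simps)
qed

lemma c00_lincomb: "x \<in> c00 \<Longrightarrow> y \<in> c00 \<Longrightarrow> (\<lambda>i. a * x i + b * y i) \<in> c00"
  unfolding c00_def mem_Collect_eq
  by (rule finite_subset[of _ "supp x \<union> supp y"]) (auto simp: supp_def)

lemma c00_zero [simp]: "(\<lambda>i. 0) \<in> c00"
  by (simp add: c00_def supp_def)

lemma c00_scale: "x \<in> c00 \<Longrightarrow> (\<lambda>i. a * x i) \<in> c00"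
  using c00_lincomb[of x x a 0] by simp

lemma c00_plus: "x \<in> c00 \<Longrightarrow> y \<in> c00 \<Longrightarrow> (\<lambda>i. x i + y i) \<in> c00"
  using c00_lincomb[of x y 1 1] by simp

lemma c00_sum: "(\<And>i. i \<in> I \<Longrightarrow> y i \<in> c00) \<Longrightarrow> (\<lambda>n. \<Sum>i\<in>I. y i n) \<in> c00"
  by (induction I rule: infinite_finite_induct) (auto intro: c00_plus)

lemma pairing_scale: "x \<in> c00 \<Longrightarrow> pairing z (\<lambda>i. a * x i) = a * pairing z x"
  using pairing_add[of x x z a 0] by simp

lemma pairing_zero_right [simp]: "pairing z (\<lambda>i. 0) = 0"
  by (simp add: pairing_def supp_def)

lemma pairing_sum: "(\<And>i. i \<in> I \<Longrightarrow> y i \<in> c00) \<Longrightarrow> pairing z (\<lambda>n. \<Sum>i\<in>I. y i n) = (\<Sum>i\<in>I. pairing z (y i))"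
proof (induction I rule: infinite_finite_induct)
  case (insert i I)
  then show ?case using pairing_add[of "y i" "\<lambda>n. \<Sum>i\<in>I. y i n" z 1 1] by (simp add: c00_sum)
qed auto

lemma pairing_scale_left: "pairing (\<lambda>n. a * z n) x = a * pairing z x"
  by (simp add: pairing_def sum_distrib_left mult.assoc)

lemma pairing_sum_left: "pairing (\<lambda>n. \<Sum>i\<in>I. a i * w i n) x = (\<Sum>i\<in>I. a i * pairing (w i) x)"
proof -
  have "pairing (\<lambda>n. \<Sum>i\<in>I. a i * w i n) x = (\<Sum>n\<in>supp x. \<Sum>i\<in>I. a i * (w i n * x n))"
    by (simp add: pairing_def sum_distrib_right mult.assoc)
  also have "\<dots> = (\<Sum>i\<in>I. a i * pairing (w i) x)"
    by (subst sum.swap) (simp add: pairing_def sum_distrib_left)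
  finally show ?thesis .
qed

lemma pairing_sum_list: "pairing (\<lambda>n. \<Sum>u\<leftarrow>us. F u n) x = (\<Sum>u\<leftarrow>us. pairing (F u) x)"
proof (induction us)
  case (Cons u us)
  then show ?case by (simp add: pairing_def sum.distrib distrib_right)
qed (simp add: pairing_def)

lemma pairing_eq_0: "supp z \<inter> supp x = {} \<Longrightarrow> pairing z x = 0"
  unfolding pairing_def by (rule sum.neutral) (auto simp: supp_def)

lemma restr_sum: "restr E (\<lambda>n. \<Sum>i\<in>I. y i n) = (\<lambda>n. \<Sum>i\<in>I. restr E (y i) n)"
  by (auto simp: restr_def)

lemma restr_scale: "restr E (\<lambda>n. a * z n) = (\<lambda>n. a * restr E z n)"
  by (auto simp: restr_def)

lemma restr_sum_list: "restr E (\<lambda>n. \<Sum>u\<leftarrow>us. F u n) = (\<lambda>n. \<Sum>u\<leftarrow>us. restr E (F u) n)"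
  by (induction us) (auto simp: restr_def fun_eq_iff)

lemma vec_before_restr: "vec_before u v \<Longrightarrow> vec_before (restr E u) (restr F v)"
  unfolding vec_before_def by (auto intro: set_before_mono simp: supp_restr)

definition avg :: "(nat \<Rightarrow> real) list \<Rightarrow> nat \<Rightarrow> real"
  where "avg us = (\<lambda>n. 1 / lf (real (length us)) * (\<Sum>u\<leftarrow>us. u n))"

lemma restr_avg: "restr E (avg us) = avg (map (restr E) us)"
  unfolding avg_def restr_scale restr_sum_list[of E "\<lambda>u. u" us] by (simp add: o_def)

lemma pairing_avg: "pairing (avg us) x = 1 / lf (real (length us)) * (\<Sum>u\<leftarrow>us. pairing u x)"
  unfolding avg_def pairing_scale_left using pairing_sum_list[of "\<lambda>u. u" us x] by simp

lemma sorted_wrt_concat: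
  "(\<And>xs. xs \<in> set xss \<Longrightarrow> sorted_wrt P xs) \<Longrightarrow>
   sorted_wrt (\<lambda>xs ys. \<forall>x\<in>set xs. \<forall>y\<in>set ys. P x y) xss \<Longrightarrow> sorted_wrt P (concat xss)"
  by (induction xss) (auto simp: sorted_wrt_append)

lemma sorted_wrt_vec_before_restr:
  "sorted_wrt vec_before us \<Longrightarrow> sorted_wrt vec_before (map (restr E) us)"
  unfolding sorted_wrt_map
  by (rule sorted_wrt_mono_rel[of us vec_before]) (auto intro: vec_before_restr)

text \<open>
  A relaxation of the norming set: the lengths of the groups of a special functional need not be
  coded, they only lie in \<open>J\<close> and repeat at most twice (the length \<open>m\<^sub>1 = j\<^sub>2\<^sub>l\<close> may also be
  a value of \<open>\<sigma>\<close>), and \<open>c\<close> stands for \<open>1 / sqrt (f l)\<close>, where \<open>f l \<ge> 256\<close>.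
\<close>

inductive_set relG :: "nat set \<Rightarrow> (nat \<Rightarrow> real) set" for J where
  base: "\<bar>c\<bar> \<le> 1 \<Longrightarrow> (\<lambda>i. if i = n then c else 0) \<in> relG J"
| conv: "(\<And>i. i \<in> {1..l::nat} \<Longrightarrow> w i \<in> relG J) \<Longrightarrow> (\<Sum>i=1..l. \<bar>a i\<bar>) \<le> 1 \<Longrightarrow>
    (\<lambda>n. \<Sum>i=1..l. a i * w i n) \<in> relG J"
| node: "us \<noteq> [] \<Longrightarrow> (\<And>u. u \<in> set us \<Longrightarrow> u \<in> relG J) \<Longrightarrow> sorted_wrt vec_before us \<Longrightarrow> avg us \<in> relG J"
| spec: "(\<And>us u. us \<in> set uss \<Longrightarrow> u \<in> set us \<Longrightarrow> u \<in> relG J) \<Longrightarrow> length ` set uss \<subseteq> J \<Longrightarrow>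
    sorted_wrt vec_before (concat uss) \<Longrightarrow> (\<And>m. length (filter (\<lambda>us. length us = m) uss) \<le> 2) \<Longrightarrow>
    0 \<le> c \<Longrightarrow> c \<le> 1 / 16 \<Longrightarrow> (\<lambda>n. c * (\<Sum>us\<leftarrow>uss. avg us n)) \<in> relG J"

lemma restr_spec: "restr E (\<lambda>n. c * (\<Sum>us\<leftarrow>uss. avg us n)) =
    (\<lambda>n. c * (\<Sum>us\<leftarrow>map (map (restr E)) uss. avg us n))"
  by (simp add: restr_scale restr_sum_list o_def restr_avg)

lemma length_filter_map_length:
  "length (filter (\<lambda>us. length us = m) (map (map f) uss)) = length (filter (\<lambda>us. length us = m) uss)"
  by (simp add: filter_map o_def)

lemma restr_relG: "z \<in> relG J \<Longrightarrow> restr E z \<in> relG J"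
proof (induction rule: relG.induct)
  case (base c n)
  have "restr E (\<lambda>i. if i = n then c else 0) = (\<lambda>i. if i = n then (if n \<in> E then c else 0) else 0)"
    by (auto simp: restr_def)
  then show ?case using relG.base[of "if n \<in> E then c else 0" n J] base by auto
next
  case (conv l w a)
  then show ?case using relG.conv[of l "\<lambda>i. restr E (w i)" J a] by (simp add: restr_sum restr_scale)
next
  case (node us)
  then show ?case unfolding restr_avg
    by (intro relG.node) (auto intro: sorted_wrt_vec_before_restr)
next
  case (spec uss c)
  show ?case unfolding restr_spec
    by (intro relG.spec)
       (use spec in \<open>auto simp: length_filter_map_length map_concat[symmetric] image_image
          o_def intro: sorted_wrt_vec_before_restr\<close>)
qed

text \<open>At a fixed coordinate at most one of the successive functionals is nonzero.\<close>

lemma sum_list_sorted_le_1: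
  assumes "sorted_wrt vec_before us" "\<And>u. u \<in> set us \<Longrightarrow> \<bar>u n\<bar> \<le> B" "0 \<le> B"
  shows "(\<Sum>u\<leftarrow>us. \<bar>u n\<bar>) \<le> B"
  using assms
proof (induction us)
  case (Cons u us)
  show ?case
  proof (cases "u n = 0")
    case True then show ?thesis using Cons by simp
  next
    case False
    have "v n = 0" if "v \<in> set us" for v
    proof (rule ccontr)
      assume "v n \<noteq> 0"
      moreover have "vec_before u v" using Cons that by auto
      ultimately show False using False unfolding vec_before_def set_before_def supp_def by auto
    qed
    then have "(\<Sum>u\<leftarrow>us. \<bar>u n\<bar>) = 0" by (induction us) auto
    then show ?thesis using Cons by simp
  qed
qed simp

lemma abs_avg_le:
  assumes "sorted_wrt vec_before us" "\<And>u. u \<in> set us \<Longrightarrow> \<bar>u n\<bar> \<le> 1" "us \<noteq> []"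
  shows "\<bar>avg us n\<bar> \<le> 1 / lf (real (length us))"
proof -
  have l: "1 \<le> lf (real (length us))" using assms(3) by (intro lf_ge_1) (simp add: Suc_le_eq)
  have "\<bar>\<Sum>u\<leftarrow>us. u n\<bar> \<le> (\<Sum>u\<leftarrow>us. \<bar>u n\<bar>)" by (induction us) auto
  also have "\<dots> \<le> 1" by (rule sum_list_sorted_le_1) (use assms in auto)
  finally show ?thesis using l unfolding avg_def by (simp add: abs_mult divide_right_mono)
qed

section \<open>Lacunarity of the set \<open>J\<close>\<close>

lemma GM_index_ge:
  assumes J: "GM_index_set J" and n: "n \<in> J"
  shows "256 \<le> lf (real n)"
proof -
  have "256 \<le> lf (real (LEAST n. n \<in> J))" using J by (simp add: GM_index_set_def)
  also have "\<dots> \<le> lf (real n)" by (rule lf_mono) (use n Least_le in auto)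
  finally show ?thesis .
qed

lemma GM_index_gt: "GM_index_set J \<Longrightarrow> n \<in> J \<Longrightarrow> 100 \<le> n"
proof (rule ccontr)
  assume a: "GM_index_set J" "n \<in> J" "\<not> 100 \<le> n"
  have "lf (real n) \<le> lf (2 ^ 7 - 1)" using a by (intro lf_mono) auto
  also have "\<dots> = 7" using lf_pow2[of 7] by simp
  finally show False using GM_index_ge[OF a(1,2)] by simp
qed

lemma two_powr_le_exp: "0 \<le> (x::real) \<Longrightarrow> 2 powr x \<le> exp x"
proof -
  assume x: "0 \<le> x"
  have "2 powr x \<le> exp 1 powr x" using x exp_ge_add_one_self[of "1::real"] by (intro powr_mono2) auto
  also have "\<dots> = exp x" by (simp add: powr_def)
  finally show ?thesis .
qed

text \<open>Since \<open>2 powr x <= exp x\<close>, the three natural logarithms of the gap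
  condition become three powers of 2; the term \<open>4 * n ^ 2\<close> leaves room for
  \<open>n + 1 = 2 powr lf n\<close>.\<close>

lemma GM_index_lacunary:
  assumes J: "GM_index_set J" and n: "n \<in> J" and m: "m \<in> J" and nm: "n < m"
  shows "2 powr (2 powr (2 powr (lf (real n)))) \<le> lf (real m)"
proof -
  have n100: "100 \<le> n" using GM_index_gt[OF J n] .
  have m100: "100 < real m" using n100 nm by simp
  have h: "4 * (real n)\<^sup>2 \<le> ln (ln (ln (real m)))"
    using J n m nm by (simp add: GM_index_set_def)
  have e3: "exp 1 \<le> (3::real)" using e_less_272 by simp
  have lm: "1 < ln (real m)"
  proof -
    have "ln (exp (1::real)) < ln (real m)" using e3 m100 by (subst ln_less_cancel_iff) auto
    then show ?thesis by simp
  qed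
  have llm: "0 < ln (ln (real m))" using lm by simp
  have "real n * 1 \<le> real n * real n" using n100 by (intro mult_left_mono) auto
  then have a: "real n + 1 \<le> 4 * (real n)\<^sup>2" using n100 unfolding power2_eq_square by linarith
  have "2 powr lf (real n) = real n + 1" by (simp add: two_powr_lf)
  then have "2 powr lf (real n) \<le> ln (ln (ln (real m)))" using a h by linarith
  then have "2 powr (2 powr lf (real n)) \<le> exp (ln (ln (ln (real m))))"
    using two_powr_le_exp[of "2 powr lf (real n)"] by (meson exp_le_cancel_iff order_trans powr_ge_zero)
  also have "\<dots> = ln (ln (real m))" using llm by simp
  finally have "2 powr (2 powr (2 powr lf (real n))) \<le> exp (ln (ln (real m)))"
    using two_powr_le_exp[of "2 powr (2 powr lf (real n))"] by (meson exp_le_cancel_iff order_trans powr_ge_zero)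
  also have "\<dots> = ln (real m)" using lm by simp
  also have "\<dots> \<le> ln (real m + 1)" using m100 by simp
  also have "\<dots> \<le> ln (real m + 1) / ln 2" using ln_2_less_1 m100 by (simp add: field_simps)
  also have "\<dots> = lf (real m)" by (simp add: lf_def log_def)
  finally show ?thesis .
qed

lemma ln_2_ge_half: "1 / 2 \<le> ln (2::real)"
proof -
  have "(exp (1 / 2 :: real))\<^sup>2 = exp 1" by (simp add: power2_eq_square flip: exp_add)
  also have "\<dots> \<le> 2\<^sup>2" using e_less_272 by simp
  finally have "exp (1 / 2 :: real) \<le> 2" by (rule power2_le_imp_le) simp
  then show ?thesis by (subst ln_ge_iff) auto
qed

text \<open>The tangent of \<open>2 powr x\<close> at 1 has slope \<open>2 * ln 2\<close>, which is
  at least 1.\<close>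

lemma two_powr_ge: "x + 1 \<le> 2 powr (x::real)" if "1 \<le> x" for x
proof -
  have "(x - 1) * (1 / 2) \<le> (x - 1) * ln 2" using that ln_2_ge_half by (intro mult_left_mono) auto
  then have "x + 1 \<le> 2 * (1 + (x - 1) * ln 2)" by argo
  also have "\<dots> \<le> 2 * exp ((x - 1) * ln 2)" using exp_ge_add_one_self[of "(x - 1) * ln 2"]
    by (intro mult_left_mono) auto
  also have "\<dots> = 2 powr x" by (simp add: powr_def algebra_simps exp_diff)
  finally show ?thesis .
qed

lemma GM_index_double:
  assumes J: "GM_index_set J" and n: "n \<in> J" and m: "m \<in> J" and nm: "n < m"
  shows "2 * lf (real n) \<le> lf (real m)"
proof -
  let ?x = "lf (real n)"
  have x: "256 \<le> ?x" using GM_index_ge[OF J n] .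
  have "2 * ?x \<le> 2 powr ?x"
  proof -
    have "2 * ?x = 2 * (?x - 1 + 1)" by simp
    also have "\<dots> \<le> 2 * 2 powr (?x - 1)" using two_powr_ge[of "?x - 1"] x by simp
    also have "\<dots> = 2 powr ?x" by (simp add: powr_diff)
    finally show ?thesis .
  qed
  also have "\<dots> \<le> 2 powr (2 powr ?x)" using two_powr_ge[of "2 powr ?x"] two_powr_ge[of ?x] x by linarith
  also have "\<dots> \<le> 2 powr (2 powr (2 powr ?x))"
    using two_powr_ge[of "2 powr (2 powr ?x)"] two_powr_ge[of "2 powr ?x"] two_powr_ge[of ?x] x by linarith
  also have "\<dots> \<le> lf (real m)" by (rule GM_index_lacunary[OF assms])
  finally show ?thesis .
qed

text \<open>Along \<open>J\<close> the values of \<open>lf\<close> at least double, so the sum is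
  dominated by a geometric series. The induction takes off the smallest element \<open>b\<close> and
  continues with \<open>2 * lf b\<close> in place of \<open>t\<close>.\<close>

lemma sum_inverse_lf_le:
  assumes J: "GM_index_set J" and S: "finite S" "S \<subseteq> J" and t: "0 < t" "\<And>m. m \<in> S \<Longrightarrow> t \<le> lf (real m)"
  shows "(\<Sum>m\<in>S. 1 / lf (real m)) \<le> 2 / t"
  using S t
proof (induction S arbitrary: t rule: finite_linorder_min_induct)
  case (insert b A)
  have "t \<le> lf (real b)" using insert.prems by simp
  then have b: "0 < lf (real b)" "t \<le> lf (real b)" using insert.prems(2) by linarith+
  have A: "A \<subseteq> J" using insert.prems by simp
  have db: "2 * lf (real b) \<le> lf (real m)" if "m \<in> A" for m
    using that insert.hyps insert.prems GM_index_double[OF J, of b m] by auto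
  have "0 < 2 * lf (real b)" using b by linarith
  then have "(\<Sum>m\<in>A. 1 / lf (real m)) \<le> 2 / (2 * lf (real b))"
    by (rule insert.IH[OF A _ db])
  moreover have "1 / lf (real b) \<le> 1 / t" using b insert.prems(2) by (intro divide_left_mono mult_pos_pos) linarith+
  moreover have "b \<notin> A" using insert by auto
  ultimately show ?case using insert.hyps by simp
qed simp

lemma sum_list_by_length:
  assumes "finite M" "length ` set uss \<subseteq> M"
  shows "(\<Sum>us\<leftarrow>uss. (h (length us) :: real)) = (\<Sum>m\<in>M. real (length (filter (\<lambda>us. length us = m) uss)) * h m)"
  using assms(2)
proof (induction uss)
  case (Cons us uss)
  have "(\<Sum>m\<in>M. real (length (filter (\<lambda>us. length us = m) (us # uss))) * h m) =
      (\<Sum>m\<in>M. real (length (filter (\<lambda>us. length us = m) uss)) * h m + (if length us = m then h m else 0))"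
    by (intro sum.cong) (auto simp: algebra_simps)
  also have "\<dots> = (\<Sum>m\<in>M. real (length (filter (\<lambda>us. length us = m) uss)) * h m) + h (length us)"
    using Cons.prems assms(1) by (simp add: sum.distrib)
  finally show ?case using Cons by simp
qed simp

lemma sum_list_le_twice:
  assumes mult: "\<And>m. length (filter (\<lambda>us. length us = m) uss) \<le> 2" and h: "\<And>m. 0 \<le> (h m :: real)"
  shows "(\<Sum>us\<leftarrow>uss. h (length us)) \<le> 2 * (\<Sum>m\<in>length ` set uss. h m)"
proof -
  have "(\<Sum>us\<leftarrow>uss. h (length us)) = (\<Sum>m\<in>length ` set uss. real (length (filter (\<lambda>us. length us = m) uss)) * h m)"
    by (rule sum_list_by_length) auto
  also have "\<dots> \<le> (\<Sum>m\<in>length ` set uss. 2 * h m)"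
    using mult h by (intro sum_mono mult_right_mono) (simp_all add: of_nat_le_iff[of _ 2, simplified])
  finally show ?thesis by (simp add: sum_distrib_left)
qed

lemma sum_list_inverse_lf_le:
  assumes J: "GM_index_set J" and S: "length ` set uss \<subseteq> J"
    and mult: "\<And>m. length (filter (\<lambda>us. length us = m) uss) \<le> 2"
    and t: "0 < t" "\<And>us. us \<in> set uss \<Longrightarrow> t \<le> lf (real (length us))"
  shows "(\<Sum>us\<leftarrow>uss. 1 / lf (real (length us))) \<le> 4 / t"
proof -
  have "(\<Sum>us\<leftarrow>uss. 1 / lf (real (length us))) \<le> 2 * (\<Sum>m\<in>length ` set uss. 1 / lf (real m))"
    by (rule sum_list_le_twice[OF mult]) (simp add: lf_def)
  also have "\<dots> \<le> 2 * (2 / t)"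
    by (intro mult_left_mono sum_inverse_lf_le[OF J]) (use S t in auto)
  finally show ?thesis by simp
qed

section \<open>The norm\<close>

definition GMs :: "nat set \<Rightarrow> ((nat \<Rightarrow> real) list \<Rightarrow> nat) \<Rightarrow> (nat \<Rightarrow> real) set"
  where "GMs J \<sigma> = (\<Union>k. GMstar J \<sigma> k)"

lemma GMstar_Suc_subset: "GMstar J \<sigma> k \<subseteq> GMstar J \<sigma> (Suc k)"
proof
  fix z assume z: "z \<in> GMstar J \<sigma> k"
  have "GM_form1 (GMstar J \<sigma> k) z" unfolding GM_form1_def
    by (rule exI[of _ 1], rule exI[of _ "\<lambda>_. 1"], rule exI[of _ "\<lambda>_. z"]) (use z in auto)
  then show "z \<in> GMstar J \<sigma> (Suc k)" using restr_UNIV[of z] by (auto intro!: exI[of _ UNIV])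
qed

lemma GMstar_mono: "k \<le> k' \<Longrightarrow> GMstar J \<sigma> k \<subseteq> GMstar J \<sigma> k'"
  by (rule lift_Suc_mono_le[of "GMstar J \<sigma>"]) (use GMstar_Suc_subset in auto)

text \<open>The levels increase, a functional being a form (1) combination of itself. That finitely
  many functionals share a level is what makes the union \<open>GMs\<close> closed under the
  forms.\<close>

lemma GMs_finite_level:
  assumes "finite A" "A \<subseteq> GMs J \<sigma>"
  shows "\<exists>k. A \<subseteq> GMstar J \<sigma> k"
  using assms
proof (induction A rule: finite_induct)
  case (insert a A)
  then obtain k k' where "A \<subseteq> GMstar J \<sigma> k" "a \<in> GMstar J \<sigma> k'" by (auto simp: GMs_def)
  then have "insert a A \<subseteq> GMstar J \<sigma> (max k k')"
    using GMstar_mono[of k "max k k'" J \<sigma>] GMstar_mono[of k' "max k k'" J \<sigma>] by auto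
  then show ?case by blast
qed simp

lemma GMstar_restr_form:
  assumes "GM_form1 (GMstar J \<sigma> k) z \<or> GM_form2 (GMstar J \<sigma> k) z \<or> GM_form3 J \<sigma> (GMstar J \<sigma> k) z" "nat_interval E"
  shows "restr E z \<in> GMs J \<sigma>"
proof -
  have "restr E z \<in> GMstar J \<sigma> (Suc k)" using assms by auto
  then show ?thesis unfolding GMs_def by blast
qed

lemma GMs_base: "\<bar>c\<bar> \<le> 1 \<Longrightarrow> (\<lambda>i. if i = n then c else 0) \<in> GMs J \<sigma>"
  unfolding GMs_def by (rule UN_I[of 0]) auto

lemma GMs_restr:
  assumes z: "z \<in> GMs J \<sigma>" and E: "nat_interval E"
  shows "restr E z \<in> GMs J \<sigma>"
proof -
  from z obtain k where z: "z \<in> GMstar J \<sigma> k" by (auto simp: GMs_def)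
  have "GM_form1 (GMstar J \<sigma> k) z" unfolding GM_form1_def
    by (rule exI[of _ 1], rule exI[of _ "\<lambda>_. 1"], rule exI[of _ "\<lambda>_. z"]) (use z in auto)
  then show ?thesis using E by (intro GMstar_restr_form) auto
qed

lemma GMs_conv:
  assumes w: "\<And>i. i \<in> {1..l::nat} \<Longrightarrow> w i \<in> GMs J \<sigma>" and a: "(\<Sum>i=1..l. \<bar>a i\<bar>) \<le> 1" and l: "1 \<le> l"
  shows "(\<lambda>n. \<Sum>i=1..l. a i * w i n) \<in> GMs J \<sigma>"
proof -
  obtain k where k: "w ` {1..l} \<subseteq> GMstar J \<sigma> k"
    using GMs_finite_level[of "w ` {1..l}" J \<sigma>] w by blast
  have "GM_form1 (GMstar J \<sigma> k) (\<lambda>n. \<Sum>i=1..l. a i * w i n)" unfolding GM_form1_def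
    by (rule exI[of _ l], rule exI[of _ a], rule exI[of _ w]) (use k a l in auto)
  then show ?thesis using GMstar_restr_form[of J \<sigma> k _ UNIV] by simp
qed

lemma GMs_scale: "z \<in> GMs J \<sigma> \<Longrightarrow> \<bar>a\<bar> \<le> 1 \<Longrightarrow> (\<lambda>n. a * z n) \<in> GMs J \<sigma>"
  using GMs_conv[of 1 "\<lambda>_. z" J \<sigma> "\<lambda>_. a"] by simp

lemma sum_list_indexed: "(\<Sum>u\<leftarrow>us. F u) = (\<Sum>i=1..length us. F (us ! (i - 1)))"
proof -
  have "(\<Sum>u\<leftarrow>us. F u) = (\<Sum>i=0..<length us. F (us ! i))"
    by (simp add: sum_list_sum_nth)
  also have "\<dots> = (\<Sum>i=1..length us. F (us ! (i - 1)))"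
    by (rule sum.reindex_bij_witness[of _ "\<lambda>i. i - 1" Suc]) auto
  finally show ?thesis .
qed

lemma GMs_avg:
  assumes us: "set us \<subseteq> GMs J \<sigma>" "us \<noteq> []" "sorted_wrt vec_before us"
  shows "avg us \<in> GMs J \<sigma>"
proof -
  obtain k where k: "set us \<subseteq> GMstar J \<sigma> k" using GMs_finite_level[of "set us" J \<sigma>] us by auto
  have "GM_form2 (GMstar J \<sigma> k) (avg us)" unfolding GM_form2_def
  proof (intro exI conjI ballI impI)
    show "1 \<le> length us" using us by (simp add: Suc_le_eq)
    fix i assume i: "i \<in> {1..length us}"
    then show "us ! (i - 1) \<in> GMstar J \<sigma> k" using k by (auto intro!: subsetD[OF k] nth_mem)
    fix j assume "j \<in> {1..length us}" "i < j"
    then show "vec_before (us ! (i - 1)) (us ! (j - 1))" using i us(3)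
      by (auto simp: sorted_wrt_iff_nth_less)
  qed (simp add: avg_def fun_eq_iff sum_list_indexed[of _ us])
  then show ?thesis using GMstar_restr_form[of J \<sigma> k _ UNIV] by simp
qed

lemma sum_eq_sum_list: "(\<Sum>i=1..l. F i) = (\<Sum>i\<leftarrow>[1..<Suc l]. F (i::nat))"
  by (simp add: interv_sum_list_conv_sum_set_nat atLeastLessThanSuc_atLeastAtMost del: upt_Suc)

lemma jelem_in: "infinite J \<Longrightarrow> jelem J n \<in> J"
  by (simp add: jelem_def enumerate_in_set)

lemma Kset_subset: "infinite J \<Longrightarrow> Kset J \<subseteq> J"
  by (auto simp: Kset_def jelem_in)

lemma Lset_subset: "infinite J \<Longrightarrow> Lset J \<subseteq> J"
  by (auto simp: Lset_def jelem_in)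

text \<open>The bound 1 serves twice: it makes the supremum in the norm finite, and it places the
  groups of a special functional in \<open>Qseq\<close>, where \<sigma> is injective. For special
  functionals it holds because all terms of all groups are successive.\<close>

lemma relG_abs_le: "z \<in> relG J \<Longrightarrow> GM_index_set J \<Longrightarrow> \<bar>z n\<bar> \<le> 1"
proof (induction rule: relG.induct)
  case (conv l w a)
  have "\<bar>\<Sum>i=1..l. a i * w i n\<bar> \<le> (\<Sum>i=1..l. \<bar>a i\<bar> * \<bar>w i n\<bar>)"
    by (rule order_trans[OF sum_abs]) (simp add: abs_mult)
  also have "\<dots> \<le> (\<Sum>i=1..l. \<bar>a i\<bar> * 1)" using conv by (intro sum_mono mult_left_mono) auto
  finally show ?case using conv by simp
next
  case (node us)
  have "1 \<le> lf (real (length us))" using node by (intro lf_ge_1) (simp add: Suc_le_eq)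
  moreover have "\<bar>avg us n\<bar> \<le> 1 / lf (real (length us))" using node by (intro abs_avg_le) auto
  moreover have "1 / lf (real (length us)) \<le> 1" using calculation(1) by (simp add: divide_simps)
  ultimately show ?case by linarith
next
  case (spec uss c)
  have l: "256 \<le> lf (real (length us))" if "us \<in> set uss" for us
    using that spec.hyps spec.prems by (intro GM_index_ge) auto
  have "(\<Sum>us\<leftarrow>uss. \<bar>avg us n\<bar>) \<le> (\<Sum>us\<leftarrow>uss. \<Sum>u\<leftarrow>us. \<bar>u n\<bar>)"
  proof (rule sum_list_mono)
    fix us assume us: "us \<in> set uss"
    have "\<bar>avg us n\<bar> = 1 / lf (real (length us)) * \<bar>\<Sum>u\<leftarrow>us. u n\<bar>" using l[OF us]
      by (simp add: avg_def abs_mult)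
    also have "\<dots> \<le> 1 * \<bar>\<Sum>u\<leftarrow>us. u n\<bar>" using l[OF us] by (intro mult_right_mono) auto
    also have "\<dots> \<le> (\<Sum>u\<leftarrow>us. \<bar>u n\<bar>)" by (induction us) auto
    finally show "\<bar>avg us n\<bar> \<le> (\<Sum>u\<leftarrow>us. \<bar>u n\<bar>)" .
  qed
  also have "\<dots> = (\<Sum>u\<leftarrow>concat uss. \<bar>u n\<bar>)" by (induction uss) auto
  also have "\<dots> \<le> 1" by (rule sum_list_sorted_le_1) (use spec in auto)
  finally have "(\<Sum>us\<leftarrow>uss. \<bar>avg us n\<bar>) \<le> 1" .
  moreover have "\<bar>\<Sum>us\<leftarrow>uss. avg us n\<bar> \<le> (\<Sum>us\<leftarrow>uss. \<bar>avg us n\<bar>)" by (induction uss) auto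
  ultimately show ?case using spec.hyps by (simp add: abs_mult mult_le_one)
qed auto

lemma c00_sum_list: "(\<And>u. u \<in> set us \<Longrightarrow> F u \<in> c00) \<Longrightarrow> (\<lambda>n. \<Sum>u\<leftarrow>us. F u n) \<in> c00"
  by (induction us) (auto intro: c00_plus)

lemma avg_c00: "(\<And>u. u \<in> set us \<Longrightarrow> u \<in> c00) \<Longrightarrow> avg us \<in> c00"
  unfolding avg_def by (intro c00_scale c00_sum_list) auto

lemma relG_c00: "z \<in> relG J \<Longrightarrow> z \<in> c00"
proof (induction rule: relG.induct)
  case (base c n)
  show ?case unfolding c00_def supp_def by (auto intro: finite_subset[of _ "{n}"])
next
  case (conv l w a)
  show ?case by (intro c00_sum c00_scale conv)
next
  case (spec uss c)
  show ?case by (intro c00_scale c00_sum_list avg_c00 spec)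
qed (auto intro: avg_c00)

text \<open>
  In a special functional the lengths of the groups lie in \<open>J\<close>, and, \<open>\<sigma>\<close> being injective,
  only the first of them can coincide with another one.
\<close>

lemma GM_form3_relG:
  assumes J: "GM_index_set J" and \<sigma>: "GM_coding J \<sigma>" and A: "A \<subseteq> relG J" and z: "GM_form3 J \<sigma> A z"
  shows "z \<in> relG J"
proof -
  have inf: "infinite J" using J by (simp add: GM_index_set_def)
  obtain l m v w where l: "l \<in> Kset J"
    and vA: "\<forall>i\<in>{1..l}. \<forall>k\<in>{1..m i}. v i k \<in> A"
    and vb: "\<forall>i\<in>{1..l}. \<forall>k\<in>{1..m i}. \<forall>i'\<in>{1..l}. \<forall>k'\<in>{1..m i'}.
         i < i' \<or> i = i' \<and> k < k' \<longrightarrow> vec_before (v i k) (v i' k')"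
    and w: "\<forall>i\<in>{1..l}. w i = (\<lambda>n. 1 / lf (real (m i)) * (\<Sum>k=1..m i. v i k n))"
    and rat: "\<forall>i\<in>{1..l}. \<forall>n. w i n \<in> \<rat>"
    and m1: "m 1 = jelem J (2 * l)"
    and ms: "\<forall>i\<in>{1..<l}. m (Suc i) = \<sigma> (map w [1..<Suc i])"
    and zeq: "z = (\<lambda>n. 1 / sqrt (lf (real l)) * (\<Sum>i=1..l. w i n))"
    using z unfolding GM_form3_def by blast
  define U where "U i = map (v i) [1..<Suc (m i)]" for i
  have lenU: "length (U i) = m i" for i by (simp add: U_def)
  have wU: "w i = avg (U i)" if "i \<in> {1..l}" for i
  proof -
    have "w i = (\<lambda>n. 1 / lf (real (m i)) * (\<Sum>k=1..m i. v i k n))" using that w by blast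
    then show ?thesis unfolding avg_def lenU unfolding U_def map_map o_def sum_eq_sum_list .
  qed
  have sU: "sorted_wrt vec_before (U i)" if "i \<in> {1..l}" for i
    unfolding U_def sorted_wrt_map
    by (rule sorted_wrt_mono_rel[of _ "(<)"]) (use vb that in \<open>auto simp del: upt_Suc\<close>)
  have inU: "u \<in> relG J" if "i \<in> {1..l}" "u \<in> set (U i)" for i u
    using that vA A by (auto simp: U_def simp del: upt_Suc)
  have l256: "256 \<le> lf (real l)" by (rule GM_index_ge[OF J]) (use l Kset_subset[OF inf] in auto)
  let ?S = "{zs. zs \<noteq> [] \<and> set zs \<subseteq> Qseq}"
  have inj: "inj_on \<sigma> ?S" and ran: "\<sigma> ` ?S \<subseteq> Lset J" using \<sigma> by (auto simp: GM_coding_def Let_def)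
  \<comment> \<open>The two claims support each other: earlier groups in \<open>Qseq\<close> make
    \<open>m i\<close> a value of \<sigma>, hence an element of \<open>J\<close>; and
    \<open>m i\<close> in \<open>J\<close> makes the group nonempty, so that \<open>w i\<close> lies
    in \<open>relG J\<close> and has coefficients at most 1.\<close>
  have mJ: "m i \<in> J \<and> w i \<in> Qseq" if "i \<in> {1..l}" for i
    using that
  proof (induction i rule: less_induct)
    case (less i)
    have "m i \<in> J"
    proof (cases "i = 1")
      case True then show ?thesis using m1 inf by (simp add: jelem_in)
    next
      case False
      then obtain i' where i': "i = Suc i'" "1 \<le> i'" "i' < l" using less.prems by (cases i) auto
      have "m i = \<sigma> (map w [1..<Suc i'])" using ms i' by (simp del: upt_Suc)
      moreover have "map w [1..<Suc i'] \<in> ?S" using less i' by (auto simp del: upt_Suc)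
      ultimately have "m i \<in> \<sigma> ` ?S" by (simp only: imageI)
      then have "m i \<in> Lset J" using ran by blast
      then show ?thesis using Lset_subset[OF inf] by auto
    qed
    then have "m i \<noteq> 0" using GM_index_gt[OF J] by fastforce
    then have "U i \<noteq> []" by (auto simp: U_def)
    then have "w i \<in> relG J" using less.prems wU sU inU by (auto intro!: relG.node)
    then have "w i \<in> Qseq" using less.prems rat relG_abs_le[OF _ J] relG_c00
      by (auto simp: Qseq_def)
    then show ?case using \<open>m i \<in> J\<close> by simp
  qed
  have inj_m: "i = i'" if "i \<in> {1..<l}" "i' \<in> {1..<l}" "m (Suc i) = m (Suc i')" for i i'
  proof -
    have "map w [1..<Suc i] \<in> ?S" "map w [1..<Suc i'] \<in> ?S" using mJ that by (auto simp del: upt_Suc)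
    moreover have "\<sigma> (map w [1..<Suc i]) = \<sigma> (map w [1..<Suc i'])" using ms that by (simp del: upt_Suc)
    ultimately have "map w [1..<Suc i] = map w [1..<Suc i']" using inj unfolding inj_on_def by blast
    then have "length (map w [1..<Suc i]) = length (map w [1..<Suc i'])" by metis
    then show ?thesis by (simp del: upt_Suc)
  qed
  define uss where "uss = map U [1..<Suc l]"
  have "z = (\<lambda>n. 1 / sqrt (lf (real l)) * (\<Sum>us\<leftarrow>uss. avg us n))"
  proof -
    have "(\<Sum>i=1..l. w i n) = (\<Sum>us\<leftarrow>uss. avg us n)" for n
    proof -
      have "(\<Sum>i=1..l. w i n) = (\<Sum>i=1..l. avg (U i) n)" using wU by (intro sum.cong) auto
      then show ?thesis unfolding uss_def map_map o_def sum_eq_sum_list .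
    qed
    then show ?thesis by (simp add: zeq)
  qed
  moreover have "(\<lambda>n. 1 / sqrt (lf (real l)) * (\<Sum>us\<leftarrow>uss. avg us n)) \<in> relG J"
  proof (rule relG.spec)
    show "u \<in> relG J" if "us \<in> set uss" "u \<in> set us" for us u
      using that inU by (auto simp: uss_def less_Suc_eq_le simp del: upt_Suc)
    show "length ` set uss \<subseteq> J" using mJ by (auto simp: uss_def lenU simp del: upt_Suc)
    show "sorted_wrt vec_before (concat uss)"
    proof (rule sorted_wrt_concat)
      show "sorted_wrt vec_before xs" if "xs \<in> set uss" for xs
        using that sU by (auto simp: uss_def simp del: upt_Suc)
      show "sorted_wrt (\<lambda>xs ys. \<forall>x\<in>set xs. \<forall>y\<in>set ys. vec_before x y) uss"
        unfolding uss_def sorted_wrt_map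
        by (rule sorted_wrt_mono_rel[of _ "(<)"]) (use vb in \<open>auto simp: U_def simp del: upt_Suc\<close>)
    qed
    show "length (filter (\<lambda>us. length us = k) uss) \<le> 2" for k
    proof -
      have "length (filter (\<lambda>us. length us = k) uss) = length (filter (\<lambda>i. m i = k) [1..<Suc l])"
        by (simp add: uss_def filter_map o_def lenU del: upt_Suc)
      also have "\<dots> = card (set (filter (\<lambda>i. m i = k) [1..<Suc l]))"
        by (rule distinct_card[symmetric]) (simp del: upt_Suc)
      also have "\<dots> \<le> card (insert 1 (Suc ` {i\<in>{1..<l}. m (Suc i) = k}))"
      proof (rule card_mono)
        show "set (filter (\<lambda>i. m i = k) [1..<Suc l]) \<subseteq> insert 1 (Suc ` {i\<in>{1..<l}. m (Suc i) = k})"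
        proof
          fix i assume "i \<in> set (filter (\<lambda>i. m i = k) [1..<Suc l])"
          then have i: "1 \<le> i" "i \<le> l" "m i = k" by auto
          show "i \<in> insert 1 (Suc ` {i\<in>{1..<l}. m (Suc i) = k})"
          proof (cases "i = 1")
            case False
            then obtain i' where i': "i = Suc i'" "i' \<in> {1..<l}" using i by (cases i) auto
            then show ?thesis using i by auto
          qed simp
        qed
      qed simp
      also have "\<dots> \<le> Suc (card (Suc ` {i\<in>{1..<l}. m (Suc i) = k}))" by (simp add: card_insert_if)
      also have "card (Suc ` {i\<in>{1..<l}. m (Suc i) = k}) \<le> card {i\<in>{1..<l}. m (Suc i) = k}"
        by (rule card_image_le) simp
      also have "card {i\<in>{1..<l}. m (Suc i) = k} \<le> Suc 0"
      proof (subst card_le_Suc0_iff_eq, simp, intro ballI)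
        fix i i' assume "i \<in> {i\<in>{1..<l}. m (Suc i) = k}" "i' \<in> {i\<in>{1..<l}. m (Suc i) = k}"
        then show "i = i'" using inj_m[of i i'] by simp
      qed
      finally show ?thesis by simp
    qed
    have "16 \<le> sqrt (lf (real l))" using l256 by (intro real_le_rsqrt) simp
    then show "0 \<le> 1 / sqrt (lf (real l))" "1 / sqrt (lf (real l)) \<le> 1 / 16"
      using l256 by (auto simp: divide_simps)
  qed
  ultimately show ?thesis by simp
qed

lemma GMstar_subset_relG:
  assumes J: "GM_index_set J" and \<sigma>: "GM_coding J \<sigma>"
  shows "GMstar J \<sigma> k \<subseteq> relG J"
proof (induction k)
  case 0
  show ?case by (auto intro: relG.base)
next
  case (Suc k)
  show ?case
  proof
    fix y assume "y \<in> GMstar J \<sigma> (Suc k)"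
    then obtain E z where y: "y = restr E z"
      and "GM_form1 (GMstar J \<sigma> k) z \<or> GM_form2 (GMstar J \<sigma> k) z \<or> GM_form3 J \<sigma> (GMstar J \<sigma> k) z" by auto
    then consider "GM_form1 (GMstar J \<sigma> k) z" | "GM_form2 (GMstar J \<sigma> k) z" | "GM_form3 J \<sigma> (GMstar J \<sigma> k) z" by auto
    then have "z \<in> relG J"
    proof cases
      case 1
      then obtain l a w where "1 \<le> l" and a: "(\<Sum>i=1..l. \<bar>a i\<bar>) \<le> (1::real)"
        and w: "\<forall>i\<in>{1..l::nat}. w i \<in> GMstar J \<sigma> k" and z: "z = (\<lambda>n. \<Sum>i=1..l. a i * w i n)"
        unfolding GM_form1_def by blast
      show ?thesis unfolding z by (rule relG.conv[OF _ a]) (use w Suc in blast)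
    next
      case 2
      then obtain l w where l: "1 \<le> l" and w: "\<forall>i\<in>{1..l}. w i \<in> GMstar J \<sigma> k"
        and b: "\<forall>i\<in>{1..l}. \<forall>k\<in>{1..l}. i < k \<longrightarrow> vec_before (w i) (w k)"
        and z: "z = (\<lambda>n. 1 / lf (real l) * (\<Sum>i=1..l. w i n))" unfolding GM_form2_def by blast
      have "z = avg (map w [1..<Suc l])" unfolding z avg_def map_map o_def sum_eq_sum_list by (simp del: upt_Suc)
      moreover have "avg (map w [1..<Suc l]) \<in> relG J"
      proof (rule relG.node)
        show "sorted_wrt vec_before (map w [1..<Suc l])" unfolding sorted_wrt_map
          by (rule sorted_wrt_mono_rel[of _ "(<)"]) (use b in \<open>auto simp del: upt_Suc\<close>)
      qed (use l w Suc in \<open>auto simp del: upt_Suc\<close>)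
      ultimately show ?thesis by simp
    next
      case 3
      then show ?thesis using GM_form3_relG[OF J \<sigma> Suc] by simp
    qed
    then show "y \<in> relG J" unfolding y by (rule restr_relG)
  qed
qed

lemma GMs_subset_relG: "GM_index_set J \<Longrightarrow> GM_coding J \<sigma> \<Longrightarrow> GMs J \<sigma> \<subseteq> relG J"
  using GMstar_subset_relG unfolding GMs_def by blast

lemma pairing_bound:
  assumes "\<And>n. \<bar>z n\<bar> \<le> 1"
  shows "\<bar>pairing z x\<bar> \<le> (\<Sum>i\<in>supp x. \<bar>x i\<bar>)"
proof -
  have "\<bar>pairing z x\<bar> \<le> (\<Sum>i\<in>supp x. \<bar>z i\<bar> * \<bar>x i\<bar>)"
    unfolding pairing_def by (rule order_trans[OF sum_abs]) (simp add: abs_mult)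
  also have "\<dots> \<le> (\<Sum>i\<in>supp x. 1 * \<bar>x i\<bar>)" using assms by (intro sum_mono mult_right_mono) auto
  finally show ?thesis by simp
qed

section \<open>Elementary properties of the norm\<close>

locale GM =
  fixes J :: "nat set" and \<sigma> :: "(nat \<Rightarrow> real) list \<Rightarrow> nat"
  assumes J: "GM_index_set J" and \<sigma>: "GM_coding J \<sigma>"
begin

abbreviation nrm :: "(nat \<Rightarrow> real) \<Rightarrow> real" where "nrm \<equiv> GM_norm J \<sigma>"

lemma GMs_relG: "z \<in> GMs J \<sigma> \<Longrightarrow> z \<in> relG J"
  using GMs_subset_relG[OF J \<sigma>] by blast

lemma bdd_pairing: "bdd_above ((\<lambda>z. pairing z x) ` GMs J \<sigma>)"
proof (rule bdd_aboveI2)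
  fix z assume "z \<in> GMs J \<sigma>"
  then have "\<bar>pairing z x\<bar> \<le> (\<Sum>i\<in>supp x. \<bar>x i\<bar>)"
    using relG_abs_le[OF GMs_relG J] by (intro pairing_bound)
  then show "pairing z x \<le> (\<Sum>i\<in>supp x. \<bar>x i\<bar>)" by simp
qed

lemma nrm_def': "nrm x = (SUP z\<in>GMs J \<sigma>. pairing z x)"
  by (simp add: GM_norm_def GMs_def)

lemma zero_in_GMs: "(\<lambda>i. 0) \<in> GMs J \<sigma>"
  using GMs_base[of 0 0 J \<sigma>] by simp

lemma nrm_ge: "z \<in> GMs J \<sigma> \<Longrightarrow> \<bar>pairing z x\<bar> \<le> nrm x"
proof -
  assume z: "z \<in> GMs J \<sigma>"
  have "pairing w x \<le> nrm x" if "w \<in> GMs J \<sigma>" for w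
    unfolding nrm_def' using that bdd_pairing by (intro cSUP_upper)
  from this[OF z] this[OF GMs_scale[OF z, of "-1"]] show ?thesis
    by (simp add: pairing_scale_left[of "-1", simplified])
qed

lemma nrm_le: "(\<And>z. z \<in> GMs J \<sigma> \<Longrightarrow> pairing z x \<le> B) \<Longrightarrow> nrm x \<le> B"
  unfolding nrm_def' using zero_in_GMs by (intro cSUP_least) auto

lemma nrm_approx:
  assumes "0 < e" shows "\<exists>z\<in>GMs J \<sigma>. nrm x - e \<le> pairing z x"
proof (rule ccontr)
  assume "\<not> ?thesis"
  then have "nrm x \<le> nrm x - e" by (intro nrm_le) auto
  then show False using assms by simp
qed

lemma nrm_nonneg: "0 \<le> nrm x"
  using nrm_ge[OF zero_in_GMs, of x] by simp

lemma nrm_sum: "(\<And>i. i \<in> I \<Longrightarrow> y i \<in> c00) \<Longrightarrow> nrm (\<lambda>n. \<Sum>i\<in>I. y i n) \<le> (\<Sum>i\<in>I. nrm (y i))"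
proof (rule nrm_le)
  fix z assume y: "\<And>i. i \<in> I \<Longrightarrow> y i \<in> c00" and z: "z \<in> GMs J \<sigma>"
  have "pairing z (\<lambda>n. \<Sum>i\<in>I. y i n) = (\<Sum>i\<in>I. pairing z (y i))" using y by (rule pairing_sum)
  also have "\<dots> \<le> (\<Sum>i\<in>I. nrm (y i))" using nrm_ge[OF z] by (intro sum_mono) (simp add: abs_le_iff)
  finally show "pairing z (\<lambda>n. \<Sum>i\<in>I. y i n) \<le> (\<Sum>i\<in>I. nrm (y i))" .
qed

lemma nrm_coord: "x \<in> c00 \<Longrightarrow> \<bar>x n\<bar> \<le> nrm x"
proof -
  assume x: "x \<in> c00"
  have "pairing (\<lambda>i. if i = n then 1 else 0) x = (\<Sum>i\<in>insert n (supp x). (if i = n then 1 else 0) * x i)"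
    using x by (intro pairing_eq_sum) (auto simp: c00_def)
  also have "\<dots> = (\<Sum>i\<in>insert n (supp x). (if i = n then x i else 0))" by (intro sum.cong) auto
  also have "\<dots> = x n" using x by (simp add: c00_def)
  finally show ?thesis using nrm_ge[OF GMs_base[of 1 n], of x] by simp
qed

text \<open>Form (2), dualised.\<close>

lemma sum_list_pairing_le:
  assumes ws: "set ws \<subseteq> GMs J \<sigma>" "sorted_wrt vec_before ws" "ws \<noteq> []"
    and P: "nat_interval P" "\<And>w. w \<in> set ws \<Longrightarrow> supp w \<subseteq> P" and x: "x \<in> c00"
  shows "(\<Sum>w\<leftarrow>ws. \<bar>pairing w x\<bar>) \<le> lf (real (length ws)) * nrm (restr P x)"
proof -
  define us where "us = map (\<lambda>w n. sgn (pairing w x) * w n) ws"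
  have "avg us \<in> GMs J \<sigma>"
  proof (rule GMs_avg)
    show "set us \<subseteq> GMs J \<sigma>" using ws by (auto simp: us_def intro!: GMs_scale simp: abs_sgn_eq)
    show "sorted_wrt vec_before us" unfolding us_def sorted_wrt_map
      by (rule sorted_wrt_mono_rel[OF _ ws(2)]) (auto simp: vec_before_def supp_def set_before_def)
  qed (use ws in \<open>simp add: us_def\<close>)
  then have "\<bar>pairing (avg us) (restr P x)\<bar> \<le> nrm (restr P x)" by (rule nrm_ge)
  moreover have "pairing (avg us) (restr P x) = 1 / lf (real (length ws)) * (\<Sum>w\<leftarrow>ws. \<bar>pairing w x\<bar>)"
  proof -
    have "(\<Sum>u\<leftarrow>us. pairing u (restr P x)) = (\<Sum>w\<leftarrow>ws. \<bar>pairing w x\<bar>)"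
      unfolding us_def map_map o_def
    proof (intro arg_cong[of _ _ sum_list] map_cong refl)
      fix w assume w: "w \<in> set ws"
      have "pairing w (restr P x) = pairing w x"
        using pairing_restr[OF x, of P w] restr_id[OF P(2)[OF w]] by simp
      then show "pairing (\<lambda>n. sgn (pairing w x) * w n) (restr P x) = \<bar>pairing w x\<bar>"
        by (subst pairing_scale_left) (simp add: abs_sgn mult.commute)
    qed
    then show ?thesis by (simp add: pairing_avg us_def)
  qed
  moreover have "1 \<le> lf (real (length ws))" using ws by (intro lf_ge_1) (simp add: Suc_le_eq)
  ultimately show ?thesis by (simp add: divide_simps mult.commute split: if_splits)
qed

text \<open>The lower estimate of Schlumprecht type. Almost norming functionals of the pieces, cut
  down to these intervals, are successive and can be averaged; the total error \<open>e\<close> is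
  shared equally among them.\<close>

lemma sum_list_nrm_le:
  assumes Es: "\<And>E. E \<in> set Es \<Longrightarrow> nat_interval E \<and> E \<subseteq> P" "sorted_wrt set_before Es" "Es \<noteq> []"
    and P: "nat_interval P" and x: "x \<in> c00"
  shows "(\<Sum>E\<leftarrow>Es. nrm (restr E x)) \<le> lf (real (length Es)) * nrm (restr P x)"
proof (rule field_le_epsilon)
  fix e :: real assume e: "0 < e"
  let ?d = "e / length Es"
  have d: "0 < ?d" using e Es(3) by simp
  have "\<forall>E. \<exists>z. z \<in> GMs J \<sigma> \<and> nrm (restr E x) - ?d \<le> pairing z (restr E x)"
  proof
    fix E
    show "\<exists>z. z \<in> GMs J \<sigma> \<and> nrm (restr E x) - ?d \<le> pairing z (restr E x)"
      using nrm_approx[OF d, of "restr E x"] by auto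
  qed
  from choice[OF this] obtain zf
    where zf: "\<And>E. zf E \<in> GMs J \<sigma> \<and> nrm (restr E x) - ?d \<le> pairing (zf E) (restr E x)" by auto
  let ?ws = "map (\<lambda>E. restr E (zf E)) Es"
  have "(\<Sum>E\<leftarrow>Es. nrm (restr E x)) \<le> (\<Sum>E\<leftarrow>Es. \<bar>pairing (restr E (zf E)) x\<bar> + ?d)"
  proof (rule sum_list_mono)
    fix E
    have "pairing (restr E (zf E)) x = pairing (zf E) (restr E x)" by (rule pairing_restr[OF x])
    then show "nrm (restr E x) \<le> \<bar>pairing (restr E (zf E)) x\<bar> + ?d" using zf[of E] by linarith
  qed
  also have "\<dots> = (\<Sum>w\<leftarrow>?ws. \<bar>pairing w x\<bar>) + e"
    using Es(3) by (simp add: sum_list_addf o_def sum_list_triv)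
  also have "(\<Sum>w\<leftarrow>?ws. \<bar>pairing w x\<bar>) \<le> lf (real (length ?ws)) * nrm (restr P x)"
  proof (rule sum_list_pairing_le)
    show "set ?ws \<subseteq> GMs J \<sigma>" using zf Es by (auto intro: GMs_restr)
    show "sorted_wrt vec_before ?ws" unfolding sorted_wrt_map
      by (rule sorted_wrt_mono_rel[OF _ Es(2)]) (auto simp: vec_before_def supp_restr set_before_def)
    show "supp w \<subseteq> P" if "w \<in> set ?ws" for w using that Es by (force simp: supp_restr)
  qed (use Es P x in auto)
  finally show "(\<Sum>E\<leftarrow>Es. nrm (restr E x)) \<le> lf (real (length Es)) * nrm (restr P x) + e" by simp
qed

lemma nrm_restr_mono:
  "nat_interval E \<Longrightarrow> E \<subseteq> P \<Longrightarrow> nat_interval P \<Longrightarrow> x \<in> c00 \<Longrightarrow> nrm (restr E x) \<le> nrm (restr P x)"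
  using sum_list_nrm_le[of "[E]" P x] by simp

end

section \<open>Rapidly increasing sequences\<close>

definition nodel :: "nat set \<Rightarrow> (nat \<Rightarrow> real) list \<Rightarrow> bool"
  where "nodel J us \<longleftrightarrow> us \<noteq> [] \<and> set us \<subseteq> relG J \<and> sorted_wrt vec_before us"

definition specl :: "nat set \<Rightarrow> (nat \<Rightarrow> real) list list \<Rightarrow> bool"
  where "specl J uss \<longleftrightarrow> (\<forall>us\<in>set uss. set us \<subseteq> relG J) \<and> length ` set uss \<subseteq> J \<and>
    sorted_wrt vec_before (concat uss) \<and> (\<forall>m. length (filter (\<lambda>us. length us = m) uss) \<le> 2)"

definition specf :: "real \<Rightarrow> (nat \<Rightarrow> real) list list \<Rightarrow> nat \<Rightarrow> real"
  where "specf c uss = (\<lambda>n. c * (\<Sum>us\<leftarrow>uss. avg us n))"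

lemma pairing_specf: "pairing (specf c uss) x = c * (\<Sum>us\<leftarrow>uss. pairing (avg us) x)"
  unfolding specf_def pairing_scale_left pairing_sum_list by simp

lemma restr_specf: "restr E (specf c uss) = specf c (map (map (restr E)) uss)"
  unfolding specf_def restr_spec ..

lemma nodel_relG: "nodel J us \<Longrightarrow> avg us \<in> relG J"
  by (auto simp: nodel_def intro: relG.node)

lemma specl_relG: "specl J uss \<Longrightarrow> 0 \<le> c \<Longrightarrow> c \<le> 1 / 16 \<Longrightarrow> specf c uss \<in> relG J"
  unfolding specf_def specl_def by (intro relG.spec) auto

lemma nodel_restr: "nodel J us \<Longrightarrow> nodel J (map (restr E) us)"
  by (auto simp: nodel_def restr_relG sorted_wrt_vec_before_restr)

lemma specl_restr: "specl J uss \<Longrightarrow> specl J (map (map (restr E)) uss)"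
  unfolding specl_def
  by (auto simp: length_filter_map_length map_concat[symmetric] image_image o_def
      intro: sorted_wrt_vec_before_restr intro!: restr_relG)

lemma sorted_wrt_concat_elem: "sorted_wrt P (concat xss) \<Longrightarrow> xs \<in> set xss \<Longrightarrow> sorted_wrt P xs"
  by (induction xss) (auto simp: sorted_wrt_append)

lemma sorted_wrt_concat_filter: "sorted_wrt P (concat xss) \<Longrightarrow> sorted_wrt P (concat (filter Q xss))"
  by (induction xss) (auto simp: sorted_wrt_append)

lemma length_filter_filter: "length (filter P (filter Q xs)) \<le> length (filter P xs)"
  by (induction xs) auto

lemma specl_filter: "specl J uss \<Longrightarrow> specl J (filter Q uss)"
proof -
  assume a: "specl J uss"
  have "length (filter (\<lambda>us. length us = m) (filter Q uss)) \<le> 2" for m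
    using a length_filter_filter[of "\<lambda>us. length us = m" Q uss] order_trans unfolding specl_def by blast
  then show ?thesis using a unfolding specl_def by (auto simp: sorted_wrt_concat_filter)
qed

lemma specl_nodel: "GM_index_set J \<Longrightarrow> specl J uss \<Longrightarrow> us \<in> set uss \<Longrightarrow> nodel J us"
  unfolding specl_def nodel_def using GM_index_gt[of J "length us"]
  by (fastforce intro: sorted_wrt_concat_elem)

lemma specl_ge: "GM_index_set J \<Longrightarrow> specl J uss \<Longrightarrow> us \<in> set uss \<Longrightarrow> 256 \<le> lf (real (length us))"
  unfolding specl_def by (intro GM_index_ge) auto

lemma specf_split: "pairing (specf c uss) x = pairing (specf c (filter Q uss)) x + pairing (specf c (filter (\<lambda>us. \<not> Q us) uss)) x"
  unfolding pairing_specf by (induction uss) (auto simp: algebra_simps)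

lemma abs_sum_list_le: "\<bar>\<Sum>u\<leftarrow>us. F u\<bar> \<le> (\<Sum>u\<leftarrow>us. \<bar>F u :: real\<bar>)"
  by (induction us) auto

lemma lf_length_ge_1: "us \<noteq> [] \<Longrightarrow> 1 \<le> lf (real (length us))"
  by (intro lf_ge_1) (simp add: Suc_le_eq)

lemma abs_pairing_avg_le: "us \<noteq> [] \<Longrightarrow> \<bar>pairing (avg us) x\<bar> \<le> (\<Sum>u\<leftarrow>us. \<bar>pairing u x\<bar>) / lf (real (length us))"
proof -
  assume "us \<noteq> []"
  then have "0 < lf (real (length us))" using lf_length_ge_1[of us] by linarith
  then show ?thesis unfolding pairing_avg
    by (simp add: abs_mult divide_right_mono abs_sum_list_le)
qed

text \<open>The part of \<open>E\<close> that \<open>u\<close> can see, filled up to an interval,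
  because the norming set is only stable under restriction to intervals. Successive functionals have
  successive pieces.\<close>

definition piece :: "nat set \<Rightarrow> (nat \<Rightarrow> real) \<Rightarrow> nat set"
  where "piece E u = E \<inter> ihull (supp u)"

lemma piece_subset: "piece E u \<subseteq> E"
  by (simp add: piece_def)

lemma nat_interval_piece: "nat_interval E \<Longrightarrow> nat_interval (piece E u)"
  by (simp add: piece_def nat_interval_Int)

lemma pairing_piece: "x \<in> c00 \<Longrightarrow> pairing u (restr E x) = pairing u (restr (piece E u) x)"
  by (rule pairing_restr_supp) (use ihull_superset[of "supp u"] in \<open>auto simp: piece_def\<close>)

lemma sorted_piece: "sorted_wrt vec_before us \<Longrightarrow> sorted_wrt set_before (map (piece E) us)"
  unfolding sorted_wrt_map
proof (rule sorted_wrt_mono_rel[of us vec_before])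
  fix u v assume "vec_before u v"
  then have "set_before (ihull (supp u)) (ihull (supp v))" by (intro set_before_ihull) (simp add: vec_before_def)
  then show "set_before (piece E u) (piece E v)" by (rule set_before_mono) (auto simp: piece_def)
qed

text \<open>
  \<open>good J C a p d y\<close>: relative to \<open>relG J\<close> the vector \<open>y\<close> has norm at most \<open>C\<close>, it behaves like an
  \<open>l\<^sub>1\<close>-average for at most \<open>l\<close> successive functionals if \<open>f l \<le> a\<close>, and averages of length \<open>l\<close>
  with \<open>f l \<ge> p\<close> nearly vanish on it. Only lengths with \<open>a < f l < p\<close> are dangerous.
\<close>

definition good :: "nat set \<Rightarrow> real \<Rightarrow> real \<Rightarrow> real \<Rightarrow> real \<Rightarrow> (nat \<Rightarrow> real) \<Rightarrow> bool"
  where "good J C a p d y \<longleftrightarrow> y \<in> c00 \<and>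
    (\<forall>us. nodel J us \<longrightarrow> lf (real (length us)) \<le> a \<longrightarrow> (\<Sum>u\<leftarrow>us. \<bar>pairing u y\<bar>) \<le> C) \<and>
    (\<forall>u\<in>relG J. \<bar>pairing u y\<bar> \<le> C) \<and>
    (\<forall>us. nodel J us \<longrightarrow> p \<le> lf (real (length us)) \<longrightarrow> \<bar>pairing (avg us) y\<bar> \<le> d) \<and>
    (\<forall>uss c. specl J uss \<longrightarrow> (\<forall>us\<in>set uss. p \<le> lf (real (length us))) \<longrightarrow> 0 \<le> c \<longrightarrow> c \<le> 1 / 16 \<longrightarrow>
      \<bar>pairing (specf c uss) y\<bar> \<le> d)"

lemma good_c00: "good J C a p d y \<Longrightarrow> y \<in> c00"
  by (simp add: good_def)

lemma good_norm: "good J C a p d y \<Longrightarrow> u \<in> relG J \<Longrightarrow> \<bar>pairing u (restr E y)\<bar> \<le> C"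
  using pairing_restr[of y E u] restr_relG[of u J E] unfolding good_def by auto

lemma good_node_small:
  assumes "good J C a p d y" "nodel J us" "lf (real (length us)) \<le> a"
  shows "\<bar>pairing (avg us) (restr E y)\<bar> \<le> C / lf (real (length us))"
proof -
  have n: "nodel J (map (restr E) us)" using assms by (intro nodel_restr)
  have "\<bar>pairing (avg (map (restr E) us)) y\<bar> \<le> (\<Sum>u\<leftarrow>map (restr E) us. \<bar>pairing u y\<bar>) / lf (real (length us))"
    using abs_pairing_avg_le[of "map (restr E) us" y] n by (simp add: nodel_def)
  also have "\<dots> \<le> C / lf (real (length us))"
  proof (rule divide_right_mono)
    have "lf (real (length (map (restr E) us))) \<le> a" using assms by simp
    then show "(\<Sum>u\<leftarrow>map (restr E) us. \<bar>pairing u y\<bar>) \<le> C" using assms(1) n unfolding good_def by blast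
  qed (use lf_length_ge_1[of us] assms(2) in \<open>simp add: nodel_def\<close>)
  finally show ?thesis using pairing_restr[OF good_c00[OF assms(1)], of E "avg us"] by (simp add: restr_avg)
qed

lemma good_node_large:
  assumes "good J C a p d y" "nodel J us" "p \<le> lf (real (length us))"
  shows "\<bar>pairing (avg us) (restr E y)\<bar> \<le> d"
  using assms nodel_restr[OF assms(2), of E] pairing_restr[OF good_c00[OF assms(1)], of E "avg us"]
  unfolding good_def restr_avg by (metis length_map)

lemma good_spec_large:
  assumes "good J C a p d y" "specl J uss" "\<And>us. us \<in> set uss \<Longrightarrow> p \<le> lf (real (length us))" "0 \<le> c" "c \<le> 1 / 16"
  shows "\<bar>pairing (specf c uss) (restr E y)\<bar> \<le> d"
proof -
  have "\<forall>us\<in>set (map (map (restr E)) uss). p \<le> lf (real (length us))" using assms(3) by auto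
  then have "\<bar>pairing (specf c (map (map (restr E)) uss)) y\<bar> \<le> d"
    using assms specl_restr[OF assms(2), of E] unfolding good_def by blast
  then show ?thesis using pairing_restr[OF good_c00[OF assms(1)], of E "specf c uss"] by (simp add: restr_specf)
qed

definition touch :: "(nat \<Rightarrow> nat \<Rightarrow> real) \<Rightarrow> nat \<Rightarrow> nat set \<Rightarrow> nat set"
  where "touch y N E = {i\<in>{1..N}. E \<inter> supp (y i) \<noteq> {}}"

lemma finite_touch [simp]: "finite (touch y N E)"
  by (simp add: touch_def)

lemma card_touch_le: "card (touch y N E) \<le> N"
proof -
  have "card (touch y N E) \<le> card {1..N}" by (intro card_mono) (auto simp: touch_def)
  then show ?thesis by simp
qed

text \<open>Successive sets share at most one vector, the one lying across their common boundary. So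
  every further set costs at most one double count.\<close>

lemma sum_card_touch:
  assumes y: "\<And>i j. i \<in> {1..N} \<Longrightarrow> j \<in> {1..N} \<Longrightarrow> i < j \<Longrightarrow> vec_before (y i) (y j)"
    and Es: "sorted_wrt set_before Es" "\<And>F. F \<in> set Es \<Longrightarrow> F \<subseteq> E"
  shows "(\<Sum>F\<leftarrow>Es. card (touch y N F)) \<le> card (touch y N E) + length Es"
  using Es
proof (induction Es arbitrary: E)
  case (Cons F Es)
  let ?U = "\<Union>(set Es)"
  have IH: "(\<Sum>F\<leftarrow>Es. card (touch y N F)) \<le> card (touch y N ?U) + length Es"
    using Cons by (intro Cons.IH) auto
  have le: "i \<le> j" if "i \<in> touch y N F" "j \<in> touch y N ?U" for i j
  proof (rule ccontr)
    assume "\<not> i \<le> j"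
    then have "vec_before (y j) (y i)" using that by (intro y) (auto simp: touch_def)
    moreover obtain s t where "s \<in> F" "s \<in> supp (y i)" "t \<in> ?U" "t \<in> supp (y j)"
      using \<open>i \<in> _\<close> \<open>j \<in> _\<close> by (auto simp: touch_def)
    moreover from this Cons.prems(1) have "s < t" by (auto simp: set_before_def)
    ultimately show False unfolding vec_before_def set_before_def using order.asym by blast
  qed
  have "card (touch y N F \<inter> touch y N ?U) \<le> 1"
  proof -
    have "i = j" if "i \<in> touch y N F \<inter> touch y N ?U" "j \<in> touch y N F \<inter> touch y N ?U" for i j
      using le[of i j] le[of j i] that by auto
    then show ?thesis unfolding One_nat_def by (subst card_le_Suc0_iff_eq) auto
  qed
  moreover have "touch y N F \<union> touch y N ?U \<subseteq> touch y N E"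
    using Cons.prems(2) by (fastforce simp: touch_def)
  then have "card (touch y N F \<union> touch y N ?U) \<le> card (touch y N E)" by (intro card_mono) auto
  moreover have "card (touch y N F) + card (touch y N ?U) = card (touch y N F \<union> touch y N ?U) + card (touch y N F \<inter> touch y N ?U)"
    by (rule card_Un_Int) auto
  ultimately show ?case using IH by simp
qed simp

text \<open>A rapidly increasing sequence. By \<open>ap\<close> the dangerous windows between
  \<open>a i\<close> and \<open>p i\<close> do not overlap, so a given length is dangerous for at
  most one vector; by \<open>free\<close> the lengths in \<open>J\<close>, hence the groups of
  special functionals, are dangerous for none. The bound on \<open>d\<close> keeps the sum of all
  \<open>N\<close> errors below \<open>C / 10\<close>.\<close>

locale RIS =
  fixes J :: "nat set" and N :: nat and y :: "nat \<Rightarrow> nat \<Rightarrow> real" and C d :: real and a p :: "nat \<Rightarrow> real"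
  assumes J: "GM_index_set J" and N: "1 \<le> N" and C: "0 < C" and d: "0 \<le> d" "10 * N * d \<le> C"
    and good: "i \<in> {1..N} \<Longrightarrow> good J C (a i) (p i) d (y i)"
    and succ: "i \<in> {1..N} \<Longrightarrow> j \<in> {1..N} \<Longrightarrow> i < j \<Longrightarrow> vec_before (y i) (y j)"
    and ap: "i \<in> {1..N} \<Longrightarrow> j \<in> {1..N} \<Longrightarrow> i < j \<Longrightarrow> p i \<le> a j"
    and free: "i \<in> {1..N} \<Longrightarrow> m \<in> J \<Longrightarrow> lf (real m) \<le> a i \<or> p i \<le> lf (real m)"
begin

definition Y where "Y = (\<lambda>n. \<Sum>i=1..N. y i n)"

abbreviation k where "k E \<equiv> real (card (touch y N E))"

lemma y_c00: "i \<in> {1..N} \<Longrightarrow> y i \<in> c00"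
  using good good_c00 by blast

lemma Y_c00: "Y \<in> c00"
  unfolding Y_def using y_c00 by (intro c00_sum) auto

lemma pairing_Y: "pairing u (restr E Y) = (\<Sum>i\<in>touch y N E. pairing u (restr E (y i)))"
proof -
  have "pairing u (restr E Y) = (\<Sum>i=1..N. pairing u (restr E (y i)))"
    unfolding Y_def restr_sum using y_c00 by (intro pairing_sum restr_c00) auto
  also have "\<dots> = (\<Sum>i\<in>touch y N E. pairing u (restr E (y i)))"
  proof (rule sum.mono_neutral_right)
    show "\<forall>i\<in>{1..N} - touch y N E. pairing u (restr E (y i)) = 0"
      by (intro ballI pairing_eq_0) (auto simp: touch_def supp_restr)
  qed (auto simp: touch_def)
  finally show ?thesis .
qed

lemma abs_pairing_Y_le:
  assumes "\<And>i. i \<in> {1..N} \<Longrightarrow> \<bar>pairing u (restr E (y i))\<bar> \<le> b i"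
  shows "\<bar>pairing u (restr E Y)\<bar> \<le> (\<Sum>i\<in>touch y N E. b i)"
  unfolding pairing_Y by (rule order_trans[OF sum_abs]) (use assms in \<open>auto intro!: sum_mono simp: touch_def\<close>)

lemma bound_norm: "u \<in> relG J \<Longrightarrow> \<bar>pairing u (restr E Y)\<bar> \<le> C * k E"
  using abs_pairing_Y_le[of u E "\<lambda>_. C"] good_norm[OF good] by (simp add: mult.commute)

text \<open>Vectors that find the length short contribute \<open>C / lf l\<close> each, those that
  find it long contribute at most \<open>C\<close> altogether, and at most one vector has the length
  in its window and contributes up to \<open>C\<close>.\<close>

lemma bound_node:
  assumes us: "nodel J us"
  shows "\<bar>pairing (avg us) (restr E Y)\<bar> \<le> C * k E / lf (real (length us)) + 2 * C"
proof -
  let ?F = "lf (real (length us))"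
  have F: "1 \<le> ?F" using us lf_length_ge_1[of us] by (simp add: nodel_def)
  define W where "W = {i\<in>{1..N}. a i < ?F \<and> ?F < p i}"
  have "\<bar>pairing (avg us) (restr E Y)\<bar> \<le> (\<Sum>i\<in>touch y N E. C / ?F + d + (if i \<in> W then C else 0))"
  proof (rule abs_pairing_Y_le)
    fix i assume i: "i \<in> {1..N}"
    consider "?F \<le> a i" | "p i \<le> ?F" | "i \<in> W" using i by (force simp: W_def)
    then show "\<bar>pairing (avg us) (restr E (y i))\<bar> \<le> C / ?F + d + (if i \<in> W then C else 0)"
    proof cases
      case 1
      show ?thesis using good_node_small[OF good[OF i] us 1, of E] d C by auto
    next
      case 2
      have "0 \<le> C / ?F" using C F by simp
      then show ?thesis using good_node_large[OF good[OF i] us 2, of E] C by auto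
    next
      case 3
      have "0 \<le> C / ?F" using C F by simp
      then show ?thesis using good_norm[OF good[OF i] nodel_relG[OF us], of E] 3 d by auto
    qed
  qed
  also have "\<dots> = k E * (C / ?F) + k E * d + (\<Sum>i\<in>touch y N E. if i \<in> W then C else 0)"
    by (simp add: sum.distrib algebra_simps)
  also have "\<dots> \<le> k E * (C / ?F) + C + C"
  proof -
    have "k E * d \<le> N * d" using card_touch_le[of y N E] d by (intro mult_right_mono) auto
    also have "\<dots> \<le> 10 * N * d" using d by (intro mult_right_mono) auto
    also have "\<dots> \<le> C" using d by simp
    finally have 1: "k E * d \<le> C" .
    have WW: "i = j" if "i \<in> W" "j \<in> W" for i j
    proof (rule ccontr)
      assume "i \<noteq> j"
      then consider "i < j" | "j < i" by linarith
      then show False using ap[of i j] ap[of j i] that by cases (auto simp: W_def)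
    qed
    have "(\<Sum>i\<in>touch y N E. if i \<in> W then C else 0) = C * card (touch y N E \<inter> W)"
      by (simp add: sum.If_cases Int_def)
    also have "\<dots> \<le> C * 1"
    proof -
      have "card (touch y N E \<inter> W) \<le> 1" using WW
        by (simp add: card_le_Suc0_iff_eq)
      then show ?thesis using C by (intro mult_left_mono) auto
    qed
    finally show ?thesis using 1 by simp
  qed
  finally show ?thesis by (simp add: mult.commute)
qed

text \<open>No window matters here. For each vector the long groups contribute at most
  \<open>d\<close>; the short ones sum to at most \<open>C * 4 / t\<close> by lacunarity, and
  \<open>c <= 1 / 16\<close> turns this into \<open>C / (4 * t)\<close>.\<close>

lemma bound_spec:
  assumes uss: "specl J uss" "\<And>us. us \<in> set uss \<Longrightarrow> t \<le> lf (real (length us))" "0 < t" and c: "0 \<le> c" "c \<le> 1 / 16"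
  shows "\<bar>pairing (specf c uss) (restr E Y)\<bar> \<le> k E * (C / (4 * t) + d)"
proof -
  have "\<bar>pairing (specf c uss) (restr E Y)\<bar> \<le> (\<Sum>i\<in>touch y N E. C / (4 * t) + d)"
  proof (rule abs_pairing_Y_le)
    fix i assume i: "i \<in> {1..N}"
    define Q where "Q us \<longleftrightarrow> lf (real (length us)) \<le> a i" for us :: "(nat \<Rightarrow> real) list"
    have P: "p i \<le> lf (real (length us))" if "us \<in> set uss" "\<not> Q us" for us
      using free[OF i, of "length us"] that uss(1) by (auto simp: specl_def Q_def)
    have "\<bar>pairing (specf c (filter (\<lambda>us. \<not> Q us) uss)) (restr E (y i))\<bar> \<le> d"
      by (rule good_spec_large[OF good[OF i]]) (use uss c P specl_filter in auto)
    moreover have "\<bar>pairing (specf c (filter Q uss)) (restr E (y i))\<bar> \<le> C / (4 * t)"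
    proof -
      have "\<bar>\<Sum>us\<leftarrow>filter Q uss. pairing (avg us) (restr E (y i))\<bar> \<le> (\<Sum>us\<leftarrow>filter Q uss. \<bar>pairing (avg us) (restr E (y i))\<bar>)"
        by (rule abs_sum_list_le)
      also have "\<dots> \<le> (\<Sum>us\<leftarrow>filter Q uss. C * (1 / lf (real (length us))))"
      proof (rule sum_list_mono)
        fix us assume us: "us \<in> set (filter Q uss)"
        then show "\<bar>pairing (avg us) (restr E (y i))\<bar> \<le> C * (1 / lf (real (length us)))"
          using good_node_small[OF good[OF i] specl_nodel[OF J uss(1)], of us E] by (simp add: Q_def)
      qed
      also have "\<dots> = C * (\<Sum>us\<leftarrow>filter Q uss. 1 / lf (real (length us)))" by (subst sum_list_const_mult) simp
      also have "\<dots> \<le> C * (4 / t)"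
        using specl_filter[OF uss(1), of Q] uss(2,3) C
        by (intro mult_left_mono sum_list_inverse_lf_le[OF J]) (auto simp: specl_def)
      finally have "\<bar>\<Sum>us\<leftarrow>filter Q uss. pairing (avg us) (restr E (y i))\<bar> \<le> C * (4 / t)" .
      then have "c * \<bar>\<Sum>us\<leftarrow>filter Q uss. pairing (avg us) (restr E (y i))\<bar> \<le> 1 / 16 * (C * (4 / t))"
        using c by (intro mult_mono) auto
      then show ?thesis using c by (simp add: pairing_specf abs_mult)
    qed
    ultimately show "\<bar>pairing (specf c uss) (restr E (y i))\<bar> \<le> C / (4 * t) + d"
      using specf_split[of c uss "restr E (y i)" Q] by linarith
  qed
  then show ?thesis by simp
qed

lemma bound_base:
  assumes "\<bar>c\<bar> \<le> 1"
  shows "\<bar>pairing (\<lambda>i. if i = n then c else 0) (restr E Y)\<bar> \<le> C"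
proof -
  let ?u = "\<lambda>i. if i = n then c else 0"
  have u: "?u \<in> relG J" using assms by (rule relG.base)
  have "pairing ?u (restr E Y) = pairing ?u (restr (E \<inter> {n}) Y)"
    by (rule pairing_restr_supp[OF _ Y_c00]) (auto simp: supp_def)
  then have "\<bar>pairing ?u (restr E Y)\<bar> \<le> C * k (E \<inter> {n})" using bound_norm[OF u, of "E \<inter> {n}"] by simp
  also have "\<dots> \<le> C * 1"
  proof -
    have "card (touch y N (E \<inter> {n})) \<le> Suc 0"
    proof (subst card_le_Suc0_iff_eq, simp, intro ballI)
      fix i j assume ij: "i \<in> touch y N (E \<inter> {n})" "j \<in> touch y N (E \<inter> {n})"
      show "i = j"
      proof (rule ccontr)
        assume "i \<noteq> j"
        then consider "i < j" | "j < i" by linarith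
        then show False using succ[of i j] succ[of j i] ij
          by cases (auto simp: touch_def vec_before_def set_before_def)
      qed
    qed
    then show ?thesis using C by (intro mult_left_mono) auto
  qed
  finally show ?thesis by simp
qed

end

section \<open>Growth of sums of rapidly increasing sequences\<close>

lemma lf_divide_ge:
  assumes "1 \<le> l" "1 \<le> T" shows "lf T - lf l \<le> lf (T / l)"
proof -
  have "(T + 1) / (l + 1) \<le> T / l + 1" using assms by (simp add: field_simps)
  then have "log 2 ((T + 1) / (l + 1)) \<le> log 2 (T / l + 1)" using assms by (subst log_le_cancel_iff) (auto simp: add_nonneg_pos)
  moreover have "log 2 ((T + 1) / (l + 1)) = lf T - lf l" using assms by (simp add: lf_def log_divide)
  ultimately show ?thesis by (simp add: lf_def)
qed

lemma two_lf_le: "5 \<le> lf T \<Longrightarrow> 0 \<le> T \<Longrightarrow> 2 * lf T \<le> T"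
proof -
  assume a: "5 \<le> lf T" "0 \<le> T"
  have "2 * lf T + 1 \<le> 4 * (lf T - 2 + 1)" using a by simp
  also have "\<dots> \<le> 4 * 2 powr (lf T - 2)" using two_powr_ge[of "lf T - 2"] a by simp
  also have "\<dots> = 2 powr lf T" by (simp add: powr_diff)
  also have "\<dots> = T + 1" using a by (simp add: two_powr_lf)
  finally show ?thesis by simp
qed

lemma lf_le_self: "1 \<le> T \<Longrightarrow> lf T \<le> T"
proof -
  assume "1 \<le> T"
  then have "log 2 (T + 1) \<le> log 2 (2 powr T)" using two_powr_ge[of T] by (subst log_le_cancel_iff) auto
  then show ?thesis by (simp add: lf_def)
qed

text \<open>Describes the region in which the sharp growth function is better than
  \<open>f / 5\<close>: there \<open>f\<close> exceeds \<open>25 / e\<close>, so the additive loss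
  \<open>20 / e\<close> no longer hurts.\<close>

lemma tight_region:
  fixes e f g :: real
  assumes e: "0 < e" "e \<le> 1 / 20" and "f / 5 < g" "g = (1 - e) * f - 20 / e"
  shows "5 / e < g \<and> 100 \<le> 5 / e \<and> 400 \<le> 20 / e"
proof -
    have "20 / e < (4 / 5 - e) * f" using assms by (simp add: algebra_simps)
    then have "0 < (4 / 5 - e) * f" using e by (smt (verit) divide_pos_pos)
    then have f0: "0 < f" using e by (simp add: zero_less_mult_iff)
    have "(4 / 5 - e) * f \<le> 4 / 5 * f" using f0 e by (intro mult_right_mono) auto
    then have "25 / e < f" using \<open>20 / e < _\<close> by (simp add: field_simps)
    moreover have "100 \<le> 5 / e" "400 \<le> 20 / e" using e by (auto simp: field_simps)
    ultimately show ?thesis using assms by simp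
  qed

context RIS
begin

text \<open>
  Bounding a functional on \<open>E Y\<close> by \<open>C (k + T) / g (f T)\<close> simultaneously for all \<open>T\<close> replaces the
  concavity of \<open>k / f k\<close>: for an average of length \<open>l\<close> one passes from \<open>T\<close> to \<open>T / l\<close>.
\<close>

lemma growth:
  fixes g :: "real \<Rightarrow> real" and R :: "real \<Rightarrow> bool" and T :: real
  assumes triv: "\<And>u E (T::real). u \<in> relG J \<Longrightarrow> 1 \<le> T \<Longrightarrow> T \<le> N \<Longrightarrow> \<not> R (lf T) \<Longrightarrow>
      \<bar>pairing u (restr E Y)\<bar> * g (lf T) \<le> C * (k E + T)"
    and R: "\<And>f. R f \<Longrightarrow> 5 \<le> f \<and> 1 \<le> g f \<and> g f \<le> f"
    and rec: "\<And>f F. R f \<Longrightarrow> 19 / 12 \<le> F \<Longrightarrow> F < g f \<Longrightarrow> F \<le> f - 5 \<and> 21 / 20 * g f \<le> F * g (f - F)"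
    and half: "\<And>f F. R f \<Longrightarrow> 256 \<le> F \<Longrightarrow> F \<le> g f / 2 \<Longrightarrow> g f / 2 \<le> g (f - F)"
    and mono: "\<And>x y. x \<le> y \<Longrightarrow> g x \<le> g y"
    and u: "u \<in> relG J" and T: "1 \<le> T" "T \<le> N"
  shows "\<bar>pairing u (restr E Y)\<bar> * g (lf T) \<le> C * (k E + T)"
  using u T
proof (induction arbitrary: E T rule: relG.induct)
  case (base c n)
  show ?case
  proof (cases "R (lf T)")
    case True
    have "\<bar>pairing (\<lambda>i. if i = n then c else 0) (restr E Y)\<bar> * g (lf T) \<le> C * T"
      using bound_base[OF base(1), of n E] R[OF True] lf_le_self[of T] base C by (intro mult_mono) auto
    also have "\<dots> \<le> C * (k E + T)" using C by (intro mult_left_mono) auto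
    finally show ?thesis .
  next
    case False
    then show ?thesis using triv[OF relG.base[OF base(1)]] base by blast
  qed
next
  case (conv l w a)
  have u: "(\<lambda>n. \<Sum>i=1..l. a i * w i n) \<in> relG J" using conv by (intro relG.conv) auto
  show ?case
  proof (cases "R (lf T)")
    case True
    have "\<bar>pairing (\<lambda>n. \<Sum>i=1..l. a i * w i n) (restr E Y)\<bar> \<le> (\<Sum>i=1..l. \<bar>a i\<bar> * \<bar>pairing (w i) (restr E Y)\<bar>)"
      unfolding pairing_sum_left by (rule order_trans[OF sum_abs]) (simp add: abs_mult)
    then have "\<bar>pairing (\<lambda>n. \<Sum>i=1..l. a i * w i n) (restr E Y)\<bar> * g (lf T)
       \<le> (\<Sum>i=1..l. \<bar>a i\<bar> * \<bar>pairing (w i) (restr E Y)\<bar>) * g (lf T)"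
      using R[OF True] by (intro mult_right_mono) auto
    also have "\<dots> = (\<Sum>i=1..l. \<bar>a i\<bar> * (\<bar>pairing (w i) (restr E Y)\<bar> * g (lf T)))"
      by (simp add: sum_distrib_right mult.assoc)
    also have "\<dots> \<le> (\<Sum>i=1..l. \<bar>a i\<bar> * (C * (k E + T)))"
      using conv.IH conv.prems by (intro sum_mono mult_left_mono) auto
    also have "\<dots> = (\<Sum>i=1..l. \<bar>a i\<bar>) * (C * (k E + T))" by (simp add: sum_distrib_right)
    also have "\<dots> \<le> 1 * (C * (k E + T))" using conv C by (intro mult_right_mono) auto
    finally show ?thesis by simp
  next
    case False
    then show ?thesis using triv[OF u] conv.prems by blast
  qed
next
  case (node us)
  have nod: "nodel J us" using node by (auto simp: nodel_def)
  show ?case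
  proof (cases "R (lf T)")
    case False
    then show ?thesis using triv[OF nodel_relG[OF nod]] node.prems by blast
  next
    case True
    note R = R[OF True]
    let ?F = "lf (real (length us))" and ?l = "real (length us)"
    have l1: "1 \<le> ?l" using node.hyps by (simp add: Suc_le_eq)
    have F1: "1 \<le> ?F" using l1 by (rule lf_ge_1)
    \<comment> \<open>An average of length 1 equals its only term and gains nothing. If
      \<open>?F\<close> is at least \<open>g (lf T)\<close>, then \<open>bound_node\<close> suffices
      because \<open>2 * lf T <= T\<close>. Only the remaining lengths use the recursion.\<close>
    consider "length us = 1" | "2 \<le> length us" "g (lf T) \<le> ?F" | "2 \<le> length us" "?F < g (lf T)"
      using l1 by linarith
    then show ?thesis
    proof cases
      case 1
      then obtain u where us: "us = [u]" by (cases us) auto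
      then have "avg us = u" by (simp add: avg_def)
      then show ?thesis using node.IH[of u] us node.prems by simp
    next
      case 2
      have "\<bar>pairing (avg us) (restr E Y)\<bar> * g (lf T) \<le> (C * k E / ?F + 2 * C) * g (lf T)"
        using bound_node[OF nod, of E] R by (intro mult_right_mono) auto
      also have "\<dots> = C * k E * (g (lf T) / ?F) + C * (2 * g (lf T))" by (simp add: algebra_simps)
      also have "\<dots> \<le> C * k E * 1 + C * T"
        using 2 F1 C R two_lf_le[of T] node.prems by (intro add_mono mult_left_mono) auto
      finally show ?thesis by (simp add: algebra_simps)
    next
      case 3
      have F: "19 / 12 \<le> ?F" using 3 by (intro lf_ge_2) simp
      note rc = rec[OF True F 3(2)]
      \<comment> \<open>The length is at most about \<open>T / 32\<close>. The \<open>?l\<close>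
        double counts at the ends of the pieces then cost less than the factor
        \<open>21 / 20\<close> that \<open>rec\<close> provides.\<close>
      have lT: "?l + 1 \<le> (T + 1) / 32"
      proof -
        have "?l + 1 = 2 powr ?F" using l1 by (simp add: two_powr_lf)
        also have "\<dots> \<le> 2 powr (lf T - 5)" using rc by (intro powr_mono) auto
        also have "\<dots> = (T + 1) / 32" using node.prems by (simp add: powr_diff two_powr_lf)
        finally show ?thesis .
      qed
      let ?T = "T / ?l" and ?v = "\<bar>pairing (avg us) (restr E Y)\<bar>"
      have T': "1 \<le> ?T" "?T \<le> N"
      proof -
        have "?l \<le> T" using lT l1 by argo
        then show "1 \<le> ?T" using l1 pos_le_divide_eq[of ?l 1 T] by linarith
        have "?T \<le> T / 1" using l1 node.prems by (intro divide_left_mono) auto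
        then show "?T \<le> N" using node.prems by simp
      qed
      have gT: "g (lf T - ?F) \<le> g (lf ?T)" using lf_divide_ge[of ?l T] l1 node.prems by (intro mono) auto
      have gpos: "0 < g (lf T - ?F)"
      proof -
        have "0 < 21 / 20 * g (lf T)" using R by linarith
        also have "\<dots> \<le> ?F * g (lf T - ?F)" using rc by simp
        finally show ?thesis using F1 by (simp add: zero_less_mult_iff)
      qed
      have vF: "?v * ?F \<le> (\<Sum>u\<leftarrow>us. \<bar>pairing u (restr (piece E u) Y)\<bar>)"
        using abs_pairing_avg_le[of us "restr E Y"] node.hyps F1 pairing_piece[OF Y_c00, of _ E]
        by (simp add: field_simps)
      have "?v * (?F * g (lf T - ?F)) \<le> (\<Sum>u\<leftarrow>us. \<bar>pairing u (restr (piece E u) Y)\<bar>) * g (lf T - ?F)"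
        using mult_right_mono[OF vF, of "g (lf T - ?F)"] gpos by (simp add: mult.assoc)
      also have "\<dots> \<le> (\<Sum>u\<leftarrow>us. \<bar>pairing u (restr (piece E u) Y)\<bar>) * g (lf ?T)"
        using gT by (intro mult_left_mono sum_list_nonneg) auto
      also have "\<dots> = (\<Sum>u\<leftarrow>us. \<bar>pairing u (restr (piece E u) Y)\<bar> * g (lf ?T))"
        by (simp add: sum_list_mult_const)
      also have "\<dots> \<le> (\<Sum>u\<leftarrow>us. C * (k (piece E u) + ?T))"
        using node.IH T' by (intro sum_list_mono) auto
      also have "\<dots> = C * ((\<Sum>u\<leftarrow>us. k (piece E u)) + ?l * ?T)"
        by (simp add: sum_list_const_mult sum_list_addf sum_list_triv)
      also have "\<dots> \<le> C * (k E + ?l + T)"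
      proof -
        have "(\<Sum>F\<leftarrow>map (piece E) us. card (touch y N F)) \<le> card (touch y N E) + length (map (piece E) us)"
          using node.hyps piece_subset by (intro sum_card_touch succ sorted_piece) auto
        then have "real (\<Sum>F\<leftarrow>map (piece E) us. card (touch y N F)) \<le> real (card (touch y N E) + length (map (piece E) us))"
          by (rule of_nat_mono)
        moreover have "real (\<Sum>F\<leftarrow>map (piece E) us. card (touch y N F)) = (\<Sum>u\<leftarrow>us. k (piece E u))"
          by (induction us) auto
        ultimately show ?thesis using l1 C by (intro mult_left_mono) auto
      qed
      also have "\<dots> \<le> C * (21 / 20 * (k E + T))" using lT C node.prems by (intro mult_left_mono) auto
      finally have "?v * (?F * g (lf T - ?F)) \<le> 21 / 20 * (C * (k E + T))"
        by (simp only: mult.left_commute[of C])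
      moreover have "?v * (21 / 20 * g (lf T)) \<le> ?v * (?F * g (lf T - ?F))" using rc by (intro mult_left_mono) auto
      ultimately show ?thesis by simp
    qed
  qed
next
  case (spec uss c)
  have sp: "specl J uss" using spec by (auto simp: specl_def)
  have sf: "(\<lambda>n. c * (\<Sum>us\<leftarrow>uss. avg us n)) = specf c uss" by (simp add: specf_def)
  show ?case unfolding sf
  proof (cases "R (lf T)")
    case False
    then show "\<bar>pairing (specf c uss) (restr E Y)\<bar> * g (lf T) \<le> C * (k E + T)"
      using triv[OF specl_relG[OF sp]] spec by blast
  next
    case True
    note R = R[OF True]
    let ?g = "g (lf T)"
    \<comment> \<open>Groups with \<open>lf\<close> at least half of \<open>g (lf T)\<close> are
      left to \<open>bound_spec\<close> and take the share \<open>3 / 5\<close>. The shorter ones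
      are treated like averages, with \<open>half\<close> supplying the growth; as their inverse
      weights sum to at most \<open>4 / 256\<close>, they take only \<open>1 / 10\<close>.\<close>
    define Q where "Q us \<longleftrightarrow> ?g / 2 \<le> lf (real (length us))" for us :: "(nat \<Rightarrow> real) list"
    have large: "\<bar>pairing (specf c (filter Q uss)) (restr E Y)\<bar> * ?g \<le> 3 / 5 * (C * k E)"
    proof -
      have "\<bar>pairing (specf c (filter Q uss)) (restr E Y)\<bar> \<le> k E * (C / (4 * (?g / 2)) + d)"
        using sp R spec.hyps by (intro bound_spec specl_filter) (auto simp: Q_def)
      then have "\<bar>pairing (specf c (filter Q uss)) (restr E Y)\<bar> * ?g \<le> k E * (C / (4 * (?g / 2)) + d) * ?g"
        using R by (intro mult_right_mono) auto
      also have "\<dots> = k E * (C / 2 + d * ?g)" using R by (simp add: field_simps)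
      also have "\<dots> \<le> k E * (C / 2 + C / 10)"
      proof -
        have "?g \<le> N" using R lf_le_self[of T] spec.prems by linarith
        then have "d * ?g \<le> d * N" using d by (intro mult_left_mono) auto
        then have "C / 2 + d * ?g \<le> C / 2 + C / 10" using d by (simp add: mult.commute)
        then show ?thesis by (intro mult_left_mono) auto
      qed
      finally show ?thesis by (simp add: algebra_simps)
    qed
    have small1: "\<bar>pairing (avg us) (restr E Y)\<bar> * ?g \<le> 3 * (C * (k E + T)) * (1 / lf (real (length us)))"
      if us: "us \<in> set (filter (\<lambda>us. \<not> Q us) uss)" for us
    proof -
      let ?F = "lf (real (length us))" and ?l = "real (length us)"
      have usm: "us \<in> set uss" using us by simp
      have nod: "nodel J us" using specl_nodel[OF J sp usm] .
      have F: "256 \<le> ?F" "?F < ?g / 2" using specl_ge[OF J sp usm] us by (auto simp: Q_def)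
      have l1: "1 \<le> ?l" using nod by (simp add: nodel_def Suc_le_eq)
      have rc: "?F \<le> lf T - 5" using rec[OF True, of ?F] F R by auto
      have hf: "?g / 2 \<le> g (lf T - ?F)" using half[OF True, of ?F] F by auto
      have lT: "?l + 1 \<le> (T + 1) / 32"
      proof -
        have "?l + 1 = 2 powr ?F" using l1 by (simp add: two_powr_lf)
        also have "\<dots> \<le> 2 powr (lf T - 5)" using rc by (intro powr_mono) auto
        also have "\<dots> = (T + 1) / 32" using spec.prems by (simp add: powr_diff two_powr_lf)
        finally show ?thesis .
      qed
      let ?T = "T / ?l" and ?v = "\<bar>pairing (avg us) (restr E Y)\<bar>"
      have T': "1 \<le> ?T" "?T \<le> N"
      proof -
        have "?l \<le> T" using lT l1 by argo
        then show "1 \<le> ?T" using l1 pos_le_divide_eq[of ?l 1 T] by linarith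
        have "?T \<le> T / 1" using l1 spec.prems by (intro divide_left_mono) auto
        then show "?T \<le> N" using spec.prems by simp
      qed
      have gT: "?g / 2 \<le> g (lf ?T)" using hf lf_divide_ge[of ?l T] l1 spec.prems
        by (intro order_trans[OF hf] mono) auto
      have vF: "?v * ?F \<le> (\<Sum>u\<leftarrow>us. \<bar>pairing u (restr (piece E u) Y)\<bar>)"
        using abs_pairing_avg_le[of us "restr E Y"] nod F pairing_piece[OF Y_c00, of _ E]
        by (simp add: field_simps nodel_def)
      have "?v * ?F * (?g / 2) \<le> (\<Sum>u\<leftarrow>us. \<bar>pairing u (restr (piece E u) Y)\<bar>) * g (lf ?T)"
        using vF gT R by (intro mult_mono sum_list_nonneg) auto
      also have "\<dots> = (\<Sum>u\<leftarrow>us. \<bar>pairing u (restr (piece E u) Y)\<bar> * g (lf ?T))"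
        by (simp add: sum_list_mult_const)
      also have "\<dots> \<le> (\<Sum>u\<leftarrow>us. C * (k (piece E u) + ?T))"
        using spec.IH[OF usm] T' by (intro sum_list_mono) auto
      also have "\<dots> = C * ((\<Sum>u\<leftarrow>us. k (piece E u)) + ?l * ?T)"
        by (simp add: sum_list_const_mult sum_list_addf sum_list_triv)
      also have "\<dots> \<le> C * (k E + ?l + T)"
      proof -
        have "(\<Sum>F\<leftarrow>map (piece E) us. card (touch y N F)) \<le> card (touch y N E) + length (map (piece E) us)"
          using nod piece_subset by (intro sum_card_touch succ sorted_piece) (auto simp: nodel_def)
        then have "real (\<Sum>F\<leftarrow>map (piece E) us. card (touch y N F)) \<le> real (card (touch y N E) + length (map (piece E) us))"
          by (rule of_nat_mono)
        moreover have "real (\<Sum>F\<leftarrow>map (piece E) us. card (touch y N F)) = (\<Sum>u\<leftarrow>us. k (piece E u))"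
          by (induction us) auto
        ultimately show ?thesis using l1 C by (intro mult_left_mono) auto
      qed
      also have "\<dots> \<le> C * (3 / 2 * (k E + T))" using lT C spec.prems by (intro mult_left_mono) auto
      finally show ?thesis using F by (simp add: field_simps)
    qed
    have small: "\<bar>pairing (specf c (filter (\<lambda>us. \<not> Q us) uss)) (restr E Y)\<bar> * ?g \<le> 1 / 10 * (C * (k E + T))"
    proof -
      let ?ls = "filter (\<lambda>us. \<not> Q us) uss"
      have "\<bar>\<Sum>us\<leftarrow>?ls. pairing (avg us) (restr E Y)\<bar> * ?g \<le> (\<Sum>us\<leftarrow>?ls. \<bar>pairing (avg us) (restr E Y)\<bar>) * ?g"
        using R by (intro mult_right_mono abs_sum_list_le) auto
      also have "\<dots> = (\<Sum>us\<leftarrow>?ls. \<bar>pairing (avg us) (restr E Y)\<bar> * ?g)" by (simp add: sum_list_mult_const)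
      also have "\<dots> \<le> (\<Sum>us\<leftarrow>?ls. 3 * (C * (k E + T)) * (1 / lf (real (length us))))"
        using small1 by (intro sum_list_mono) auto
      also have "\<dots> = 3 * (C * (k E + T)) * (\<Sum>us\<leftarrow>?ls. 1 / lf (real (length us)))"
        by (subst sum_list_const_mult) simp
      also have "\<dots> \<le> 3 * (C * (k E + T)) * (4 / 256)"
        using specl_filter[OF sp, of "\<lambda>us. \<not> Q us"] specl_ge[OF J sp] C spec.prems
        by (intro mult_left_mono sum_list_inverse_lf_le[OF J]) (auto simp: specl_def)
      finally have 1: "\<bar>\<Sum>us\<leftarrow>?ls. pairing (avg us) (restr E Y)\<bar> * ?g \<le> 3 * (C * (k E + T)) * (4 / 256)" .
      have "c * (\<bar>\<Sum>us\<leftarrow>?ls. pairing (avg us) (restr E Y)\<bar> * ?g) \<le> 1 * (3 * (C * (k E + T)) * (4 / 256))"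
      proof (rule mult_mono[OF _ 1])
        show "0 \<le> \<bar>\<Sum>us\<leftarrow>?ls. pairing (avg us) (restr E Y)\<bar> * ?g" using R by simp
      qed (use spec.hyps in auto)
      also have "\<dots> \<le> 1 / 10 * (C * (k E + T))" using C spec.prems by simp
      finally show ?thesis using spec.hyps by (simp add: pairing_specf abs_mult mult.assoc)
    qed
    have "\<bar>pairing (specf c uss) (restr E Y)\<bar> * ?g \<le>
        \<bar>pairing (specf c (filter Q uss)) (restr E Y)\<bar> * ?g +
        \<bar>pairing (specf c (filter (\<lambda>us. \<not> Q us) uss)) (restr E Y)\<bar> * ?g"
      unfolding specf_split[of c uss "restr E Y" Q] distrib_right[symmetric]
      using R by (intro mult_right_mono) auto
    also have "\<dots> \<le> 3 / 5 * (C * k E) + 1 / 10 * (C * (k E + T))" using large small by linarith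
    also have "\<dots> \<le> C * (k E + T)"
    proof -
      have "0 \<le> C * k E" "0 \<le> C * T" using C spec.prems by auto
      then show ?thesis unfolding distrib_left by linarith
    qed
    finally show "\<bar>pairing (specf c uss) (restr E Y)\<bar> * ?g \<le> C * (k E + T)" .
  qed
qed

text \<open>A crude first pass, whose purpose is to start the sharp one. For
  \<open>F < f / 5\<close> the recursion keeps four fifths of \<open>f\<close>, and
  \<open>19 / 12 * 4 / 5\<close> still exceeds \<open>21 / 20\<close>.\<close>

lemma growth_lossy:
  fixes T :: real
  assumes "u \<in> relG J" "1 \<le> T" "T \<le> N"
  shows "\<bar>pairing u (restr E Y)\<bar> * (lf T / 5) \<le> C * (k E + T)"
proof (rule growth[where R = "\<lambda>f. 5 < f" and g = "\<lambda>f. f / 5"])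
  fix u E and T :: real assume a: "u \<in> relG J" "1 \<le> T" "T \<le> real N" "\<not> 5 < lf T"
  have "\<bar>pairing u (restr E Y)\<bar> * (lf T / 5) \<le> (C * k E) * 1"
    using a bound_norm[of u E] C lf_ge_1[of T] by (intro mult_mono) auto
  also have "\<dots> \<le> C * (k E + T)" using a C by (simp add: algebra_simps)
  finally show "\<bar>pairing u (restr E Y)\<bar> * (lf T / 5) \<le> C * (k E + T)" .
next
  fix f F :: real assume a: "5 < f" "19 / 12 \<le> F" "F < f / 5"
  have "19 / 12 * (4 / 5 * f) \<le> F * (f - F)" using a by (intro mult_mono) auto
  then show "F \<le> f - 5 \<and> 21 / 20 * (f / 5) \<le> F * ((f - F) / 5)" using a by simp
qed (use assms in auto)

text \<open>A recursion with a constant close to 1 has no room while \<open>lf T\<close> is small,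
  so the lossy bound covers the range where it is the better of the two; beyond that range
  \<open>g\<close> exceeds \<open>5 / e\<close>. The factor \<open>1 - e\<close> decides the case of
  \<open>F\<close> close to \<open>g\<close>, in which \<open>g - (1 - e) * F\<close> is still at
  least \<open>e * g\<close>, more than 5.\<close>

lemma growth_tight:
  fixes T :: real
  assumes u: "u \<in> relG J" "1 \<le> T" "T \<le> N" and e: "0 < e" "e \<le> 1 / 20"
  shows "\<bar>pairing u (restr E Y)\<bar> * ((1 - e) * lf T - 20 / e) \<le> C * (k E + T)"
proof (rule growth[where R = "\<lambda>f. f / 5 < (1 - e) * f - 20 / e" and g = "\<lambda>f. (1 - e) * f - 20 / e"])
  fix u E and T :: real assume a: "u \<in> relG J" "1 \<le> T" "T \<le> real N" "\<not> lf T / 5 < (1 - e) * lf T - 20 / e"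
  then have "\<bar>pairing u (restr E Y)\<bar> * ((1 - e) * lf T - 20 / e) \<le> \<bar>pairing u (restr E Y)\<bar> * (lf T / 5)"
    by (intro mult_left_mono) auto
  also have "\<dots> \<le> C * (k E + T)" using a by (intro growth_lossy)
  finally show "\<bar>pairing u (restr E Y)\<bar> * ((1 - e) * lf T - 20 / e) \<le> C * (k E + T)" .
next
  fix f assume a: "f / 5 < (1 - e) * f - 20 / e"
  have b: "5 / e < (1 - e) * f - 20 / e" "100 \<le> 5 / e" "400 \<le> 20 / e" using tight_region[OF e a refl] by auto
  have f0: "0 < f"
  proof (rule ccontr)
    assume "\<not> 0 < f"
    then have "(1 - e) * f \<le> 0" using e by (simp add: mult_le_0_iff)
    then show False using b by linarith
  qed
  have "(1 - e) * f \<le> f" using e f0 by (simp add: algebra_simps)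
  then show "5 \<le> f \<and> 1 \<le> (1 - e) * f - 20 / e \<and> (1 - e) * f - 20 / e \<le> f" using b by linarith
next
  fix f F assume a: "f / 5 < (1 - e) * f - 20 / e" "19 / 12 \<le> F" "F < (1 - e) * f - 20 / e"
  define g where "g = (1 - e) * f - 20 / e"
  have b: "5 / e < g" "100 \<le> 5 / e" "400 \<le> 20 / e" using tight_region[OF e a(1) refl] by (auto simp: g_def)
  have f0: "0 < f"
  proof (rule ccontr)
    assume "\<not> 0 < f"
    then have "(1 - e) * f \<le> 0" using e by (simp add: mult_le_0_iff)
    then show False using b by (simp add: g_def)
  qed
  have eF: "(1 - e) * F \<le> F" using e a(2) by (simp add: algebra_simps)
  have "(1 - e) * f \<le> f" using e f0 by (simp add: algebra_simps)
  then have "F \<le> f - 5" using a(3) b(3) by linarith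
  moreover have "21 / 20 * g \<le> F * (g - (1 - e) * F)"
  proof (cases "F \<le> g / 2")
    case True
    show ?thesis
    proof (cases "21 / 10 \<le> F")
      case True': True
      have "g / 2 \<le> g - (1 - e) * F" using True eF by linarith
      then have "21 / 10 * (g / 2) \<le> F * (g - (1 - e) * F)" using True' b by (intro mult_mono) auto
      then show ?thesis by simp
    next
      case False
      have "g - 21 / 10 \<le> g - (1 - e) * F" using False eF by linarith
      then have "19 / 12 * (g - 21 / 10) \<le> F * (g - (1 - e) * F)" using a(2) b by (intro mult_mono) auto
      then show ?thesis using b by simp
    qed
  next
    case False
    have "(1 - e) * F \<le> (1 - e) * g" using a(3) e by (intro mult_left_mono) (auto simp: g_def)
    then have "e * g \<le> g - (1 - e) * F" by (simp add: algebra_simps)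
    moreover have "5 < e * g" using b(1) e by (simp add: field_simps)
    ultimately have "g / 2 * 5 \<le> F * (g - (1 - e) * F)" using False b by (intro mult_mono) auto
    then show ?thesis using b by simp
  qed
  moreover have "(1 - e) * (f - F) - 20 / e = g - (1 - e) * F" by (simp add: g_def algebra_simps)
  ultimately show "F \<le> f - 5 \<and> 21 / 20 * ((1 - e) * f - 20 / e) \<le> F * ((1 - e) * (f - F) - 20 / e)"
    unfolding g_def[symmetric] by simp
next
  fix f F assume a: "f / 5 < (1 - e) * f - 20 / e" "256 \<le> F" "F \<le> ((1 - e) * f - 20 / e) / 2"
  have "(1 - e) * F \<le> F" using a e by (simp add: algebra_simps)
  moreover have "(1 - e) * (f - F) = (1 - e) * f - (1 - e) * F" by (simp add: right_diff_distrib)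
  ultimately show "((1 - e) * f - 20 / e) / 2 \<le> (1 - e) * (f - F) - 20 / e" using a by argo
next
  fix x y :: real assume "x \<le> y"
  then show "(1 - e) * x - 20 / e \<le> (1 - e) * y - 20 / e" using e by (simp add: mult_left_mono)
qed (use u in auto)

text \<open>Since \<open>lf N = r ^ 8\<close>, the weight \<open>r ^ 8 / N\<close> keeps the norm
  bound near \<open>C\<close>. The result has again a single window, now from \<open>r ^ 2\<close>
  to \<open>r ^ 16\<close>, which depends only on \<open>r\<close> and not on the windows of the
  summands; this allows iteration.\<close>

lemma good_average:
  fixes r :: nat
  assumes r: "20 \<le> r" and Nr: "real N = 2 ^ r ^ 8 - 1"
  shows "good J (C * (1 + 6 / r)) (r ^ 2) ((r ^ 8) ^ 2) (3 * C / r ^ 8) (\<lambda>n. r ^ 8 / N * Y n)"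
proof -
  define e where "e = real (r ^ 8)"
  have e8: "e = real r ^ 8" by (simp add: e_def)
  have r1: "20 \<le> real r" using r by simp
  have pw: "real r ^ i * real r ^ j = real r ^ (i + j)" for i j by (simp add: power_add)
  have p1: "20 * real r ^ i \<le> real r ^ Suc i" for i using r1 by (simp add: mult_right_mono)
  have p0: "1 \<le> real r ^ i" for i using r1 by (simp add: one_le_power)
  have chain: "20 \<le> real r" "20 * real r \<le> real r ^ 2" "20 * real r ^ 2 \<le> real r ^ 3" "20 * real r ^ 3 \<le> real r ^ 4"
    "20 * real r ^ 4 \<le> real r ^ 5" "20 * real r ^ 5 \<le> real r ^ 6" "20 * real r ^ 6 \<le> real r ^ 7" "20 * real r ^ 7 \<le> real r ^ 8"
    using r1 p1[of 1] p1[of 2] p1[of 3] p1[of 4] p1[of 5] p1[of 6] p1[of 7]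
    by (auto simp: numeral_eq_Suc)
  have e1: "400 \<le> e" unfolding e8 using chain by linarith
  have e_bounds: "2 ^ r ^ 8 = (2::real) powr e" by (simp add: e_def powr_realpow flip: of_nat_power)
  have N0: "real N = 2 powr e - 1" using Nr e_bounds by simp
  have N2: "2 powr (e - 1) \<le> real N"
    using N0 e1 two_powr_ge[of "e - 1"] by (simp add: powr_diff)
  have Ne: "e * e \<le> real N"
  proof -
    have "e / 3 + 1 \<le> 2 powr (e / 3)" using two_powr_ge[of "e / 3"] e1 by simp
    then have "(e / 3) ^ 3 \<le> (2 powr (e / 3)) ^ 3" using e1 by (intro power_mono) auto
    also have "\<dots> = 2 powr e" by (simp add: powr_power)
    finally have "e * e * e \<le> 27 * 2 powr e" by (simp add: power3_eq_cube)
    moreover have "54 * (e * e) \<le> e * (e * e)" using e1 by (intro mult_right_mono) auto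
    moreover have "e * e * e = e * (e * e)" by simp
    ultimately have "2 * (e * e) \<le> 2 powr e" by linarith
    moreover have "1 * 1 \<le> e * e" using e1 by (intro mult_mono) auto
    ultimately show ?thesis using N0 by linarith
  qed
  have Npos: "0 < real N" using N by simp
  let ?x = "\<lambda>n. r ^ 8 / N * Y n"
  have px: "pairing u ?x = e / N * pairing u Y" for u
    using pairing_scale[OF Y_c00, of u "r ^ 8 / N"] by (simp add: e_def)
  have x_c00: "?x \<in> c00" using Y_c00 by (rule c00_scale)
  have A: "(\<Sum>u\<leftarrow>us. \<bar>pairing u ?x\<bar>) \<le> C * (1 + 6 / r)"
    if us: "nodel J us" and l: "lf (real (length us)) \<le> r ^ 2" for us
  proof -
    let ?l = "real (length us)"
    have l1: "1 \<le> ?l" using us by (simp add: nodel_def Suc_le_eq)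
    \<comment> \<open>A compromise: times a length with \<open>lf\<close> at most
      \<open>r ^ 2\<close>, this \<open>T\<close> is negligible against \<open>N\<close>, while
      \<open>lf T\<close> still equals \<open>r ^ 8\<close> up to a small relative loss.\<close>
    define T where "T = 2 powr (e - real r ^ 4)"
    define G where "G = (1 - 1 / r) * lf T - 20 / (1 / r)"
    have T1: "1 \<le> T" unfolding T_def e8 using chain by (intro ge_one_powr_ge_zero) auto
    have "T \<le> 2 powr (e - 1)" unfolding T_def using p0[of 4] by (intro powr_mono) auto
    then have TN: "T \<le> N" using N2 by linarith
    have lfT: "e - real r ^ 4 \<le> lf T" using log2_le_lf[of T] T1 by (simp add: T_def)
    have Gge: "e * (1 - 2 / r) \<le> G"
    proof -
      have "(1 - 1 / r) * (e - real r ^ 4) \<le> (1 - 1 / r) * lf T" using lfT r1 by (intro mult_left_mono) auto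
      moreover have "(1 - 1 / r) * (e - real r ^ 4) = e - e / r - real r ^ 4 + real r ^ 4 / r" by (simp add: algebra_simps diff_divide_distrib)
      moreover have "e / r = real r ^ 7" using r1 by (simp add: e8 power_eq_if)
      moreover have "e * (1 - 2 / r) = e - 2 * (e / r)" by (simp add: algebra_simps)
      moreover have "0 \<le> real r ^ 4 / r" by simp
      moreover have "20 / (1 / real r) = 20 * real r" by simp
      moreover have "20 * real r \<le> 1 / 20 * real r ^ 7" "real r ^ 4 \<le> 1 / 20 * real r ^ 7" using chain by linarith+
      ultimately show ?thesis unfolding G_def using p0[of 7] by linarith
    qed
    have r2: "0 < 1 - 2 / real r" using r1 by simp
    have Gpos: "0 < G" using Gge r2 e1 by (smt (verit) mult_pos_pos)
    have each: "\<bar>pairing u Y\<bar> * G \<le> C * (k (piece UNIV u) + T)" if "u \<in> set us" for u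
    proof -
      have "pairing u Y = pairing u (restr (piece UNIV u) Y)" using pairing_piece[OF Y_c00, of u UNIV] by simp
      then show ?thesis
        using growth_tight[of u T "1 / r" "piece UNIV u"] that us T1 TN r1 by (auto simp: G_def nodel_def divide_simps)
    qed
    have small: "?l + ?l * T \<le> N / r"
    proof -
      have "?l \<le> 2 powr (real r ^ 2)"
      proof -
        have "?l \<le> 2 powr lf ?l" using l1 by (simp add: two_powr_lf)
        also have "\<dots> \<le> 2 powr (real r ^ 2)" using l by (intro powr_mono) auto
        finally show ?thesis .
      qed
      then have "?l * (2 * T) \<le> 2 powr (real r ^ 2) * (2 * T)" using T1 by (intro mult_right_mono) auto
      also have "\<dots> = 2 powr (real r ^ 2 + 1 + (e - real r ^ 4))" by (simp add: T_def powr_add)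
      also have "\<dots> \<le> 2 powr ((e - 1) - r)" using chain by (intro powr_mono) auto
      also have "\<dots> = 2 powr (e - 1) / 2 powr r" by (simp add: powr_diff)
      also have "\<dots> \<le> N / r" using N2 two_powr_ge[of r] r1 by (intro frac_le) auto
      finally have "?l * (2 * T) \<le> N / r" .
      moreover have "?l * 1 \<le> ?l * T" using T1 by (intro mult_left_mono) auto
      ultimately show ?thesis by linarith
    qed
    have "(\<Sum>u\<leftarrow>us. \<bar>pairing u Y\<bar>) * G = (\<Sum>u\<leftarrow>us. \<bar>pairing u Y\<bar> * G)" by (simp add: sum_list_mult_const)
    also have "\<dots> \<le> (\<Sum>u\<leftarrow>us. C * (k (piece UNIV u) + T))" using each by (intro sum_list_mono)
    also have "\<dots> = C * ((\<Sum>u\<leftarrow>us. k (piece UNIV u)) + ?l * T)"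
      by (simp add: sum_list_const_mult sum_list_addf sum_list_triv)
    also have "\<dots> \<le> C * (N + ?l + ?l * T)"
    proof -
      have "(\<Sum>F\<leftarrow>map (piece UNIV) us. card (touch y N F)) \<le> card (touch y N UNIV) + length (map (piece UNIV) us)"
        using us by (intro sum_card_touch succ sorted_piece) (auto simp: nodel_def)
      also have "\<dots> \<le> N + length us" using card_touch_le[of y N UNIV] by simp
      finally have "real (\<Sum>F\<leftarrow>map (piece UNIV) us. card (touch y N F)) \<le> real (N + length us)" by (rule of_nat_mono)
      moreover have "real (\<Sum>F\<leftarrow>map (piece UNIV) us. card (touch y N F)) = (\<Sum>u\<leftarrow>us. k (piece UNIV u))"
        by (induction us) auto
      ultimately show ?thesis using C by (intro mult_left_mono) auto
    qed
    also have "\<dots> \<le> C * (N * (1 + 1 / r))" using small C by (intro mult_left_mono) (auto simp: algebra_simps)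
    finally have V: "(\<Sum>u\<leftarrow>us. \<bar>pairing u Y\<bar>) * G \<le> C * (N * (1 + 1 / r))" .
    have "(\<Sum>u\<leftarrow>us. \<bar>pairing u ?x\<bar>) = e / N * (\<Sum>u\<leftarrow>us. \<bar>pairing u Y\<bar>)"
    proof -
      have "\<bar>pairing u ?x\<bar> = e / N * \<bar>pairing u Y\<bar>" for u unfolding px using e1 by (simp add: abs_mult)
      then show ?thesis by (simp only: sum_list_const_mult)
    qed
    then have "(\<Sum>u\<leftarrow>us. \<bar>pairing u ?x\<bar>) * G \<le> e / N * (C * (N * (1 + 1 / r)))"
      using mult_left_mono[OF V, of "e / N"] e1 by (simp add: mult.assoc)
    also have "\<dots> = C * (e * (1 + 1 / r))" using Npos by simp
    also have "\<dots> \<le> C * (e * ((1 + 6 / r) * (1 - 2 / r)))"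
    proof -
      \<comment> \<open>The origin of the 6 in the new constant: \<open>1 / r\<close> is lost in
        counting and \<open>2 / r\<close> in the growth function.\<close>
      have "1 + 1 / real r \<le> (1 + 6 / r) * (1 - 2 / r)"
      proof -
        define q where "q = 1 / real r"
        have q: "0 < q" "q \<le> 1 / 20" using r1 by (auto simp: q_def divide_simps)
        have "(1 + 6 * q) * (1 - 2 * q) = 1 + 4 * q - 12 * (q * q)" by (simp add: algebra_simps)
        moreover have "q * q \<le> 1 / 20 * q" using q by (intro mult_right_mono) auto
        ultimately have "1 + q \<le> (1 + 6 * q) * (1 - 2 * q)" using q by linarith
        then show ?thesis by (simp add: q_def)
      qed
      then show ?thesis using C e1 by (intro mult_left_mono) auto
    qed
    also have "\<dots> = C * (1 + 6 / r) * (e * (1 - 2 / r))" by simp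
    also have "\<dots> \<le> C * (1 + 6 / r) * G" using Gge C by (intro mult_left_mono) auto
    finally show ?thesis using Gpos by (simp only: mult_le_cancel_right_pos)
  qed
  have Wt: "\<bar>pairing (avg us) ?x\<bar> \<le> 3 * C / r ^ 8"
    if us: "nodel J us" and l: "real ((r ^ 8) ^ 2) \<le> lf (real (length us))" for us
  proof -
    have l': "e * e \<le> lf (real (length us))" using l by (simp add: e8 power2_eq_square)
    have ee: "0 < e * e" using e1 by simp
    have "\<bar>pairing (avg us) Y\<bar> \<le> C * k UNIV / lf (real (length us)) + 2 * C" using bound_node[OF us, of UNIV] by simp
    also have "\<dots> \<le> C * N / (e * e) + 2 * C"
      using l' ee C card_touch_le[of y N UNIV] by (intro add_right_mono frac_le mult_left_mono) auto
    finally have "e / N * \<bar>pairing (avg us) Y\<bar> \<le> e / N * (C * N / (e * e) + 2 * C)" using e1 by (intro mult_left_mono) auto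
    also have "\<dots> = C / e + 2 * C * (e / N)" using Npos e1 by (simp add: field_simps)
    also have "\<dots> \<le> C / e + 2 * C * (1 / e)"
    proof -
      have "e / N \<le> e / (e * e)" using e1 by (intro divide_left_mono[OF Ne _ mult_pos_pos[OF Npos ee]]) simp
      also have "\<dots> = 1 / e" using e1 by simp
      finally show ?thesis using C by (intro add_left_mono mult_left_mono) auto
    qed
    also have "\<dots> = 3 * C / e" by simp
    finally show ?thesis unfolding px using e1 by (simp add: abs_mult e_def)
  qed
  have Sp: "\<bar>pairing (specf c uss) ?x\<bar> \<le> 3 * C / r ^ 8"
    if uss: "specl J uss" "\<forall>us\<in>set uss. real ((r ^ 8) ^ 2) \<le> lf (real (length us))" and c: "0 \<le> c" "c \<le> 1 / 16" for uss c
  proof -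
    have ee: "0 < e * e" using e1 by simp
    have "\<bar>pairing (specf c uss) Y\<bar> \<le> k UNIV * (C / (4 * (e * e)) + d)"
      using bound_spec[OF uss(1) _ ee c, of UNIV] uss(2) by (simp add: e8 power2_eq_square)
    also have "\<dots> \<le> N * (C / (4 * (e * e)) + d)"
      using C ee d card_touch_le[of y N UNIV] by (intro mult_right_mono) auto
    finally have "e / N * \<bar>pairing (specf c uss) Y\<bar> \<le> e / N * (N * (C / (4 * (e * e)) + d))" using e1 by (intro mult_left_mono) auto
    also have "\<dots> = C / (4 * e) + e * d" using Npos e1 by (simp add: field_simps)
    also have "\<dots> \<le> C / e + C / e"
    proof -
      have "e * (e * d) \<le> N * d" using Ne d by (simp add: mult_right_mono flip: mult.assoc)
      also have "\<dots> \<le> 10 * N * d" using d by (intro mult_right_mono) auto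
      also have "\<dots> \<le> C" using d by simp
      finally have "e * d \<le> C / e" using e1 by (simp add: field_simps)
      moreover have "C / (4 * e) \<le> C / e" using C e1 by (simp add: field_simps)
      ultimately show ?thesis by linarith
    qed
    also have "\<dots> \<le> 3 * C / e" using C e1 by (simp add: field_simps)
    finally show ?thesis unfolding px using e1 by (simp add: abs_mult e_def)
  qed
  have Nm: "\<bar>pairing u ?x\<bar> \<le> C * (1 + 6 / r)" if u: "u \<in> relG J" for u
    using A[of "[u]"] u p0[of 2] by (simp add: nodel_def)
  show ?thesis unfolding good_def using x_c00 A Wt Sp Nm by auto
qed

end

section \<open>Trees of averages\<close>

text \<open>The scale on which all parameters are measured. Polynomial losses are absorbed by one
  step up the tower, so numerical constants hardly matter.\<close>

primrec tw :: "nat \<Rightarrow> nat"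
  where "tw 0 = 2 ^ 20" | "tw (Suc m) = 2 ^ tw m"

declare tw.simps [simp del]

lemma tw_ge: "2 ^ 20 + m \<le> tw m"
proof (induction m)
  case (Suc m)
  have "2 ^ 20 + Suc m \<le> tw m + 1" using Suc by simp
  also have "\<dots> \<le> 2 ^ tw m" using less_exp[of "tw m"] by linarith
  finally show ?case by (simp add: tw.simps)
qed (simp add: tw.simps)

lemma tw_less_Suc: "tw m < tw (Suc m)"
  using less_exp[of "tw m"] by (simp add: tw.simps)

lemma tw_mono: "m \<le> n \<Longrightarrow> tw m \<le> tw n"
  by (rule lift_Suc_mono_le[of tw]) (use tw_less_Suc less_imp_le in blast)+

lemma exp_ge_cube: "16 \<le> n \<Longrightarrow> n ^ 3 \<le> 2 ^ (n::nat)"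
proof (induction n rule: dec_induct)
  case (step n)
  have "Suc n ^ 3 = n ^ 3 + 3 * n ^ 2 + 3 * n + 1" by (simp add: power2_eq_square power3_eq_cube algebra_simps)
  also have "\<dots> \<le> n ^ 3 + n ^ 3"
  proof -
    have "16 * n ^ 2 \<le> n ^ 3" using step by (simp add: power2_eq_square power3_eq_cube)
    moreover have "16 * n \<le> n ^ 2" using step by (simp add: power2_eq_square)
    moreover have "1 \<le> n" using step by simp
    ultimately show ?thesis by linarith
  qed
  also have "\<dots> \<le> 2 ^ Suc n" using step by simp
  finally show ?case .
qed simp

lemma exp_ge_quadratic: "16 \<le> n \<Longrightarrow> 16 * n\<^sup>2 \<le> 2 ^ (n::nat)"
proof -
  assume n: "16 \<le> n"
  then have "16 * n\<^sup>2 \<le> n ^ 3" by (simp add: power2_eq_square power3_eq_cube)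
  then show ?thesis using exp_ge_cube[OF n] by simp
qed

section \<open>Choice of the parameters of the trees\<close>

context GM
begin

text \<open>If \<open>E = t\<close> fails, some \<open>m\<close> in \<open>J\<close> has
  \<open>lf m\<close> in the forbidden range. The next element of \<open>J\<close> is three
  exponentials further, so the range that belongs to \<open>E = 2 ^ (2 * t ^ 2)\<close>, which
  begins above \<open>lf m\<close>, is free.\<close>

lemma window_exists:
  assumes t: "16 \<le> t"
  shows "\<exists>E::nat. t \<le> E \<and> E \<le> 2 ^ (2 * t\<^sup>2) \<and> (\<forall>m\<in>J. lf (real m) \<le> real E ^ 2 \<or> 2 powr (2 * real E ^ 2) \<le> lf (real m))"
proof (cases "\<forall>m\<in>J. lf (real m) \<le> real t ^ 2 \<or> 2 powr (2 * real t ^ 2) \<le> lf (real m)")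
  case True
  have "t < 2 ^ t" by (rule less_exp)
  also have "(2::nat) ^ t \<le> 2 ^ (2 * t\<^sup>2)" using t by (intro power_increasing) (auto simp: power2_eq_square)
  finally show ?thesis using True by (intro exI[of _ t]) simp
next
  case False
  then obtain m where m: "m \<in> J" "real t ^ 2 < lf (real m)" "lf (real m) < 2 powr (2 * real t ^ 2)" by force
  define E where "E = (2::nat) ^ (2 * t\<^sup>2)"
  have Er: "real E = 2 powr (2 * real t ^ 2)" by (simp add: E_def powr_realpow[symmetric])
  have tE: "t \<le> E"
  proof -
    have "t < 2 ^ t" by (rule less_exp)
    also have "(2::nat) ^ t \<le> 2 ^ (2 * t\<^sup>2)" using t by (intro power_increasing) (auto simp: power2_eq_square)
    finally show ?thesis by (simp add: E_def)
  qed
  have "lf (real n) \<le> real E ^ 2 \<or> 2 powr (2 * real E ^ 2) \<le> lf (real n)" if n: "n \<in> J" for n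
  proof (rule disjCI)
    assume "\<not> 2 powr (2 * real E ^ 2) \<le> lf (real n)"
    then have n2: "lf (real n) < 2 powr (2 * real E ^ 2)" by simp
    show "lf (real n) \<le> real E ^ 2"
    proof (rule ccontr)
      assume "\<not> lf (real n) \<le> real E ^ 2"
      then have "real E ^ 2 < lf (real n)" by simp
      moreover have "real E \<le> real E ^ 2" using tE t by (simp add: power2_eq_square)
      ultimately have mn: "lf (real m) < lf (real n)" using m(3) Er by linarith
      then have "m < n" using lf_mono[of "real n" "real m"] by (intro not_le_imp_less) auto
      have "2 * real E ^ 2 = 2 powr (4 * real t ^ 2 + 1)"
        by (simp add: Er powr_add powr_power)
      also have "\<dots> \<le> 2 powr (2 powr (real t ^ 2))"
      proof -
        have "16 \<le> t\<^sup>2" using t power2_nat_le_imp_le[of 4 t] by (simp add: power2_eq_square) (metis le_square order_trans)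
        then have "16 * (t\<^sup>2)\<^sup>2 \<le> 2 ^ t\<^sup>2" by (rule exp_ge_quadratic)
        moreover have "4 * t\<^sup>2 + 1 \<le> 16 * (t\<^sup>2)\<^sup>2"
        proof -
          have "t\<^sup>2 * 1 \<le> t\<^sup>2 * t\<^sup>2" using t by (intro mult_left_mono) auto
          moreover have "1 \<le> t\<^sup>2" using t by simp
          ultimately show ?thesis unfolding power2_eq_square[of "t\<^sup>2"] by linarith
        qed
        ultimately have "4 * t\<^sup>2 + 1 \<le> 2 ^ t\<^sup>2" by linarith
        then have "real (4 * t\<^sup>2 + 1) \<le> real (2 ^ t\<^sup>2)" by (rule of_nat_mono)
        then have "4 * real t ^ 2 + 1 \<le> 2 powr (real t ^ 2)" by (simp add: powr_realpow[symmetric])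
        then show ?thesis by (intro powr_mono) auto
      qed
      finally have "2 powr (2 * real E ^ 2) \<le> 2 powr (2 powr (2 powr (real t ^ 2)))" by (intro powr_mono) auto
      also have "\<dots> \<le> 2 powr (2 powr (2 powr (lf (real m))))" using m(2) by (intro powr_mono) auto
      also have "\<dots> \<le> lf (real n)" by (rule GM_index_lacunary[OF J m(1) n \<open>m < n\<close>])
      finally show False using n2 by simp
    qed
  qed
  then show ?thesis using tE by (intro exI[of _ E]) (auto simp: E_def)
qed

text \<open>
  \<open>EE g\<close> is the smallest parameter used at level \<open>g\<close>, \<open>MM g\<close> bounds the number of children of a node
  of level \<open>g - 1\<close>, and \<open>rho g i\<close> is the parameter of the \<open>i\<close>-th child. All parameters of level \<open>g\<close>
  lie between \<open>EE g\<close> and \<open>XX g\<close>, and the choice of \<open>EE g\<close> keeps \<open>lf\<close> of elements of \<open>J\<close> away from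
  this range.
\<close>

definition EE :: "nat \<Rightarrow> nat"
  where "EE g = (SOME E. tw (6 * g + 3) \<le> E \<and> E \<le> 2 ^ (2 * (tw (6 * g + 3))\<^sup>2) \<and>
    (\<forall>m\<in>J. lf (real m) \<le> real E ^ 2 \<or> 2 powr (2 * real E ^ 2) \<le> lf (real m)))"

lemma EE: "tw (6 * g + 3) \<le> EE g" "EE g \<le> 2 ^ (2 * (tw (6 * g + 3))\<^sup>2)"
    "m \<in> J \<Longrightarrow> lf (real m) \<le> real (EE g) ^ 2 \<or> 2 powr (2 * real (EE g) ^ 2) \<le> lf (real m)"
proof -
  have "16 \<le> tw (6 * g + 3)" using tw_ge[of "6 * g + 3"] by simp
  from someI_ex[OF window_exists[OF this]]
  show "tw (6 * g + 3) \<le> EE g" "EE g \<le> 2 ^ (2 * (tw (6 * g + 3))\<^sup>2)"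
    "m \<in> J \<Longrightarrow> lf (real m) \<le> real (EE g) ^ 2 \<or> 2 powr (2 * real (EE g) ^ 2) \<le> lf (real m)"
    unfolding EE_def by blast+
qed

primrec MM :: "nat \<Rightarrow> nat"
  where "MM 0 = 1" | "MM (Suc g) = 2 ^ (EE g ^ 8 ^ MM g)"

definition XX :: "nat \<Rightarrow> nat" where "XX g = EE g ^ 8 ^ MM g"

definition rho :: "nat \<Rightarrow> nat \<Rightarrow> nat" where "rho g i = EE g ^ 8 ^ (i - 1)"

lemma MM_Suc: "MM (Suc g) = 2 ^ XX g"
  by (simp add: XX_def)

lemma EE_ge: "2 ^ 20 \<le> EE g" "tw g \<le> EE g"
  using EE(1)[of g] tw_ge[of "6 * g + 3"] tw_mono[of g "6 * g + 3"] by auto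

text \<open>The reason for six tower steps per level: \<open>MM g\<close> is at most
  \<open>tw (6 * g + 1)\<close>, so that \<open>8 ^ MM g\<close> fits below \<open>EE g\<close>,
  which starts at \<open>tw (6 * g + 3)\<close>; the search for a free window and the iterated
  eighth powers cost three more exponentials.\<close>

lemma MM_XX: "MM g \<le> tw (6 * g + 1) \<and> 8 ^ MM g \<le> EE g \<and> XX g \<le> 2 ^ (EE g)\<^sup>2 \<and> XX g \<le> tw (6 * g + 6)"
proof (induction g)
  have step: "8 ^ MM g \<le> EE g \<and> XX g \<le> 2 ^ (EE g)\<^sup>2 \<and> XX g \<le> tw (6 * g + 6)" if "MM g \<le> tw (6 * g + 1)" for g
  proof -
    let ?t = "tw (6 * g + 3)"
    have "3 * MM g \<le> 3 * tw (6 * g + 1)" using that by simp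
    also have "\<dots> \<le> 16 * (tw (6 * g + 1))\<^sup>2" using tw_ge[of "6 * g + 1"] by (simp add: power2_eq_square)
    also have "\<dots> \<le> 2 ^ tw (6 * g + 1)" using tw_ge[of "6 * g + 1"] by (intro exp_ge_quadratic) simp
    also have "\<dots> = tw (6 * g + 2)" using tw.simps(2)[of "6 * g + 1"] by simp
    finally have "(2::nat) ^ (3 * MM g) \<le> 2 ^ tw (6 * g + 2)" by (intro power_increasing) auto
    moreover have "?t = 2 ^ tw (6 * g + 2)"
      using tw.simps(2)[of "6 * g + 2"] by (simp only: numeral_3_eq_3 numeral_2_eq_2 add_Suc_right)
    ultimately have "8 ^ MM g \<le> ?t" by (simp add: power_mult)
    then have 8: "8 ^ MM g \<le> EE g" using EE(1)[of g] by simp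
    have "XX g \<le> EE g ^ EE g" unfolding XX_def using 8 EE_ge(1)[of g] by (intro power_increasing) auto
    also have "\<dots> \<le> (2 ^ EE g) ^ EE g" by (rule power_mono[OF less_imp_le[OF less_exp]]) simp
    also have "\<dots> = 2 ^ (EE g)\<^sup>2" by (simp add: power_mult power2_eq_square)
    finally have X: "XX g \<le> 2 ^ (EE g)\<^sup>2" .
    also have "(2::nat) ^ (EE g)\<^sup>2 \<le> 2 ^ (2 ^ (2 * ?t\<^sup>2))\<^sup>2" using EE(2)[of g] by (intro power_increasing power_mono) auto
    also have "\<dots> = 2 ^ 2 ^ (4 * ?t\<^sup>2)" by (simp add: power_mult[symmetric] mult.commute)
    also have "\<dots> \<le> 2 ^ 2 ^ 2 ^ ?t"
    proof -
      have "16 * ?t\<^sup>2 \<le> 2 ^ ?t" using tw_ge[of "6 * g + 3"] by (intro exp_ge_quadratic) simp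
      then show ?thesis by (intro power_increasing) auto
    qed
    also have "\<dots> = tw (6 * g + 6)"
    proof -
      have "tw (a + 3) = 2 ^ 2 ^ 2 ^ tw a" for a
        by (simp only: numeral_3_eq_3 add_Suc_right tw.simps add_0_right)
      from this[of "6 * g + 3"] show ?thesis by (simp add: add.commute)
    qed
    finally show ?thesis using 8 X by simp
  qed
  {
    case 0
    have "MM 0 \<le> tw 1" using tw_ge[of 1] by simp
    then show ?case using step[of 0] by simp
  next
    case (Suc g)
    have "MM (Suc g) \<le> 2 ^ tw (6 * g + 6)" unfolding MM_Suc using Suc by (intro power_increasing) auto
    also have "\<dots> = tw (6 * Suc g + 1)" using tw.simps(2)[of "6 * g + 6"] by simp
    finally show ?case using step[of "Suc g"] by simp
  }
qed

text \<open>Eighth powers make the windows of consecutive children adjacent: the upper end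
  \<open>(rho g i ^ 8) ^ 2\<close> of one is the lower end \<open>rho g (Suc i) ^ 2\<close> of the
  next.\<close>

lemma rho_Suc: "1 \<le> i \<Longrightarrow> rho g (Suc i) = rho g i ^ 8"
  unfolding rho_def by (cases i) (auto simp: power_mult[symmetric] mult.commute)

lemma rho_mono: "i \<le> j \<Longrightarrow> rho g i \<le> rho g j"
  unfolding rho_def using EE_ge(1)[of g] by (intro power_increasing) (auto intro!: power_increasing)

lemma rho_ge: "EE g \<le> rho g i"
  unfolding rho_def using EE_ge(1)[of g] power_increasing[of 1 "8 ^ (i - 1)" "EE g"] by simp

lemma rho8_le: "1 \<le> i \<Longrightarrow> i \<le> MM g \<Longrightarrow> rho g i ^ 8 \<le> XX g"
proof -
  assume i: "1 \<le> i" "i \<le> MM g"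
  have "rho g i ^ 8 = EE g ^ 8 ^ i" using i rho_Suc[of i g] by (simp add: rho_def)
  also have "\<dots> \<le> XX g" unfolding XX_def using i EE_ge(1)[of g] by (intro power_increasing) (auto intro!: power_increasing)
  finally show ?thesis .
qed

text \<open>All windows of level \<open>g\<close> lie between \<open>EE g ^ 2\<close> and
  \<open>XX g ^ 2\<close>, and \<open>XX g ^ 2\<close> is at most \<open>2 ^ (2 * EE g ^ 2)\<close>,
  the end of the range that was chosen free of \<open>J\<close>.\<close>

lemma window_free:
  assumes "m \<in> J" "1 \<le> i" "i \<le> MM g"
  shows "lf (real m) \<le> real (rho g i) ^ 2 \<or> real ((rho g i ^ 8) ^ 2) \<le> lf (real m)"
  using EE(3)[OF assms(1), of g]
proof
  assume "lf (real m) \<le> real (EE g) ^ 2"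
  also have "\<dots> \<le> real (rho g i) ^ 2" using rho_ge[of g i] by (intro power_mono) auto
  finally show ?thesis by simp
next
  assume a: "2 powr (2 * real (EE g) ^ 2) \<le> lf (real m)"
  have "(rho g i ^ 8) ^ 2 \<le> (2 ^ (EE g)\<^sup>2) ^ 2" using rho8_le[OF assms(2,3)] MM_XX[of g] by (intro power_mono) auto
  also have "\<dots> = 2 ^ (2 * (EE g)\<^sup>2)" by (simp add: power_mult[symmetric] mult.commute)
  finally have "real ((rho g i ^ 8) ^ 2) \<le> real (2 ^ (2 * (EE g)\<^sup>2))" by (rule of_nat_mono)
  also have "\<dots> = 2 powr (2 * real (EE g) ^ 2)" by (simp add: powr_realpow[symmetric])
  finally show ?thesis using a by simp
qed

end

lemma chain_exists:
  assumes "\<And>i p. \<exists>q y. p < q \<and> P i p q y"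
  shows "\<exists>Q Y. Q 0 = (p0::nat) \<and> (\<forall>i::nat. Q i < Q (Suc i) \<and> P i (Q i) (Q (Suc i)) (Y i))"
proof -
  define F where "F i p = (SOME t. p < fst t \<and> P i p (fst t) (snd t))" for i p
  define f h where "f i p = fst (F i p)" and "h i p = snd (F i p)" for i p
  have fh: "p < f i p \<and> P i p (f i p) (h i p)" for i p
  proof -
    have "\<exists>t. p < fst t \<and> P i p (fst t) (snd t)" using assms[of p i] by auto
    from someI_ex[OF this] show ?thesis by (simp add: f_def h_def F_def)
  qed
  define Q where "Q = rec_nat p0 (\<lambda>i p. f i p)"
  have "Q 0 = p0" "Q (Suc i) = f i (Q i)" for i by (auto simp: Q_def)
  then show ?thesis using fh by (intro exI[of _ Q] exI[of _ "\<lambda>i. h i (Q i)"]) auto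
qed

lemma good_mono:
  assumes "good J C a p d y" "C \<le> C'" "d \<le> d'"
  shows "good J C' a p d' y"
  using assms unfolding good_def by (auto intro: order_trans) (meson order_trans)+

definition unitv :: "nat \<Rightarrow> nat \<Rightarrow> real"
  where "unitv n = (\<lambda>i. if i = n then 1 else 0)"

lemma supp_unitv: "supp (unitv n) = {n}"
  by (auto simp: supp_def unitv_def)

lemma unitv_c00: "unitv n \<in> c00"
  by (simp add: c00_def supp_unitv)

lemma pairing_unitv: "pairing u (unitv n) = u n"
  by (simp add: pairing_def supp_unitv) (simp add: unitv_def)

lemma pairing_unitv_self: "pairing (unitv n) (unitv n) = 1"
  by (simp add: pairing_unitv) (simp add: unitv_def)

text \<open>Unit vectors are the leaves of the trees. Only one of several successive functionals can
  act on such a vector, so there is no restriction on \<open>a\<close>.\<close>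

lemma good_unitv:
  assumes J: "GM_index_set J" and p: "0 < p" "1 / p \<le> d"
  shows "good J 1 a p d (unitv n)"
proof -
  have A: "(\<Sum>u\<leftarrow>us. \<bar>pairing u (unitv n)\<bar>) \<le> 1" if "nodel J us" for us
    unfolding pairing_unitv using that relG_abs_le[OF _ J]
    by (intro sum_list_sorted_le_1) (auto simp: nodel_def)
  have W: "\<bar>pairing (avg us) (unitv n)\<bar> \<le> d" if us: "nodel J us" and l: "p \<le> lf (real (length us))" for us
  proof -
    have "\<bar>avg us n\<bar> \<le> 1 / lf (real (length us))"
      using us relG_abs_le[OF _ J] by (intro abs_avg_le) (auto simp: nodel_def)
    also have "\<dots> \<le> 1 / p" using p l by (intro divide_left_mono) auto
    finally show ?thesis using p by (simp add: pairing_unitv)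
  qed
  have S: "\<bar>pairing (specf c uss) (unitv n)\<bar> \<le> d"
    if uss: "specl J uss" "\<forall>us\<in>set uss. p \<le> lf (real (length us))" and c: "0 \<le> c" "c \<le> 1 / 16" for uss c
  proof -
    have "(\<Sum>us\<leftarrow>uss. \<bar>avg us n\<bar>) \<le> (\<Sum>us\<leftarrow>uss. 1 / p * (\<Sum>u\<leftarrow>us. \<bar>u n\<bar>))"
    proof (rule sum_list_mono)
      fix us assume us: "us \<in> set uss"
      have "\<bar>avg us n\<bar> = 1 / lf (real (length us)) * \<bar>\<Sum>u\<leftarrow>us. u n\<bar>"
        using uss(2) us p by (auto simp: avg_def abs_mult)
      also have "\<dots> \<le> 1 / p * (\<Sum>u\<leftarrow>us. \<bar>u n\<bar>)"
        using uss(2) us p by (intro mult_mono abs_sum_list_le divide_left_mono) auto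
      finally show "\<bar>avg us n\<bar> \<le> 1 / p * (\<Sum>u\<leftarrow>us. \<bar>u n\<bar>)" .
    qed
    also have "\<dots> = 1 / p * (\<Sum>u\<leftarrow>concat uss. \<bar>u n\<bar>)" by (induction uss) (auto simp: algebra_simps add_divide_distrib)
    also have "\<dots> \<le> 1 / p * 1"
      using uss(1) relG_abs_le[OF _ J] p by (intro mult_left_mono sum_list_sorted_le_1) (auto simp: specl_def)
    finally have 1: "(\<Sum>us\<leftarrow>uss. \<bar>avg us n\<bar>) \<le> d" using p by simp
    have "\<bar>pairing (specf c uss) (unitv n)\<bar> = c * \<bar>\<Sum>us\<leftarrow>uss. avg us n\<bar>"
      using c by (simp add: pairing_unitv specf_def abs_mult)
    also have "\<dots> \<le> 1 * (\<Sum>us\<leftarrow>uss. \<bar>avg us n\<bar>)" using c by (intro mult_mono abs_sum_list_le) auto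
    finally show ?thesis using 1 by simp
  qed
  show ?thesis unfolding good_def using unitv_c00 A W S relG_abs_le[OF _ J] by (auto simp: pairing_unitv)
qed

lemma sum_list_map_concat: "(\<Sum>x\<leftarrow>concat xss. f x) = (\<Sum>xs\<leftarrow>xss. \<Sum>x\<leftarrow>xs. (f x :: real))"
  by (induction xss) auto

section \<open>Construction of the trees\<close>

context GM
begin

lemma EE_ge': "1048576 \<le> EE g"
  using EE_ge(1)[of g] by simp

lemma rho_ge': "1048576 \<le> rho g i"
  using rho_ge[of g i] EE_ge'[of g] by linarith

text \<open>A tree functional cut at one level: the subtrees below the cut remain norming
  functionals, and the weights above it multiply to coefficients at most \<open>t\<close>. The
  number of pieces is bounded by a power of 2 because only its logarithm will enter.\<close>

definition cut :: "real \<Rightarrow> nat \<Rightarrow> nat set \<Rightarrow> (nat \<Rightarrow> real) \<Rightarrow> bool"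
  where "cut t B P z \<longleftrightarrow> (\<exists>ps. z = (\<lambda>n. \<Sum>sw\<leftarrow>ps. fst sw * snd sw n) \<and>
    (\<forall>sw\<in>set ps. 0 \<le> fst sw \<and> fst sw \<le> t \<and> snd sw \<in> GMs J \<sigma> \<and> supp (snd sw) \<subseteq> P) \<and>
    sorted_wrt vec_before (map snd ps) \<and> length ps \<le> 2 ^ B)"

lemma cut_self: "z \<in> GMs J \<sigma> \<Longrightarrow> supp z \<subseteq> P \<Longrightarrow> cut 1 0 P z"
  unfolding cut_def by (rule exI[of _ "[(1, z)]"]) auto

lemma vec_before_atLeastLessThan:
  "supp x \<subseteq> {a..<b} \<Longrightarrow> supp y \<subseteq> {c..<d} \<Longrightarrow> b \<le> c \<Longrightarrow> vec_before x y"
  unfolding vec_before_def set_before_def by fastforce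

lemma cut_avg:
  assumes Q: "\<And>i. Q i < Q (Suc i)" and N: "N \<le> 2 ^ X" "lf (real N) = e" "0 < e"
    and z: "\<And>i. i < N \<Longrightarrow> cut t B {Q i..<Q (Suc i)} (z i)" and t': "t / e \<le> t'"
  shows "cut t' (X + B) {Q 0..<Q N} (avg (map z [0..<N]))"
proof -
  have Qm: "i \<le> j \<Longrightarrow> Q i \<le> Q j" for i j by (rule lift_Suc_mono_le[of Q]) (use Q less_imp_le in blast)+
  have "\<forall>i\<in>{..<N}. \<exists>ps. z i = (\<lambda>n. \<Sum>sw\<leftarrow>ps. fst sw * snd sw n) \<and>
    (\<forall>sw\<in>set ps. 0 \<le> fst sw \<and> fst sw \<le> t \<and> snd sw \<in> GMs J \<sigma> \<and> supp (snd sw) \<subseteq> {Q i..<Q (Suc i)}) \<and>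
    sorted_wrt vec_before (map snd ps) \<and> length ps \<le> 2 ^ B" using z unfolding cut_def by auto
  from bchoice[OF this] obtain p where
    p1: "\<And>i. i < N \<Longrightarrow> z i = (\<lambda>n. \<Sum>sw\<leftarrow>p i. fst sw * snd sw n)" and
    p2: "\<And>i sw. i < N \<Longrightarrow> sw \<in> set (p i) \<Longrightarrow> 0 \<le> fst sw \<and> fst sw \<le> t \<and> snd sw \<in> GMs J \<sigma> \<and> supp (snd sw) \<subseteq> {Q i..<Q (Suc i)}" and
    p3: "\<And>i. i < N \<Longrightarrow> sorted_wrt vec_before (map snd (p i))" and
    p4: "\<And>i. i < N \<Longrightarrow> length (p i) \<le> 2 ^ B" by auto
  define ps where "ps = concat (map (\<lambda>i. map (\<lambda>sw. (fst sw / e, snd sw)) (p i)) [0..<N])"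
  have sndps: "map snd ps = concat (map (\<lambda>i. map snd (p i)) [0..<N])"
    by (simp add: ps_def map_concat o_def)
  show ?thesis unfolding cut_def
  proof (intro exI[of _ ps] conjI)
    show "avg (map z [0..<N]) = (\<lambda>n. \<Sum>sw\<leftarrow>ps. fst sw * snd sw n)"
    proof
      fix n
      have "(\<Sum>sw\<leftarrow>ps. fst sw * snd sw n) = (\<Sum>i\<leftarrow>[0..<N]. \<Sum>sw\<leftarrow>p i. fst sw / e * snd sw n)"
        unfolding ps_def sum_list_map_concat by (simp add: o_def)
      also have "\<dots> = (\<Sum>i\<leftarrow>[0..<N]. 1 / e * z i n)"
      proof (intro arg_cong[of _ _ sum_list] map_cong refl)
        fix i assume "i \<in> set [0..<N]"
        then show "(\<Sum>sw\<leftarrow>p i. fst sw / e * snd sw n) = 1 / e * z i n"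
          using p1[of i] by (simp add: sum_list_const_mult[symmetric])
      qed
      also have "\<dots> = avg (map z [0..<N]) n" by (simp only: avg_def N sum_list_const_mult map_map o_def length_map length_upt diff_zero)
      finally show "avg (map z [0..<N]) n = (\<Sum>sw\<leftarrow>ps. fst sw * snd sw n)" ..
    qed
    show "\<forall>sw\<in>set ps. 0 \<le> fst sw \<and> fst sw \<le> t' \<and> snd sw \<in> GMs J \<sigma> \<and> supp (snd sw) \<subseteq> {Q 0..<Q N}"
    proof
      fix sw assume "sw \<in> set ps"
      then obtain i sw' where i: "i < N" "sw' \<in> set (p i)" "sw = (fst sw' / e, snd sw')" by (auto simp: ps_def)
      have "fst sw' / e \<le> t / e" using p2[OF i(1,2)] N by (intro divide_right_mono) auto
      moreover have "{Q i..<Q (Suc i)} \<subseteq> {Q 0..<Q N}" using Qm[of 0 i] Qm[of "Suc i" N] i by auto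
      ultimately show "0 \<le> fst sw \<and> fst sw \<le> t' \<and> snd sw \<in> GMs J \<sigma> \<and> supp (snd sw) \<subseteq> {Q 0..<Q N}"
        using p2[OF i(1,2)] i N t' by auto
    qed
    show "sorted_wrt vec_before (map snd ps)" unfolding sndps
    proof (rule sorted_wrt_concat)
      show "sorted_wrt vec_before xs" if "xs \<in> set (map (\<lambda>i. map snd (p i)) [0..<N])" for xs
        using that p3 by auto
      show "sorted_wrt (\<lambda>xs ys. \<forall>x\<in>set xs. \<forall>y\<in>set ys. vec_before x y) (map (\<lambda>i. map snd (p i)) [0..<N])"
        unfolding sorted_wrt_map
      proof (rule sorted_wrt_mono_rel[of _ "(<)"])
        fix i j assume ij: "i \<in> set [0..<N]" "j \<in> set [0..<N]" "i < j"
        show "\<forall>x\<in>set (map snd (p i)). \<forall>y\<in>set (map snd (p j)). vec_before x y"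
        proof (intro ballI)
          fix x y assume "x \<in> set (map snd (p i))" "y \<in> set (map snd (p j))"
          then obtain a b where "a \<in> set (p i)" "x = snd a" "b \<in> set (p j)" "y = snd b" by auto
          then have "supp x \<subseteq> {Q i..<Q (Suc i)}" "supp y \<subseteq> {Q j..<Q (Suc j)}" using p2[of i a] p2[of j b] ij by auto
          then show "vec_before x y" by (rule vec_before_atLeastLessThan) (use Qm ij in simp)
        qed
      qed simp
    qed
    have "length ps = (\<Sum>i\<leftarrow>[0..<N]. length (p i))" by (simp add: ps_def length_concat o_def)
    also have "\<dots> \<le> (\<Sum>i\<leftarrow>[0..<N]. 2 ^ B)" using p4 by (intro sum_list_mono) auto
    also have "\<dots> = N * 2 ^ B" by (simp add: sum_list_triv)
    also have "\<dots> \<le> 2 ^ X * 2 ^ B" using N by simp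
    finally show "length ps \<le> 2 ^ (X + B)" by (simp add: power_add)
  qed
qed

text \<open>For a tree with root at level \<open>g\<close> that is cut at level \<open>h\<close>,
  \<open>Th\<close> bounds the product of the weights above the cut and \<open>BB\<close> the
  logarithm of the number of pieces.\<close>

definition Th :: "nat \<Rightarrow> nat \<Rightarrow> real" where "Th g h = (\<Prod>j\<in>{g..<h}. 1 / real (EE j))"
definition BB :: "nat \<Rightarrow> nat \<Rightarrow> nat" where "BB g h = (\<Sum>j\<in>{g..<h}. XX j)"

text \<open>Here \<open>r\<close> is the remaining depth, which limits the levels at which
  \<open>z\<close> can be cut. The norm bounds grow towards the root by summable amounts, so a root
  at level 0 has bound 2 whatever its depth.\<close>

definition tree_node :: "nat \<Rightarrow> nat \<Rightarrow> nat \<Rightarrow> nat \<Rightarrow> nat \<Rightarrow> (nat \<Rightarrow> real) \<Rightarrow> (nat \<Rightarrow> real) \<Rightarrow> bool"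
  where "tree_node r g i p q x z \<longleftrightarrow> supp x \<subseteq> {p..<q} \<and> supp z \<subseteq> {p..<q} \<and>
    good J (1 + (1 / 2) ^ g) (rho g i ^ 2) ((rho g i ^ 8) ^ 2) (6 / rho g i ^ 8) x \<and>
    z \<in> GMs J \<sigma> \<and> pairing z x = 1 \<and> (\<forall>h. g \<le> h \<longrightarrow> h \<le> g + r \<longrightarrow> cut (Th g h) (BB g h) {p..<q} z)"

lemma Th_refl: "Th g g = 1" and BB_refl: "BB g g = 0"
  by (simp_all add: Th_def BB_def)

lemma Th_step: "g < h \<Longrightarrow> Th g h = Th (Suc g) h / EE g"
  by (simp add: Th_def prod.atLeast_Suc_lessThan)

lemma BB_step: "g < h \<Longrightarrow> BB g h = XX g + BB (Suc g) h"
  by (simp add: BB_def sum.atLeast_Suc_lessThan)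

lemma Th_nonneg: "0 \<le> Th g h"
  by (simp add: Th_def prod_nonneg)

text \<open>
  A node of level \<open>g\<close> carries a rapidly increasing sequence of nodes of level \<open>g + 1\<close>. The
  lengths of all averages avoid neighbourhoods of \<open>J\<close>, so that special functionals are harmless.
\<close>

lemma tree_exists: "1 \<le> i \<Longrightarrow> i \<le> MM g \<Longrightarrow> \<exists>q xz. p < q \<and> tree_node r g i p q (fst xz) (snd xz)"
proof (induction r arbitrary: g i p)
  case 0
  have r1: "1 \<le> rho g i" using rho_ge'[of g i] by linarith
  have "good J 1 (rho g i ^ 2) ((rho g i ^ 8) ^ 2) (6 / rho g i ^ 8) (unitv p)"
  proof (rule good_unitv[OF J])
    show "0 < real ((rho g i ^ 8) ^ 2)" using r1 by simp
    have "1 \<le> real (rho g i ^ 8)" using r1 by (simp add: one_le_power)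
    then have "1 / real (rho g i ^ 8) * (1 / real (rho g i ^ 8)) \<le> 6 * (1 / real (rho g i ^ 8))"
      by (intro mult_right_mono) (auto simp: divide_simps)
    then show "1 / real ((rho g i ^ 8) ^ 2) \<le> 6 / real (rho g i ^ 8)" by (simp add: power2_eq_square)
  qed
  then have "good J (1 + (1 / 2) ^ g) (rho g i ^ 2) ((rho g i ^ 8) ^ 2) (6 / rho g i ^ 8) (unitv p)"
    by (rule good_mono) auto
  moreover have "unitv p \<in> GMs J \<sigma>" using GMs_base[of 1 p] by (simp add: unitv_def)
  moreover from this have "cut 1 0 {p..<Suc p} (unitv p)" by (rule cut_self) (simp add: supp_unitv)
  ultimately have "tree_node 0 g i p (Suc p) (unitv p) (unitv p)"
    unfolding tree_node_def using Th_refl BB_refl by (auto simp: supp_unitv pairing_unitv_self dest!: le_antisym)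
  then show ?case by (intro exI[of _ "Suc p"] exI[of _ "(unitv p, unitv p)"]) simp
next
  case (Suc r)
  let ?r = "rho g i"
  define N where "N = (2::nat) ^ ?r ^ 8 - 1"
  have r20: "20 \<le> ?r" using rho_ge'[of g i] by linarith
  have Nr: "real N = 2 ^ ?r ^ 8 - 1" by (simp add: N_def of_nat_diff)
  have N2: "N \<le> 2 ^ XX g"
  proof -
    have "(2::nat) ^ ?r ^ 8 \<le> 2 ^ XX g" using rho8_le[OF Suc.prems] by (intro power_increasing) auto
    then show ?thesis unfolding N_def by (rule order_trans[OF diff_le_self])
  qed
  have N1: "1 \<le> N"
  proof -
    have "(2::nat) ^ 1 \<le> 2 ^ ?r ^ 8" using r20 by (intro power_increasing) (auto simp: Suc_le_eq)
    then have "1 + 1 \<le> (2::nat) ^ ?r ^ 8" by (simp only: power_one_right one_add_one)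
    then show ?thesis unfolding N_def by linarith
  qed
  have NM: "N \<le> MM (Suc g)" using N2 by (simp add: MM_Suc del: MM.simps)
  have lfN: "lf (real N) = real (?r ^ 8)" unfolding Nr by (rule lf_pow2)
  \<comment> \<open>Only the first \<open>N\<close> children matter; from there on the condition is
    void and the chain merely continues.\<close>
  define P where "P k p q xz \<longleftrightarrow> (k < N \<longrightarrow> tree_node r (Suc g) (Suc k) p q (fst xz) (snd xz))" for k p q and xz :: "(nat \<Rightarrow> real) \<times> (nat \<Rightarrow> real)"
  have "\<exists>q y. p < q \<and> P k p q y" for k p
  proof (cases "k < N")
    case True
    then show ?thesis using Suc.IH[of "Suc k" "Suc g" p] NM unfolding P_def by (auto simp del: MM.simps)
  next
    case False
    then show ?thesis unfolding P_def by auto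
  qed
  from chain_exists[of P, OF this, of p] obtain Q Y where Q0: "Q 0 = p"
    and QY: "\<And>k. Q k < Q (Suc k) \<and> P k (Q k) (Q (Suc k)) (Y k)" by auto
  define x where "x k = fst (Y k)" for k
  define z where "z k = snd (Y k)" for k
  have nd: "tree_node r (Suc g) (Suc k) (Q k) (Q (Suc k)) (x k) (z k)" if "k < N" for k
    using QY[of k] that by (simp add: P_def x_def z_def)
  have Qm: "k \<le> k' \<Longrightarrow> Q k \<le> Q k'" for k k' by (rule lift_Suc_mono_le[of Q]) (use QY less_imp_le in blast)+
  define y where "y k = x (k - 1)" for k
  define C :: real where "C = 1 + (1 / 2) ^ Suc g"
  have Cb: "1 \<le> C" "C \<le> 2"
    unfolding C_def using power_le_one[of "1/2::real" "Suc g"] by (auto simp del: power_Suc)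
  interpret RIS J N y C "6 / EE (Suc g)" "\<lambda>k. real (rho (Suc g) k ^ 2)" "\<lambda>k. real ((rho (Suc g) k ^ 8) ^ 2)"
  proof
    show "GM_index_set J" by (rule J)
    show "1 \<le> N" by (rule N1)
    show "0 < C" using Cb by simp
    show "0 \<le> 6 / real (EE (Suc g))" by simp
    \<comment> \<open>The number of children is bounded in terms of level \<open>g\<close>, and
      \<open>EE (Suc g)\<close> lies exponentials above that bound; hence the accumulated errors of
      the children are negligible.\<close>
    have "60 * N \<le> 60 * 2 ^ XX g" using N2 by simp
    also have "\<dots> \<le> 60 * 2 ^ tw (6 * g + 6)" using MM_XX[of g] by (intro mult_left_mono power_increasing) auto
    also have "\<dots> = 60 * tw (Suc (6 * g + 6))" by (simp only: tw.simps)
    also have "\<dots> \<le> 16 * (tw (Suc (6 * g + 6)))\<^sup>2" using tw_ge[of "Suc (6 * g + 6)"] by (simp add: power2_eq_square)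
    also have "\<dots> \<le> 2 ^ tw (Suc (6 * g + 6))" using tw_ge[of "Suc (6 * g + 6)"] by (intro exp_ge_quadratic) simp
    also have "\<dots> = tw (Suc (Suc (6 * g + 6)))" by (simp only: tw.simps)
    also have "\<dots> \<le> tw (6 * Suc g + 3)" by (rule tw_mono) simp
    also have "\<dots> \<le> EE (Suc g)" by (rule EE(1))
    finally have "real (60 * N) \<le> real (EE (Suc g))" by (rule of_nat_mono)
    then have "10 * real N * (6 / real (EE (Suc g))) \<le> 1" using EE_ge'[of "Suc g"] by (simp add: divide_simps)
    then show "real (10 * N) * (6 / real (EE (Suc g))) \<le> C" using Cb by simp
  next
    fix k assume k: "k \<in> {1..N}"
    have "good J C (real (rho (Suc g) k ^ 2)) (real ((rho (Suc g) k ^ 8) ^ 2)) (6 / real (rho (Suc g) k ^ 8)) (y k)"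
      using nd[of "k - 1"] k by (auto simp: tree_node_def y_def C_def)
    moreover have "6 / real (rho (Suc g) k ^ 8) \<le> 6 / EE (Suc g)"
    proof -
      have "rho (Suc g) k \<le> rho (Suc g) k ^ 8" using self_le_power[of "rho (Suc g) k" 8] rho_ge'[of "Suc g" k] by simp
      then have "real (EE (Suc g)) \<le> real (rho (Suc g) k ^ 8)" using rho_ge[of "Suc g" k] by (intro of_nat_mono) linarith
      moreover have "1048576 \<le> real (EE (Suc g))" using of_nat_mono[OF EE_ge'[of "Suc g"], where 'a = real] by simp
      ultimately show ?thesis by (intro divide_left_mono mult_pos_pos) linarith+
    qed
    ultimately show "good J C (real (rho (Suc g) k ^ 2)) (real ((rho (Suc g) k ^ 8) ^ 2)) (6 / real (EE (Suc g))) (y k)"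
      by (rule good_mono[OF _ order_refl])
    fix m assume "m \<in> J"
    then have "lf (real m) \<le> real (rho (Suc g) k) ^ 2 \<or> real ((rho (Suc g) k ^ 8) ^ 2) \<le> lf (real m)"
      by (rule window_free) (use k NM in auto)
    then show "lf (real m) \<le> real (rho (Suc g) k ^ 2) \<or> real ((rho (Suc g) k ^ 8) ^ 2) \<le> lf (real m)"
      by (simp only: of_nat_power)
  next
    fix k k' assume k: "k \<in> {1..N}" "k' \<in> {1..N}" "k < k'"
    have "supp (x (k - 1)) \<subseteq> {Q (k - 1)..<Q (Suc (k - 1))}" "supp (x (k' - 1)) \<subseteq> {Q (k' - 1)..<Q (Suc (k' - 1))}"
      using nd[of "k - 1"] nd[of "k' - 1"] k by (auto simp: tree_node_def)
    then show "vec_before (y k) (y k')" unfolding y_def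
      by (rule vec_before_atLeastLessThan) (use k in \<open>auto intro: Qm\<close>)
    have "rho (Suc g) k ^ 8 \<le> rho (Suc g) k'" using rho_Suc[of k "Suc g"] rho_mono[of "Suc k" k' "Suc g"] k by simp
    then show "real ((rho (Suc g) k ^ 8) ^ 2) \<le> real (rho (Suc g) k' ^ 2)"
      by (intro of_nat_mono power_mono) auto
  qed
  have Yeq: "RIS.Y N y = (\<lambda>n. \<Sum>k<N. x k n)"
  proof
    fix n show "RIS.Y N y n = (\<Sum>k<N. x k n)" unfolding Y_def y_def
      by (rule sum.reindex_bij_witness[of _ Suc "\<lambda>k. k - 1"]) auto
  qed
  define X where "X = (\<lambda>n. ?r ^ 8 / N * RIS.Y N y n)"
  define Z where "Z = avg (map z [0..<N])"
  have ga: "good J (C * (1 + 6 / ?r)) (?r ^ 2) ((?r ^ 8) ^ 2) (3 * C / ?r ^ 8) X"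
    using good_average[OF r20 Nr] by (simp add: X_def)
  have "good J (1 + (1 / 2) ^ g) (?r ^ 2) ((?r ^ 8) ^ 2) (6 / ?r ^ 8) X"
  proof (rule good_mono[OF ga])
    show "C * (1 + 6 / real ?r) \<le> 1 + (1 / 2) ^ g"
    proof -
      \<comment> \<open>Gives \<open>12 / r <= (1 / 2) ^ Suc g\<close>, exactly the increase of the
        norm bound permitted between level \<open>Suc g\<close> and level \<open>g\<close>.\<close>
      have "24 * 2 ^ g \<le> tw (6 * g + 3)"
      proof (induction g)
        case 0 show ?case using tw_ge[of 3] by simp
      next
        case (Suc g)
        have "24 * 2 ^ Suc g \<le> 2 * tw (6 * g + 3)" using Suc by simp
        also have "\<dots> \<le> 16 * (tw (6 * g + 3))\<^sup>2" using self_le_power[of "tw (6 * g + 3)" 2] tw_ge[of "6 * g + 3"] by linarith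
        also have "\<dots> \<le> 2 ^ tw (6 * g + 3)" using tw_ge[of "6 * g + 3"] by (intro exp_ge_quadratic) simp
        also have "\<dots> = tw (Suc (6 * g + 3))" by (simp only: tw.simps)
        also have "\<dots> \<le> tw (6 * Suc g + 3)" by (rule tw_mono) simp
        finally show ?case .
      qed
      then have "24 * 2 ^ g \<le> ?r" using EE(1)[of g] rho_ge[of g i] by linarith
      then have "real (24 * 2 ^ g) \<le> real ?r" by (rule of_nat_mono)
      then have "12 / real ?r \<le> 12 / real (24 * 2 ^ g)" using r20 by (intro divide_left_mono) auto
      also have "\<dots> = (1 / 2) ^ Suc g" by (simp add: power_one_over)
      finally have 1: "12 / real ?r \<le> (1 / 2) ^ Suc g" .
      have "C * (6 / real ?r) \<le> 2 * (6 / ?r)" using Cb by (intro mult_right_mono) auto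
      then have "C * (1 + 6 / real ?r) \<le> C + 12 / ?r" by (simp add: distrib_left)
      also have "\<dots> \<le> 1 + (1 / 2) ^ Suc g + (1 / 2) ^ Suc g" using 1 by (simp add: C_def)
      finally show ?thesis by simp
    qed
    show "3 * C / real (?r ^ 8) \<le> 6 / real (?r ^ 8)" using Cb by (intro divide_right_mono) auto
  qed
  moreover have "supp X \<subseteq> {p..<Q N}"
  proof
    fix n assume "n \<in> supp X"
    then have "(\<Sum>k<N. x k n) \<noteq> 0" by (auto simp: supp_def X_def Yeq)
    then obtain k where k: "k < N" "x k n \<noteq> 0" by (meson lessThan_iff sum.not_neutral_contains_not_neutral)
    then have "n \<in> {Q k..<Q (Suc k)}" using nd[OF k(1)] by (auto simp: tree_node_def supp_def)
    then show "n \<in> {p..<Q N}" using Qm[of 0 k] Qm[of "Suc k" N] k Q0 by auto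
  qed
  moreover have "supp Z \<subseteq> {p..<Q N}"
  proof
    fix n assume "n \<in> supp Z"
    then have "(\<Sum>u\<leftarrow>map z [0..<N]. u n) \<noteq> 0" by (auto simp: supp_def Z_def avg_def)
    then have "(\<Sum>k<N. z k n) \<noteq> 0" by (simp add: o_def interv_sum_list_conv_sum_set_nat atLeast0LessThan)
    then obtain k where k: "k < N" "z k n \<noteq> 0" by (meson lessThan_iff sum.not_neutral_contains_not_neutral)
    then have "n \<in> {Q k..<Q (Suc k)}" using nd[OF k(1)] by (auto simp: tree_node_def supp_def)
    then show "n \<in> {p..<Q N}" using Qm[of 0 k] Qm[of "Suc k" N] k Q0 by auto
  qed
  moreover have Zin: "Z \<in> GMs J \<sigma>" unfolding Z_def
  proof (rule GMs_avg)
    show "set (map z [0..<N]) \<subseteq> GMs J \<sigma>" using nd by (auto simp: tree_node_def)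
    show "map z [0..<N] \<noteq> []" using N1 by simp
    show "sorted_wrt vec_before (map z [0..<N])" unfolding sorted_wrt_map
    proof (rule sorted_wrt_mono_rel[of _ "(<)"])
      fix k k' assume k: "k \<in> set [0..<N]" "k' \<in> set [0..<N]" "k < k'"
      have "supp (z k) \<subseteq> {Q k..<Q (Suc k)}" "supp (z k') \<subseteq> {Q k'..<Q (Suc k')}"
        using nd[of k] nd[of k'] k by (auto simp: tree_node_def)
      then show "vec_before (z k) (z k')" by (rule vec_before_atLeastLessThan) (use k in \<open>auto intro: Qm\<close>)
    qed simp
  qed
  moreover have "pairing Z X = 1"
  proof -
    have xc: "k < N \<Longrightarrow> x k \<in> c00" for k using nd[of k] good_c00 by (auto simp: tree_node_def)
    have zx: "pairing (z k) (x k') = (if k = k' then 1 else 0)" if "k < N" "k' < N" for k k'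
    proof (cases "k = k'")
      case True then show ?thesis using nd[OF that(1)] by (simp add: tree_node_def)
    next
      case False
      have "supp (z k) \<inter> supp (x k') = {}"
        using nd[OF that(1)] nd[OF that(2)] False Qm[of "Suc k" k'] Qm[of "Suc k'" k]
        unfolding tree_node_def by (cases "k < k'") fastforce+
      then show ?thesis using False pairing_eq_0 by simp
    qed
    have pz: "pairing (z k) (RIS.Y N y) = 1" if "k < N" for k
    proof -
      have "pairing (z k) (RIS.Y N y) = (\<Sum>k'<N. pairing (z k) (x k'))" unfolding Yeq using xc by (intro pairing_sum) auto
      also have "\<dots> = (\<Sum>k'<N. if k = k' then 1 else 0)" using zx that by (intro sum.cong) auto
      finally show ?thesis using that by simp
    qed
    have "pairing Z X = ?r ^ 8 / N * pairing Z (RIS.Y N y)" unfolding X_def by (rule pairing_scale[OF Y_c00])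
    also have "pairing Z (RIS.Y N y) = 1 / ?r ^ 8 * (\<Sum>k\<leftarrow>[0..<N]. pairing (z k) (RIS.Y N y))"
      unfolding Z_def pairing_avg using lfN by (simp add: o_def)
    also have "(\<Sum>k\<leftarrow>[0..<N]. pairing (z k) (RIS.Y N y)) = (\<Sum>k\<leftarrow>[0..<N]. 1)"
      using pz by (intro arg_cong[of _ _ sum_list] map_cong) auto
    also have "\<dots> = N" by (simp add: sum_list_triv)
    finally show ?thesis using N1 r20 by simp
  qed
  moreover have "cut (Th g h) (BB g h) {p..<Q N} Z" if h: "g \<le> h" "h \<le> g + Suc r" for h
  proof (cases "g = h")
    case True
    then show ?thesis using cut_self[OF Zin] calculation(3) by (simp add: Th_refl BB_refl)
  next
    case False
    then have gh: "g < h" using h by simp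
    have "cut (Th (Suc g) h) (BB (Suc g) h) {Q k..<Q (Suc k)} (z k)" if "k < N" for k
      using nd[OF that] gh h by (auto simp: tree_node_def)
    moreover have "Th (Suc g) h / real (?r ^ 8) \<le> Th g h"
    proof -
      have "?r \<le> ?r ^ 8" using self_le_power[of ?r 8] r20 by simp
      then have "real (EE g) \<le> real (?r ^ 8)" using rho_ge[of g i] by (intro of_nat_mono) linarith
      then show ?thesis unfolding Th_step[OF gh] using EE_ge'[of g] Th_nonneg r20 by (intro divide_left_mono) auto
    qed
    ultimately show ?thesis unfolding BB_step[OF gh] Z_def Q0[symmetric]
      using QY N2 lfN r20 by (intro cut_avg) auto
  qed
  moreover have "p < Q N" using Qm[of 1 N] N1 QY[of 0] Q0 by simp
  ultimately have "p < Q N \<and> tree_node (Suc r) g i p (Q N) X Z" unfolding tree_node_def by auto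
  then show ?case by (intro exI[of _ "Q N"] exI[of _ "(X, Z)"]) simp
qed

lemma cut_mono:
  assumes "cut t B P z" "t \<le> t'" "B \<le> B'"
  shows "cut t' B' P z"
proof -
  have "(2::nat) ^ B \<le> 2 ^ B'" using assms(3) by (intro power_increasing) auto
  obtain ps where ps: "z = (\<lambda>n. \<Sum>sw\<leftarrow>ps. fst sw * snd sw n)" "length ps \<le> 2 ^ B"
    "\<forall>sw\<in>set ps. 0 \<le> fst sw \<and> fst sw \<le> t \<and> snd sw \<in> GMs J \<sigma> \<and> supp (snd sw) \<subseteq> P"
    "sorted_wrt vec_before (map snd ps)" using assms(1) unfolding cut_def by auto
  have "\<forall>sw\<in>set ps. 0 \<le> fst sw \<and> fst sw \<le> t' \<and> snd sw \<in> GMs J \<sigma> \<and> supp (snd sw) \<subseteq> P"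
    using ps(3) assms(2) by auto
  moreover have "length ps \<le> 2 ^ B'" using ps(2) \<open>2 ^ B \<le> 2 ^ B'\<close> by linarith
  ultimately show ?thesis unfolding cut_def using ps(1,4) by blast
qed

text \<open>The cutting level \<open>(m + 8) div 6\<close> is the least \<open>Suc h\<close> with
  \<open>m <= 6 * h + 3\<close>. The weight at level \<open>h\<close> alone, at least
  \<open>EE h\<close> and so at least \<open>tw m\<close>, already gives the bound.\<close>

lemma Th_le: "Th 0 ((m + 8) div 6) \<le> 1 / real (tw m)"
proof -
  define h where "h = (m + 8) div 6 - 1"
  have h: "(m + 8) div 6 = Suc h" "m \<le> 6 * h + 3" unfolding h_def by linarith+
  have 1: "1 / real (EE j) \<le> 1" for j using EE_ge'[of j] by simp
  have "Th 0 (Suc h) = (\<Prod>j\<in>{0..<h}. 1 / real (EE j)) * (1 / real (EE h))" by (simp add: Th_def)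
  also have "\<dots> \<le> 1 * (1 / real (EE h))" using 1 by (intro mult_right_mono prod_le_1) auto
  also have "\<dots> \<le> 1 / real (tw m)"
  proof -
    have "tw m \<le> EE h" using tw_mono[OF h(2)] EE(1)[of h] by simp
    moreover have "0 < tw m" using tw_ge[of m] by simp
    ultimately show ?thesis by (simp add: frac_le)
  qed
  finally show ?thesis by (simp add: h)
qed

text \<open>Above this cut every \<open>XX j\<close> is at most \<open>tw (m + 8)\<close>. One more
  exponential absorbs the number of levels and leaves a factor to spare.\<close>

lemma BB_le: "BB 0 ((m + 8) div 6) \<le> tw (m + 9) div 4"
proof -
  define h where "h = (m + 8) div 6"
  have h: "6 * h \<le> m + 8" "h \<le> m + 8" unfolding h_def by linarith+
  have "BB 0 h \<le> (\<Sum>j\<in>{0..<h}. tw (m + 8))" unfolding BB_def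
  proof (rule sum_mono)
    fix j assume "j \<in> {0..<h}"
    then have "XX j \<le> tw (6 * j + 6)" "6 * j + 6 \<le> m + 8" using MM_XX[of j] h by auto
    then show "XX j \<le> tw (m + 8)" using tw_mono order_trans by blast
  qed
  also have "\<dots> = h * tw (m + 8)" by simp
  also have "\<dots> \<le> tw (m + 8) * tw (m + 8)" using h tw_ge[of "m + 8"] by (intro mult_right_mono) auto
  finally have "16 * BB 0 h \<le> 16 * (tw (m + 8))\<^sup>2" by (simp add: power2_eq_square)
  also have "\<dots> \<le> 2 ^ tw (m + 8)" using tw_ge[of "m + 8"] by (intro exp_ge_quadratic) simp
  also have "\<dots> = tw (m + 9)" using tw.simps(2)[of "m + 8"] by (simp add: numeral_eq_Suc)
  finally show ?thesis unfolding h_def[symmetric] by linarith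
qed

end

text \<open>All that the rest of the proof knows about the trees. The \<open>n\<close>-th tree has
  depth \<open>n\<close>, hence the condition relating \<open>m\<close> and \<open>n\<close> in
  \<open>z_cut\<close>. With \<open>Q 0 = 0\<close> the blocks cover all coordinates.\<close>

locale blocks = GM +
  fixes Q :: "nat \<Rightarrow> nat" and bx bz :: "nat \<Rightarrow> nat \<Rightarrow> real"
  assumes Q0: "Q 0 = 0" and Q_less: "Q n < Q (Suc n)"
    and supp_x: "supp (bx n) \<subseteq> {Q n..<Q (Suc n)}" and supp_z: "supp (bz n) \<subseteq> {Q n..<Q (Suc n)}"
    and z_in: "bz n \<in> GMs J \<sigma>" and x_norm: "u \<in> relG J \<Longrightarrow> \<bar>pairing u (bx n)\<bar> \<le> 2"
    and zx: "pairing (bz n) (bx n) = 1"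
    and z_cut: "(m + 8) div 6 \<le> n \<Longrightarrow> cut (1 / tw m) (tw (m + 9) div 4) {Q n..<Q (Suc n)} (bz n)"

lemma (in GM) blocks_exist: "\<exists>Q x z. blocks J \<sigma> Q x z"
proof -
  define P where "P n p q xz \<longleftrightarrow> tree_node n 0 1 p q (fst xz) (snd xz)" for n p q and xz :: "(nat \<Rightarrow> real) \<times> (nat \<Rightarrow> real)"
  have "\<exists>q xz. p < q \<and> P n p q xz" for n p unfolding P_def by (rule tree_exists) auto
  from chain_exists[of P, OF this, of 0] obtain Q Y where Q0: "Q 0 = 0"
    and QY: "\<And>n. Q n < Q (Suc n) \<and> P n (Q n) (Q (Suc n)) (Y n)" by auto
  define x z where "x n = fst (Y n)" and "z n = snd (Y n)" for n
  have nd: "tree_node n 0 1 (Q n) (Q (Suc n)) (x n) (z n)" for n using QY[of n] by (simp add: P_def x_def z_def)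
  have "\<bar>pairing u (x n)\<bar> \<le> 2" if "u \<in> relG J" for u n
    using nd[of n] good_norm[of J _ _ _ _ "x n" u UNIV] that by (fastforce simp: tree_node_def)
  moreover have "cut (1 / tw m) (tw (m + 9) div 4) {Q n..<Q (Suc n)} (z n)" if "(m + 8) div 6 \<le> n" for m n
    using nd[of n] that cut_mono[OF _ Th_le[of m] BB_le[of m]] by (auto simp: tree_node_def)
  moreover have "z n \<in> GMs J \<sigma>" "pairing (z n) (x n) = 1"
    "supp (x n) \<subseteq> {Q n..<Q (Suc n)}" "supp (z n) \<subseteq> {Q n..<Q (Suc n)}" for n
    using nd[of n] by (simp_all add: tree_node_def)
  ultimately have "blocks J \<sigma> Q x z" using Q0 QY by unfold_locales auto
  then show ?thesis by blast
qed

section \<open>Blocks and sums of coefficients\<close>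

context blocks
begin

definition blk :: "nat set \<Rightarrow> nat set" where "blk E = (\<Union>n\<in>E. {Q n..<Q (Suc n)})"

lemma Q_mono: "n \<le> k \<Longrightarrow> Q n \<le> Q k"
  by (rule lift_Suc_mono_le[of Q]) (use Q_less less_imp_le in blast)+

lemma Q_ge: "n \<le> Q n"
proof (induction n)
  case (Suc n) then show ?case using Q_less[of n] by linarith
qed simp

lemma block_of: "\<exists>n. Q n \<le> j \<and> j < Q (Suc n)"
proof -
  define n where "n = (LEAST n. j < Q (Suc n))"
  have "j < Q (Suc j)" using Q_ge[of "Suc j"] by simp
  then have 1: "j < Q (Suc n)" unfolding n_def by (rule LeastI)
  have "Q n \<le> j"
  proof (cases n)
    case (Suc k)
    then show ?thesis using not_less_Least[of k "\<lambda>n. j < Q (Suc n)"] unfolding n_def by auto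
  qed (simp add: Q0)
  then show ?thesis using 1 by blast
qed

lemma nat_interval_blk: "nat_interval E \<Longrightarrow> nat_interval (blk E)"
  unfolding nat_interval_def
proof (intro ballI subsetI)
  fix a b j assume E: "\<forall>a\<in>E. \<forall>b\<in>E. {a..b} \<subseteq> E" and ab: "a \<in> blk E" "b \<in> blk E" "j \<in> {a..b}"
  obtain n k where nk: "n \<in> E" "k \<in> E" "Q n \<le> a" "b < Q (Suc k)" using ab by (auto simp: blk_def)
  obtain i where i: "Q i \<le> j" "j < Q (Suc i)" using block_of by blast
  have "n \<le> i" using Q_mono[of "Suc i" n] nk i ab by (cases "n \<le> i") auto
  moreover have "i \<le> k" using Q_mono[of "Suc k" i] nk i ab by (cases "i \<le> k") auto
  ultimately have "i \<in> {n..k}" by simp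
  then have "i \<in> E" using E nk by blast
  then show "j \<in> blk E" using i by (auto simp: blk_def)
qed

lemma set_before_blk: "set_before E F \<Longrightarrow> set_before (blk E) (blk F)"
proof -
  assume EF: "set_before E F"
  have "i < j" if ij: "n \<in> E" "k \<in> F" "i < Q (Suc n)" "Q k \<le> j" for n k i j
    using EF ij Q_mono[of "Suc n" k] unfolding set_before_def by fastforce
  then show ?thesis unfolding set_before_def blk_def by auto
qed

lemma blk_mono: "E \<subseteq> F \<Longrightarrow> blk E \<subseteq> blk F"
  unfolding blk_def by auto

text \<open>Shallow functionals have no long decomposition, hence the restriction on the indices.\<close>

lemma coeff_pieces:
  assumes A: "finite A" "\<And>n. n \<in> A \<Longrightarrow> (m + 8) div 6 \<le> n"
  shows "\<exists>ws. set ws \<subseteq> GMs J \<sigma> \<and> sorted_wrt vec_before ws \<and> (\<forall>w\<in>set ws. supp w \<subseteq> blk A) \<and>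
    length ws \<le> card A * 2 ^ (tw (m + 9) div 4) \<and>
    (\<forall>x\<in>c00. (\<Sum>n\<in>A. \<bar>pairing (bz n) x\<bar>) \<le> 1 / tw m * (\<Sum>w\<leftarrow>ws. \<bar>pairing w x\<bar>))"
proof -
  let ?B = "tw (m + 9) div 4"
  have "\<forall>n\<in>A. \<exists>ps. bz n = (\<lambda>i. \<Sum>sw\<leftarrow>ps. fst sw * snd sw i) \<and>
    (\<forall>sw\<in>set ps. 0 \<le> fst sw \<and> fst sw \<le> 1 / tw m \<and> snd sw \<in> GMs J \<sigma> \<and> supp (snd sw) \<subseteq> {Q n..<Q (Suc n)}) \<and>
    sorted_wrt vec_before (map snd ps) \<and> length ps \<le> 2 ^ ?B" using z_cut[of m] A(2) unfolding cut_def by auto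
  from bchoice[OF this] obtain p where
    p1: "\<And>n. n \<in> A \<Longrightarrow> bz n = (\<lambda>i. \<Sum>sw\<leftarrow>p n. fst sw * snd sw i)" and
    p2: "\<And>n sw. n \<in> A \<Longrightarrow> sw \<in> set (p n) \<Longrightarrow> 0 \<le> fst sw \<and> fst sw \<le> 1 / tw m \<and> snd sw \<in> GMs J \<sigma> \<and> supp (snd sw) \<subseteq> {Q n..<Q (Suc n)}" and
    p3: "\<And>n. n \<in> A \<Longrightarrow> sorted_wrt vec_before (map snd (p n))" and
    p4: "\<And>n. n \<in> A \<Longrightarrow> length (p n) \<le> 2 ^ ?B" by auto
  define ns where "ns = sorted_list_of_set A"
  have ns: "set ns = A" "sorted_wrt (<) ns" "length ns = card A" "distinct ns"
    using A(1) by (auto simp: ns_def strict_sorted_list_of_set)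
  define ws where "ws = concat (map (\<lambda>n. map snd (p n)) ns)"
  have "set ws \<subseteq> GMs J \<sigma>" using p2 ns by (auto simp: ws_def)
  moreover have "supp w \<subseteq> blk A" if w: "w \<in> set ws" for w
  proof -
    from w obtain n sw where "n \<in> A" "sw \<in> set (p n)" "w = snd sw" using ns by (auto simp: ws_def)
    then have "supp w \<subseteq> {Q n..<Q (Suc n)}" using p2 by blast
    then show ?thesis using \<open>n \<in> A\<close> by (auto simp: blk_def)
  qed
  moreover have "sorted_wrt vec_before ws" unfolding ws_def
  proof (rule sorted_wrt_concat)
    show "sorted_wrt vec_before xs" if "xs \<in> set (map (\<lambda>i. map snd (p i)) ns)" for xs
      using that p3 ns by auto
    show "sorted_wrt (\<lambda>xs ys. \<forall>x\<in>set xs. \<forall>y\<in>set ys. vec_before x y) (map (\<lambda>i. map snd (p i)) ns)"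
      unfolding sorted_wrt_map
    proof (rule sorted_wrt_mono_rel[OF _ ns(2)])
      fix i j assume ij: "i \<in> set ns" "j \<in> set ns" "i < j"
      show "\<forall>x\<in>set (map snd (p i)). \<forall>y\<in>set (map snd (p j)). vec_before x y"
      proof (intro ballI)
        fix x y assume "x \<in> set (map snd (p i))" "y \<in> set (map snd (p j))"
        then obtain a b where "a \<in> set (p i)" "x = snd a" "b \<in> set (p j)" "y = snd b" by auto
        then have "supp x \<subseteq> {Q i..<Q (Suc i)}" "supp y \<subseteq> {Q j..<Q (Suc j)}" using p2[of i a] p2[of j b] ij ns by auto
        then show "vec_before x y" by (rule vec_before_atLeastLessThan) (use Q_mono ij in simp)
      qed
    qed
  qed
  moreover have "length ws \<le> card A * 2 ^ ?B"
  proof -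
    have "length ws = (\<Sum>i\<leftarrow>ns. length (p i))" by (simp add: ws_def length_concat o_def)
    also have "\<dots> \<le> (\<Sum>i\<leftarrow>ns. 2 ^ ?B)" using p4 ns by (intro sum_list_mono) auto
    finally show ?thesis by (simp add: sum_list_triv ns)
  qed
  moreover have "(\<Sum>n\<in>A. \<bar>pairing (bz n) x\<bar>) \<le> 1 / tw m * (\<Sum>w\<leftarrow>ws. \<bar>pairing w x\<bar>)" if "x \<in> c00" for x
  proof -
    have "(\<Sum>n\<in>A. \<bar>pairing (bz n) x\<bar>) = (\<Sum>n\<leftarrow>ns. \<bar>pairing (bz n) x\<bar>)"
      using ns by (simp add: sum_list_distinct_conv_sum_set)
    also have "\<dots> \<le> (\<Sum>n\<leftarrow>ns. \<Sum>sw\<leftarrow>p n. 1 / tw m * \<bar>pairing (snd sw) x\<bar>)"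
    proof (rule sum_list_mono)
      fix n assume n: "n \<in> set ns"
      have "\<bar>pairing (bz n) x\<bar> = \<bar>\<Sum>sw\<leftarrow>p n. fst sw * pairing (snd sw) x\<bar>"
        using p1[of n] n ns by (simp add: pairing_sum_list pairing_scale_left)
      also have "\<dots> \<le> (\<Sum>sw\<leftarrow>p n. \<bar>fst sw * pairing (snd sw) x\<bar>)" by (rule abs_sum_list_le)
      also have "\<dots> \<le> (\<Sum>sw\<leftarrow>p n. 1 / tw m * \<bar>pairing (snd sw) x\<bar>)"
      proof (rule sum_list_mono)
        fix sw assume "sw \<in> set (p n)"
        then have "0 \<le> fst sw" "fst sw \<le> 1 / tw m" using p2 n ns by auto
        then show "\<bar>fst sw * pairing (snd sw) x\<bar> \<le> 1 / tw m * \<bar>pairing (snd sw) x\<bar>"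
          unfolding abs_mult by (intro mult_right_mono) auto
      qed
      finally show "\<bar>pairing (bz n) x\<bar> \<le> (\<Sum>sw\<leftarrow>p n. 1 / tw m * \<bar>pairing (snd sw) x\<bar>)" .
    qed
    also have "\<dots> = (\<Sum>w\<leftarrow>ws. 1 / tw m * \<bar>pairing w x\<bar>)"
      unfolding ws_def sum_list_map_concat by (simp add: o_def)
    finally show ?thesis by (simp only: sum_list_const_mult)
  qed
  ultimately show ?thesis by (intro exI[of _ ws] conjI) auto
qed

lemma pairing_z_blk: "x \<in> c00 \<Longrightarrow> n \<in> E \<Longrightarrow> pairing (bz n) (restr (blk E) x) = pairing (bz n) x"
proof -
  assume "x \<in> c00" "n \<in> E"
  then have "supp (bz n) \<subseteq> blk E" using supp_z[of n] by (auto simp: blk_def)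
  from restr_id[OF this] pairing_restr[OF \<open>x \<in> c00\<close>, of "blk E" "bz n"] show ?thesis by simp
qed

lemma coeff_le: "x \<in> c00 \<Longrightarrow> n \<in> E \<Longrightarrow> \<bar>pairing (bz n) x\<bar> \<le> nrm (restr (blk E) x)"
  using nrm_ge[OF z_in[of n], of "restr (blk E) x"] pairing_z_blk[of x n E] by simp

text \<open>The sublogarithmic estimate. The sufficiently deep \<open>bz n\<close> split into at
  most \<open>card A * 2 ^ B\<close> successive pieces with coefficients at most
  \<open>1 / tw m\<close>, to which form (2) applies; the fewer than
  \<open>(m + 8) div 6 + 1\<close> shallow ones are estimated one by one and disappear in
  \<open>tw (m + 9)\<close>.\<close>

lemma sum_coeff_le:
  assumes x: "x \<in> c00" and E: "nat_interval E" and A: "finite A" "A \<noteq> {}" "A \<subseteq> E"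
  shows "(\<Sum>n\<in>A. \<bar>pairing (bz n) x\<bar>) \<le> 1 / tw m * (log 2 (card A) + tw (m + 9)) * nrm (restr (blk E) x)"
proof -
  let ?H = "nrm (restr (blk E) x)" and ?B = "tw (m + 9) div 4" and ?h = "(m + 8) div 6"
  let ?T = "real (tw m)" and ?F = "real (tw (m + 9))"
  define A' where "A' = {n\<in>A. ?h \<le> n}"
  have cA: "1 \<le> real (card A)" using A by (simp add: Suc_le_eq card_gt_0_iff)
  have l0: "0 \<le> log 2 (real (card A))" using cA by simp
  have H0: "0 \<le> ?H" by (rule nrm_nonneg)
  have T: "1 \<le> ?T" "1 \<le> ?F" using tw_ge[of m] tw_ge[of "m + 9"] by simp_all
  obtain ws where ws: "set ws \<subseteq> GMs J \<sigma>" "sorted_wrt vec_before ws" "\<And>w. w \<in> set ws \<Longrightarrow> supp w \<subseteq> blk A'"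
    "length ws \<le> card A' * 2 ^ ?B"
    "\<And>x. x \<in> c00 \<Longrightarrow> (\<Sum>n\<in>A'. \<bar>pairing (bz n) x\<bar>) \<le> 1 / tw m * (\<Sum>w\<leftarrow>ws. \<bar>pairing w x\<bar>)"
  proof -
    have "finite A'" "\<And>n. n \<in> A' \<Longrightarrow> ?h \<le> n" using A(1) by (auto simp: A'_def)
    from coeff_pieces[OF this] that show ?thesis by blast
  qed
  have "(\<Sum>w\<leftarrow>ws. \<bar>pairing w x\<bar>) \<le> (log 2 (card A) + ?F / 4 + 1) * ?H"
  proof (cases "ws = []")
    case True
    then show ?thesis using H0 l0 T by simp
  next
    case False
    have "supp w \<subseteq> blk E" if "w \<in> set ws" for w
      using ws(3)[OF that] blk_mono[of A' E] A(3) by (auto simp: A'_def)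
    then have "(\<Sum>w\<leftarrow>ws. \<bar>pairing w x\<bar>) \<le> lf (real (length ws)) * ?H"
      using ws False nat_interval_blk[OF E] x by (intro sum_list_pairing_le) auto
    also have "lf (real (length ws)) \<le> lf (real (card A * 2 ^ ?B))"
    proof (rule lf_mono)
      have "card A' \<le> card A" unfolding A'_def using A(1) by (intro card_mono) auto
      then show "real (length ws) \<le> real (card A * 2 ^ ?B)" using ws(4)
        by (intro of_nat_mono) (meson mult_le_mono1 order_trans)
    qed simp
    also have "\<dots> \<le> log 2 (real (card A * 2 ^ ?B)) + 1"
    proof (rule lf_le_log)
      have "1 * 1 \<le> real (card A) * 2 ^ ?B" by (rule mult_mono[OF cA]) auto
      then show "1 \<le> real (card A * 2 ^ ?B)" by simp
    qed
    also have "log 2 (real (card A * 2 ^ ?B)) = log 2 (card A) + ?B"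
      using cA by (simp add: log_mult log_nat_power)
    also have "real ?B \<le> ?F / 4" by linarith
    finally show ?thesis using H0 by (simp add: mult_right_mono)
  qed
  then have "1 / ?T * (\<Sum>w\<leftarrow>ws. \<bar>pairing w x\<bar>) \<le> 1 / ?T * ((log 2 (card A) + ?F / 4 + 1) * ?H)"
    by (rule mult_left_mono) simp
  then have 1: "(\<Sum>n\<in>A'. \<bar>pairing (bz n) x\<bar>) \<le> 1 / ?T * ((log 2 (card A) + ?F / 4 + 1) * ?H)"
    using ws(5)[OF x] by linarith
  have "(\<Sum>n\<in>A - A'. \<bar>pairing (bz n) x\<bar>) \<le> (\<Sum>n\<in>A - A'. ?H)"
    using A x by (intro sum_mono coeff_le) auto
  also have "\<dots> = card (A - A') * ?H" by simp
  also have "\<dots> \<le> ?h * ?H"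
  proof (intro mult_right_mono of_nat_mono)
    have "card (A - A') \<le> card {..<?h}" by (intro card_mono) (auto simp: A'_def)
    then show "card (A - A') \<le> ?h" by simp
  qed (rule H0)
  also have "\<dots> \<le> 1 / ?T * (?F / 4) * ?H"
  proof (intro mult_right_mono H0)
    have "?h * tw m \<le> tw (m + 8) * tw (m + 8)"
      using tw_ge[of "m + 8"] tw_mono[of m "m + 8"] by (intro mult_mono) auto
    then have "16 * (?h * tw m) \<le> 16 * (tw (m + 8))\<^sup>2" by (simp add: power2_eq_square)
    also have "\<dots> \<le> 2 ^ tw (m + 8)" using tw_ge[of "m + 8"] by (intro exp_ge_quadratic) simp
    also have "\<dots> = tw (m + 9)" using tw.simps(2)[of "m + 8"] by (simp add: numeral_eq_Suc)
    finally have "real (16 * (?h * tw m)) \<le> ?F" by (rule of_nat_mono)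
    then have "?h * ?T \<le> ?F / 4" by simp
    then show "real ?h \<le> 1 / ?T * (?F / 4)" using T by (simp add: field_simps)
  qed
  finally have 2: "(\<Sum>n\<in>A - A'. \<bar>pairing (bz n) x\<bar>) \<le> 1 / ?T * (?F / 4) * ?H" .
  have "(\<Sum>n\<in>A. \<bar>pairing (bz n) x\<bar>) = (\<Sum>n\<in>A - A'. \<bar>pairing (bz n) x\<bar>) + (\<Sum>n\<in>A'. \<bar>pairing (bz n) x\<bar>)"
    using A by (intro sum.subset_diff) (auto simp: A'_def)
  also have "\<dots> \<le> 1 / ?T * (?F / 4) * ?H + 1 / ?T * ((log 2 (card A) + ?F / 4 + 1) * ?H)" using 1 2 by linarith
  also have "\<dots> = 1 / ?T * (log 2 (card A) + ?F / 2 + 1) * ?H" by (simp add: algebra_simps)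
  also have "\<dots> \<le> 1 / ?T * (log 2 (card A) + ?F) * ?H"
    using H0 T tw_ge[of "m + 9"] by (intro mult_right_mono mult_left_mono) auto
  finally show ?thesis .
qed

lemma sum_blk_le:
  assumes Es: "\<And>E. E \<in> set Es \<Longrightarrow> nat_interval E \<and> E \<subseteq> P" "sorted_wrt set_before Es" "Es \<noteq> []"
    and P: "nat_interval P" and x: "x \<in> c00"
  shows "(\<Sum>E\<leftarrow>Es. nrm (restr (blk E) x)) \<le> lf (real (length Es)) * nrm (restr (blk P) x)"
proof -
  have "sorted_wrt set_before (map blk Es)" unfolding sorted_wrt_map
    by (rule sorted_wrt_mono_rel[OF _ Es(2)]) (rule set_before_blk)
  moreover have "nat_interval E \<and> E \<subseteq> blk P" if "E \<in> set (map blk Es)" for E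
  proof -
    from that obtain F where "F \<in> set Es" "E = blk F" by auto
    then show ?thesis using Es(1)[of F] nat_interval_blk[of F] blk_mono[of F P] by simp
  qed
  ultimately show ?thesis
    using sum_list_nrm_le[of "map blk Es" "blk P" x] Es(3) nat_interval_blk[OF P] x by (simp add: o_def)
qed

end

section \<open>Domination of coefficient sequences\<close>

text \<open>Each element of \<open>S\<close> lies three exponentials above the preceding one, so a
  lower bound can be given by rank alone. Sums over lengths thereby become sums over ranks.\<close>

lemma rank_lf_ge:
  fixes g :: "nat \<Rightarrow> real"
  assumes J: "GM_index_set J" and S: "finite S" "S \<subseteq> J" "\<And>n. n \<in> S \<Longrightarrow> g 0 \<le> lf (real n)"
    and g: "\<And>r. g (Suc r) \<le> 2 powr (2 powr (2 powr (g r)))"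
  shows "n \<in> S \<Longrightarrow> g (card {k\<in>S. k < n}) \<le> lf (real n)"
proof (induction n rule: less_induct)
  case (less n)
  let ?A = "{k\<in>S. k < n}"
  show ?case
  proof (cases "?A = {}")
    case True
    then show ?thesis using S(3)[OF less.prems] by (simp only: card.empty)
  next
    case False
    define k where "k = Max ?A"
    have k: "k \<in> ?A" unfolding k_def using S(1) False by (intro Max_in) auto
    have "j \<le> k" if "j \<in> ?A" for j unfolding k_def using S(1) that by (intro Max_ge) auto
    then have A: "?A = insert k {j\<in>S. j < k}" using k by fastforce
    have "g (card ?A) = g (Suc (card {j\<in>S. j < k}))" unfolding A using S(1) by simp
    also have "\<dots> \<le> 2 powr (2 powr (2 powr (g (card {j\<in>S. j < k}))))" by (rule g)
    also have "\<dots> \<le> 2 powr (2 powr (2 powr (lf (real k))))" using less.IH[of k] k by simp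
    also have "\<dots> \<le> lf (real n)" using k S(2) less.prems by (intro GM_index_lacunary[OF J]) auto
    finally show ?thesis .
  qed
qed

lemma sum_rank:
  fixes h :: "nat \<Rightarrow> real" and S :: "nat set"
  shows "finite S \<Longrightarrow> (\<Sum>n\<in>S. h (card {k\<in>S. k < n})) = (\<Sum>r<card S. h r)"
proof (induction S rule: finite_linorder_max_induct)
  case (insert b A)
  define R where "R n = card {k \<in> insert b A. k < n}" for n
  have "{k \<in> insert b A. k < n} = {k\<in>A. k < n}" if "n \<in> A" for n using insert that by auto
  then have 1: "R n = card {k\<in>A. k < n}" if "n \<in> A" for n using that unfolding R_def by metis
  have "{k \<in> insert b A. k < b} = A" using insert by auto
  then have 2: "R b = card A" unfolding R_def by metis
  have b: "b \<notin> A" using insert by auto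
  have "(\<Sum>n\<in>insert b A. h (R n)) = h (card A) + (\<Sum>n\<in>A. h (card {k\<in>A. k < n}))"
    using b insert.hyps(1) 1 2 by simp
  also have "\<dots> = (\<Sum>r<card (insert b A). h r)" using b insert by simp
  finally show ?case unfolding R_def .
qed simp

lemma sum_list_bounded_lengths:
  fixes h :: "nat \<Rightarrow> real"
  assumes mult: "\<And>m. length (filter (\<lambda>us. length us = m) uss) \<le> 2" and h: "\<And>n. 0 \<le> h n"
    and us: "\<And>us. us \<in> set uss \<Longrightarrow> h (length us) \<noteq> 0 \<Longrightarrow> h (length us) \<le> D \<and> 1 \<le> length us \<and> real (length us) \<le> B"
    and D: "0 \<le> D" and B: "0 \<le> B"
  shows "(\<Sum>us\<leftarrow>uss. h (length us)) \<le> 2 * (B * D)"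
proof -
  let ?S = "length ` set uss" let ?S' = "{n\<in>?S. h n \<noteq> 0}"
  have "?S' \<subseteq> {1..nat \<lfloor>B\<rfloor>}"
  proof
    fix n assume "n \<in> ?S'"
    then show "n \<in> {1..nat \<lfloor>B\<rfloor>}" using us B by (auto simp: le_nat_floor)
  qed
  then have "card ?S' \<le> card {1..nat \<lfloor>B\<rfloor>}" by (intro card_mono) auto
  then have c: "real (card ?S') \<le> B" using B by simp linarith
  have "(\<Sum>us\<leftarrow>uss. h (length us)) \<le> 2 * (\<Sum>n\<in>?S. h n)" by (rule sum_list_le_twice[OF mult h])
  also have "(\<Sum>n\<in>?S. h n) = (\<Sum>n\<in>?S'. h n)" by (rule sum.mono_neutral_right) auto
  also have "\<dots> \<le> (\<Sum>n\<in>?S'. D)" using us by (intro sum_mono) auto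
  also have "\<dots> = card ?S' * D" by simp
  also have "\<dots> \<le> B * D" using c D by (rule mult_right_mono)
  finally show ?thesis by simp
qed

text \<open>Beyond the threshold \<open>Ph m\<close> for \<open>lf l\<close>, an average of length
  \<open>l\<close> is small by the factor \<open>om m\<close>. The 40 leaves room for the 36
  produced by the count in \<open>node_decay\<close>.\<close>

definition Ph :: "nat \<Rightarrow> nat" where "Ph m = tw (m + 9)"
definition om :: "nat \<Rightarrow> real" where "om m = 40 / tw m"

lemma Ph_ge: "1048576 \<le> Ph m"
  using tw_ge[of "m + 9"] unfolding Ph_def by simp

lemma om_nonneg: "0 \<le> om m"
  by (simp add: om_def)

lemma tw_add: "2 ^ r * tw m \<le> tw (m + r)"
proof (induction r)
  case (Suc r)
  have "2 ^ Suc r * tw m \<le> 2 * tw (m + r)" using Suc by simp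
  also have "\<dots> \<le> 16 * (tw (m + r))\<^sup>2" using tw_ge[of "m + r"] by (simp add: power2_eq_square)
  also have "\<dots> \<le> 2 ^ tw (m + r)" using tw_ge[of "m + r"] by (intro exp_ge_quadratic) simp
  finally show ?case by (simp add: tw.simps)
qed simp

lemma sum_om_le: "(\<Sum>r<N. om (m + r)) \<le> 2 * om m"
proof -
  have "(\<Sum>r<N. om (m + r)) \<le> (\<Sum>r<N. om m * (1 / 2) ^ r)"
  proof (rule sum_mono)
    fix r
    have "real (2 ^ r * tw m) \<le> real (tw (m + r))" using tw_add by (rule of_nat_mono)
    moreover have "0 < real (2 ^ r * tw m)" using tw_ge[of m] by simp
    ultimately have "40 / real (tw (m + r)) \<le> 40 / real (2 ^ r * tw m)" by (intro divide_left_mono) auto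
    then show "om (m + r) \<le> om m * (1 / 2) ^ r" by (simp add: om_def field_simps)
  qed
  also have "\<dots> = om m * (\<Sum>r<N. (1 / 2) ^ r)" by (simp add: sum_distrib_left)
  also have "(\<Sum>r<N. (1 / 2 :: real) ^ r) = 2 - 2 * (1 / 2) ^ N" by (induction N) auto
  also have "om m * \<dots> \<le> om m * 2" using om_nonneg by (intro mult_left_mono) auto
  finally show ?thesis by simp
qed

lemma le_two_powr_lf: "real n \<le> 2 powr lf (real n)"
  by (simp add: two_powr_lf)

lemma singletons_eq: "F \<in> set (filter (\<lambda>F. card F = 1) Fs) \<Longrightarrow> F = {Min F}"
proof -
  assume "F \<in> set (filter (\<lambda>F. card F = 1) Fs)"
  then have "card F = 1" by simp
  then obtain a where "F = {a}" by (rule card_1_singletonE)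
  then show ?thesis by simp
qed

lemma distinct_singletons:
  assumes "sorted_wrt set_before Fs"
  shows "distinct (map Min (filter (\<lambda>F. card F = 1) Fs))"
proof -
  have "sorted_wrt set_before (filter (\<lambda>F. card F = 1) Fs)" using assms by (rule sorted_wrt_filter)
  then have "sorted_wrt (<) (map Min (filter (\<lambda>F. card F = 1) Fs))" unfolding sorted_wrt_map
  proof (rule sorted_wrt_mono_rel[rotated])
    fix F G
    assume F: "F \<in> set (filter (\<lambda>F. card F = 1) Fs)" and G: "G \<in> set (filter (\<lambda>F. card F = 1) Fs)"
      and FG: "set_before F G"
    from FG have "set_before {Min F} {Min G}" using singletons_eq[OF F] singletons_eq[OF G] by metis
    then show "Min F < Min G" by (simp add: set_before_def)
  qed
  then show ?thesis by (simp only: strict_sorted_iff)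
qed

text \<open>Separates the induction over functionals from the trees: \<open>c\<close> will be the
  sequence \<open>T x\<close> and \<open>H E\<close> the norm of \<open>x\<close> on the blocks with
  index in \<open>E\<close>. The essential facts about \<open>H\<close> are the lower estimate
  \<open>H_sum\<close> and the sublogarithmic bound \<open>sum_c\<close>.\<close>

locale dominated =
  fixes J :: "nat set" and c :: "nat \<Rightarrow> real" and H :: "nat set \<Rightarrow> real"
  assumes J: "GM_index_set J" and c: "c \<in> c00" and H_nonneg: "0 \<le> H E"
    and H_sum: "(\<And>E. E \<in> set Es \<Longrightarrow> nat_interval E \<and> E \<subseteq> P) \<Longrightarrow> sorted_wrt set_before Es \<Longrightarrow> Es \<noteq> [] \<Longrightarrow>
      nat_interval P \<Longrightarrow> (\<Sum>E\<leftarrow>Es. H E) \<le> lf (real (length Es)) * H P"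
    and c_le: "n \<in> E \<Longrightarrow> \<bar>c n\<bar> \<le> H E"
    and sum_c: "nat_interval E \<Longrightarrow> finite A \<Longrightarrow> A \<noteq> {} \<Longrightarrow> A \<subseteq> E \<Longrightarrow>
      (\<Sum>n\<in>A. \<bar>c n\<bar>) \<le> 1 / tw m * (log 2 (card A) + Ph m) * H E"
begin

text \<open>
  In \<open>dec m t E v\<close> the value of \<open>v\<close> on \<open>E c\<close> is distributed over successive intervals \<open>F\<close> with
  coefficients: those below \<open>t\<close> only contribute a multiple of \<open>H F\<close>, for the others \<open>H F\<close> is replaced by a small
  multiple, except for the single coordinate when \<open>F\<close> is a singleton. The bounds on the numbers of
  intervals are stable under averaging because \<open>l \<le> 2 powr lf l\<close>.
\<close>

definition sg :: "nat set \<Rightarrow> real" where "sg F = (if card F = 1 then \<bar>c (Min F)\<bar> else 0)"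

definition wt :: "nat \<Rightarrow> real \<Rightarrow> real \<times> nat set \<Rightarrow> real"
  where "wt m t i = fst i * (if fst i < t then H (snd i) else om (Suc m) * H (snd i) + sg (snd i))"

definition items :: "nat set \<Rightarrow> (real \<times> nat set) list \<Rightarrow> bool"
  where "items E qs \<longleftrightarrow> (\<forall>i\<in>set qs. 0 \<le> fst i \<and> nat_interval (snd i) \<and> snd i \<subseteq> E) \<and> sorted_wrt set_before (map snd qs)"

definition dec :: "nat \<Rightarrow> real \<Rightarrow> nat set \<Rightarrow> (nat \<Rightarrow> real) \<Rightarrow> bool"
  where "dec m t E v \<longleftrightarrow> (\<exists>qs. items E qs \<and> (\<forall>i\<in>set qs. fst i \<le> 1) \<and>
    \<bar>pairing v (restr E c)\<bar> \<le> (\<Sum>i\<leftarrow>qs. wt m t i) \<and>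
    (\<forall>s\<ge>t. real (length (filter (\<lambda>i. s \<le> fst i) qs)) \<le> 2 powr (3 / s)) \<and>
    real (length qs) \<le> 2 powr (4 * Ph (Suc m) * (1 - log 2 t)))"

text \<open>The induction hypothesis is for all \<open>t\<close> and \<open>E\<close> at once,
  because an average passes to its terms with the threshold divided by their coefficient and with
  smaller intervals. The bound by \<open>H E\<close> is carried along for terms whose coefficient is
  below the threshold.\<close>

definition MR :: "(nat \<Rightarrow> real) \<Rightarrow> bool"
  where "MR v \<longleftrightarrow> (\<forall>E. nat_interval E \<longrightarrow> \<bar>pairing v (restr E c)\<bar> \<le> H E) \<and>
    (\<forall>m t E. 0 < t \<longrightarrow> t \<le> 1 \<longrightarrow> nat_interval E \<longrightarrow> dec m t E v)"

lemma sg_nonneg: "0 \<le> sg F"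
  by (simp add: sg_def)

lemma sum_sg_le:
  assumes Fs: "sorted_wrt set_before Fs" "\<And>F. F \<in> set Fs \<Longrightarrow> F \<subseteq> E" "Fs \<noteq> []" and E: "nat_interval E"
  shows "(\<Sum>F\<leftarrow>Fs. sg F) \<le> 1 / tw m * (log 2 (length Fs) + Ph m) * H E"
proof -
  define Gs where "Gs = filter (\<lambda>F. card F = 1) Fs"
  have Gs: "F = {Min F}" if "F \<in> set Gs" for F
    using that singletons_eq unfolding Gs_def by blast
  have d: "distinct (map Min Gs)" unfolding Gs_def using Fs(1) by (rule distinct_singletons)
  let ?A = "set (map Min Gs)"
  have lF: "1 \<le> length Fs" using Fs(3) by (cases Fs) auto
  have AE: "?A \<subseteq> E" using Gs Fs(2) unfolding Gs_def by fastforce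
  have "(\<Sum>F\<leftarrow>Fs. sg F) = (\<Sum>F\<leftarrow>Gs. \<bar>c (Min F)\<bar>)" unfolding Gs_def by (induction Fs) (auto simp: sg_def)
  also have "\<dots> = (\<Sum>n\<leftarrow>map Min Gs. \<bar>c n\<bar>)" by (simp add: o_def)
  also have "\<dots> = (\<Sum>n\<in>?A. \<bar>c n\<bar>)" by (rule sum_list_distinct_conv_sum_set[OF d])
  also have "\<dots> \<le> 1 / tw m * (log 2 (length Fs) + Ph m) * H E"
  proof (cases "Gs = []")
    case True
    have "1 \<le> real (length Fs)" using lF by simp
    then have "0 \<le> log 2 (real (length Fs))" by (subst zero_le_log_cancel_iff) linarith+
    then show ?thesis using True H_nonneg by (auto intro!: mult_nonneg_nonneg divide_nonneg_nonneg add_nonneg_nonneg)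
  next
    case False
    then have "(\<Sum>n\<in>?A. \<bar>c n\<bar>) \<le> 1 / tw m * (log 2 (card ?A) + Ph m) * H E" using AE E by (intro sum_c) auto
    also have "\<dots> \<le> 1 / tw m * (log 2 (length Fs) + Ph m) * H E"
    proof (intro mult_right_mono mult_left_mono add_right_mono H_nonneg)
      have "card ?A = length Gs" using distinct_card[OF d] by simp
      moreover have "length Gs \<le> length Fs" unfolding Gs_def by simp
      moreover have "0 < length Gs" using False by simp
      ultimately have "0 < real (card ?A)" "real (card ?A) \<le> real (length Fs)" by linarith+
      then show "log 2 (real (card ?A)) \<le> log 2 (real (length Fs))" by (subst log_le_cancel_iff) linarith+
    qed auto
    finally show ?thesis .
  qed
  finally show ?thesis .
qed

lemma dec_single:
  assumes "\<bar>pairing v (restr E c)\<bar> \<le> om (Suc m) * H E" "nat_interval E" "0 < t" "t \<le> 1"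
  shows "dec m t E v"
proof -
  have "1 \<le> 2 powr (3 / s)" if "t \<le> s" for s :: real using that assms by (simp add: ge_one_powr_ge_zero)
  moreover have "1 \<le> 2 powr (4 * Ph (Suc m) * (1 - log 2 t))"
  proof -
    have "log 2 t \<le> 0" using assms by simp
    then have "0 \<le> 4 * real (Ph (Suc m)) * (1 - log 2 t)" by (intro mult_nonneg_nonneg) auto
    then show ?thesis by (simp add: ge_one_powr_ge_zero)
  qed
  ultimately show ?thesis unfolding dec_def using assms sg_nonneg[of E]
    by (intro exI[of _ "[(1, E)]"]) (auto simp: items_def wt_def)
qed

text \<open>If \<open>b\<close> is below the threshold \<open>t\<close>, a single item with its full
  \<open>H\<close> does. Otherwise \<open>u\<close> is decomposed at the threshold
  \<open>t / b\<close>, and multiplication by \<open>b\<close> restores \<open>t\<close>.\<close>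

lemma combine_single:
  assumes "0 < b" "MR u" "0 < t" "nat_interval E"
  shows "\<exists>qs. items (piece E u) qs \<and> (\<forall>i\<in>set qs. fst i \<le> b) \<and>
    b * \<bar>pairing u (restr E c)\<bar> \<le> (\<Sum>i\<leftarrow>qs. wt m t i) \<and>
    (\<forall>s\<ge>t. real (length (filter (\<lambda>i. s \<le> fst i) qs)) \<le> (if s \<le> b then 2 powr (3 * b / s) else 0)) \<and>
    real (length qs) \<le> (if t \<le> b then 2 powr (4 * Ph (Suc m) * (1 - log 2 (t / b))) else 1)"
proof (cases "t \<le> b")
  case True
  let ?E = "piece E u"
  have E: "nat_interval ?E" using assms(4) by (rule nat_interval_piece)
  have pe: "pairing u (restr ?E c) = pairing u (restr E c)" using pairing_piece[OF c] by simp
  have "dec m (t / b) ?E u" using assms True E unfolding MR_def by simp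
  then obtain js where js: "items ?E js" "\<forall>i\<in>set js. fst i \<le> 1"
    "\<bar>pairing u (restr ?E c)\<bar> \<le> (\<Sum>i\<leftarrow>js. wt m (t / b) i)"
    "\<And>s. t / b \<le> s \<Longrightarrow> real (length (filter (\<lambda>i. s \<le> fst i) js)) \<le> 2 powr (3 / s)"
    "real (length js) \<le> 2 powr (4 * Ph (Suc m) * (1 - log 2 (t / b)))" unfolding dec_def by auto
  define qs where "qs = map (\<lambda>i. (b * fst i, snd i)) js"
  have "items ?E qs" using js(1) assms(1) by (auto simp: items_def qs_def o_def)
  moreover have "\<forall>i\<in>set qs. fst i \<le> b" using js(2) assms(1) by (auto simp: qs_def mult_le_cancel_left1)
  moreover have "b * \<bar>pairing u (restr E c)\<bar> \<le> (\<Sum>i\<leftarrow>qs. wt m t i)"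
  proof -
    have "b * \<bar>pairing u (restr E c)\<bar> \<le> b * (\<Sum>i\<leftarrow>js. wt m (t / b) i)"
      using js(3) assms(1) pe by (intro mult_left_mono) auto
    also have "\<dots> = (\<Sum>i\<leftarrow>js. b * wt m (t / b) i)" by (rule sum_list_const_mult[symmetric])
    also have "\<dots> = (\<Sum>i\<leftarrow>qs. wt m t i)" unfolding qs_def using assms(1)
      by (auto simp: o_def wt_def less_divide_eq mult.commute[of _ b] mult.assoc intro!: arg_cong[of _ _ sum_list] map_cong)
    finally show ?thesis .
  qed
  moreover have "real (length (filter (\<lambda>i. s \<le> fst i) qs)) \<le> (if s \<le> b then 2 powr (3 * b / s) else 0)" if s: "t \<le> s" for s
  proof -
    have "length (filter (\<lambda>i. s \<le> fst i) qs) = length (filter (\<lambda>i. s / b \<le> fst i) js)"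
      unfolding qs_def using assms(1) by (simp add: filter_map o_def divide_le_eq mult.commute)
    moreover have "real (length (filter (\<lambda>i. s / b \<le> fst i) js)) \<le> 2 powr (3 / (s / b))"
      using s assms(1) by (intro js(4)) (simp add: divide_right_mono)
    moreover have "filter (\<lambda>i. s / b \<le> fst i) js = []" if "b < s"
    proof -
      have "1 < s / b" using that assms(1) by simp
      then show ?thesis using js(2) unfolding filter_empty_conv by force
    qed
    ultimately show ?thesis by auto
  qed
  ultimately show ?thesis using js(5) True by (intro exI[of _ "qs"]) (auto simp: qs_def)
next
  case False
  have "\<bar>pairing u (restr E c)\<bar> \<le> H (piece E u)"
    using assms nat_interval_piece[of E u] pairing_piece[OF c, of u E] unfolding MR_def by simp
  then show ?thesis using assms False
    by (intro exI[of _ "[(b, piece E u)]"]) (auto simp: items_def wt_def nat_interval_piece)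
qed

lemma combine:
  assumes "\<And>k. k \<in> set ks \<Longrightarrow> 0 < fst k \<and> fst k \<le> b \<and> MR (snd k)" "sorted_wrt vec_before (map snd ks)"
    and t: "0 < t" and E: "nat_interval E"
  shows "\<exists>qs. items E qs \<and> (\<forall>i\<in>set qs. fst i \<le> b) \<and> (\<forall>i\<in>set qs. \<exists>k\<in>set ks. snd i \<subseteq> piece E (snd k)) \<and>
    (\<Sum>k\<leftarrow>ks. fst k * \<bar>pairing (snd k) (restr E c)\<bar>) \<le> (\<Sum>i\<leftarrow>qs. wt m t i) \<and>
    (\<forall>s\<ge>t. real (length (filter (\<lambda>i. s \<le> fst i) qs)) \<le> (\<Sum>k\<leftarrow>ks. if s \<le> fst k then 2 powr (3 * fst k / s) else 0)) \<and>
    real (length qs) \<le> (\<Sum>k\<leftarrow>ks. if t \<le> fst k then 2 powr (4 * Ph (Suc m) * (1 - log 2 (t / fst k))) else 1)"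
  using assms(1,2)
proof (induction ks)
  case Nil
  then show ?case by (intro exI[of _ "[]"]) (auto simp: items_def)
next
  case (Cons k ks)
  obtain is2 where i2: "items E is2" "\<forall>i\<in>set is2. fst i \<le> b" "\<forall>i\<in>set is2. \<exists>k\<in>set ks. snd i \<subseteq> piece E (snd k)"
    "(\<Sum>k\<leftarrow>ks. fst k * \<bar>pairing (snd k) (restr E c)\<bar>) \<le> (\<Sum>i\<leftarrow>is2. wt m t i)"
    "\<And>s. t \<le> s \<Longrightarrow> real (length (filter (\<lambda>i. s \<le> fst i) is2)) \<le> (\<Sum>k\<leftarrow>ks. if s \<le> fst k then 2 powr (3 * fst k / s) else 0)"
    "real (length is2) \<le> (\<Sum>k\<leftarrow>ks. if t \<le> fst k then 2 powr (4 * Ph (Suc m) * (1 - log 2 (t / fst k))) else 1)"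
    using Cons.IH Cons.prems by auto
  have k: "0 < fst k" "fst k \<le> b" "MR (snd k)" using Cons.prems(1)[of k] by auto
  obtain is1 where i1: "items (piece E (snd k)) is1" "\<forall>i\<in>set is1. fst i \<le> fst k"
    "fst k * \<bar>pairing (snd k) (restr E c)\<bar> \<le> (\<Sum>i\<leftarrow>is1. wt m t i)"
    "\<And>s. t \<le> s \<Longrightarrow> real (length (filter (\<lambda>i. s \<le> fst i) is1)) \<le> (if s \<le> fst k then 2 powr (3 * fst k / s) else 0)"
    "real (length is1) \<le> (if t \<le> fst k then 2 powr (4 * Ph (Suc m) * (1 - log 2 (t / fst k))) else 1)"
    using combine_single[OF k(1,3) t E] by metis
  have "items E (is1 @ is2)" unfolding items_def
  proof (intro conjI)
    show "\<forall>i\<in>set (is1 @ is2). 0 \<le> fst i \<and> nat_interval (snd i) \<and> snd i \<subseteq> E"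
      using i1(1) i2(1) piece_subset[of E "snd k"] by (auto simp: items_def)
    have "set_before (snd i) (snd j)" if "i \<in> set is1" "j \<in> set is2" for i j
    proof -
      from bspec[OF i2(3) that(2)] obtain k' where k': "k' \<in> set ks" "snd j \<subseteq> piece E (snd k')" ..
      have "vec_before (snd k) (snd k')" using Cons.prems(2) k'(1) by simp
      then have "sorted_wrt set_before (map (piece E) [snd k, snd k'])"
        using sorted_piece[of "[snd k, snd k']" E] by simp
      then have "set_before (piece E (snd k)) (piece E (snd k'))" by simp
      moreover have "snd i \<subseteq> piece E (snd k)" using i1(1) that(1) by (auto simp: items_def)
      ultimately show ?thesis using k'(2) by (rule set_before_mono)
    qed
    then show "sorted_wrt set_before (map snd (is1 @ is2))"
      using i1(1) i2(1) by (auto simp: items_def sorted_wrt_append)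
  qed
  moreover have "\<forall>i\<in>set (is1 @ is2). fst i \<le> b" using i1(2) i2(2) k(2) by auto
  moreover have "\<forall>i\<in>set (is1 @ is2). \<exists>k'\<in>set (k # ks). snd i \<subseteq> piece E (snd k')"
    using i1(1) i2(3) by (auto simp: items_def)
  moreover have "(\<Sum>k\<leftarrow>k # ks. fst k * \<bar>pairing (snd k) (restr E c)\<bar>) \<le> (\<Sum>i\<leftarrow>is1 @ is2. wt m t i)"
    using i1(3) i2(4) by simp
  moreover have "real (length (filter (\<lambda>i. s \<le> fst i) (is1 @ is2))) \<le>
      (\<Sum>k\<leftarrow>k # ks. if s \<le> fst k then 2 powr (3 * fst k / s) else 0)" if "t \<le> s" for s
    using i1(4)[OF that] i2(5)[OF that] by (simp del: if_split)
  moreover have "real (length (is1 @ is2)) \<le>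
      (\<Sum>k\<leftarrow>k # ks. if t \<le> fst k then 2 powr (4 * Ph (Suc m) * (1 - log 2 (t / fst k))) else 1)"
    using i1(5) i2(6) by (simp del: if_split)
  ultimately show ?case by blast
qed

text \<open>The factor \<open>lf l\<close> from the lower estimate cancels the weight of the
  average, so the constant 1 is kept without loss.\<close>

lemma node_bound:
  assumes us: "us \<noteq> []" "sorted_wrt vec_before us" "\<And>u. u \<in> set us \<Longrightarrow> MR u" and E: "nat_interval E"
  shows "\<bar>pairing (avg us) (restr E c)\<bar> \<le> H E"
proof -
  have l: "1 \<le> lf (real (length us))" using us(1) by (rule lf_length_ge_1)
  have "(\<Sum>u\<leftarrow>us. \<bar>pairing u (restr E c)\<bar>) \<le> (\<Sum>u\<leftarrow>us. H (piece E u))"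
    using us(3) nat_interval_piece[OF E] pairing_piece[OF c, of _ E] unfolding MR_def by (intro sum_list_mono) metis
  also have "\<dots> = (\<Sum>F\<leftarrow>map (piece E) us. H F)" by (simp add: o_def)
  also have "\<dots> \<le> lf (real (length (map (piece E) us))) * H E"
  proof (rule H_sum)
    show "nat_interval F \<and> F \<subseteq> E" if "F \<in> set (map (piece E) us)" for F
      using that nat_interval_piece[OF E] piece_subset by auto
  qed (use us E sorted_piece in auto)
  finally have "(\<Sum>u\<leftarrow>us. \<bar>pairing u (restr E c)\<bar>) / lf (real (length us)) \<le> H E"
    using l by (simp add: divide_le_eq mult.commute)
  then show ?thesis using abs_pairing_avg_le[OF us(1), of "restr E c"] by linarith
qed

end

lemma sum_list_bands:
  fixes h g :: "real \<times> nat set \<Rightarrow> real"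
  shows "(\<Sum>i\<leftarrow>qs. T * h i + (\<Sum>a<A. K a * (if s a \<le> fst i then w * h i + g i else 0))) =
    T * (\<Sum>i\<leftarrow>qs. h i) + (\<Sum>a<A. K a * (w * (\<Sum>i\<leftarrow>filter (\<lambda>i. s a \<le> fst i) qs. h i) + (\<Sum>i\<leftarrow>filter (\<lambda>i. s a \<le> fst i) qs. g i)))"
proof (induction qs)
  case (Cons i qs)
  have "(\<Sum>a<A. K a * (w * (\<Sum>i\<leftarrow>filter (\<lambda>i. s a \<le> fst i) (i # qs). h i) + (\<Sum>i\<leftarrow>filter (\<lambda>i. s a \<le> fst i) (i # qs). g i))) =
    (\<Sum>a<A. K a * (if s a \<le> fst i then w * h i + g i else 0) +
      K a * (w * (\<Sum>i\<leftarrow>filter (\<lambda>i. s a \<le> fst i) qs. h i) + (\<Sum>i\<leftarrow>filter (\<lambda>i. s a \<le> fst i) qs. g i)))"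
    by (intro sum.cong) (auto simp: algebra_simps)
  then show ?case using Cons by (simp only: sum.distrib list.map sum_list.Cons distrib_left)
qed simp

text \<open>The factor \<open>2 ^ a\<close> of the counts and the factor \<open>(1 / 2) ^ a\<close>
  of the coefficients cancel, so these terms contribute only in proportion to the number
  \<open>A\<close> of bands.\<close>

lemma sum_bands_eq:
  fixes f :: real
  shows "(\<Sum>a<A. u * (1 / 2) ^ a * (w * ((f + 6 * 2 ^ a + 1) * h) + t * (f + 6 * 2 ^ a + p) * h)) =
    u * h * ((w * (f + 1) + t * (f + p)) * (\<Sum>a<A. (1 / 2) ^ a) + A * (6 * (w + t)))"
proof -
  have 1: "u * y * (w * ((f + 6 * x + 1) * h) + t * (f + 6 * x + p) * h) =
      u * h * ((w * (f + 1) + t * (f + p)) * y + 6 * (w + t))" if "y * x = 1" for x y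
    using that by algebra
  have 2: "(1 / 2) ^ a * 2 ^ a = (1 :: real)" for a by (simp add: power_one_over)
  have "(\<Sum>a<A. u * (1 / 2) ^ a * (w * ((f + 6 * 2 ^ a + 1) * h) + t * (f + 6 * 2 ^ a + p) * h)) =
      (\<Sum>a<A. u * h * ((w * (f + 1) + t * (f + p)) * (1 / 2) ^ a + 6 * (w + t)))"
    by (rule sum.cong[OF refl]) (rule 1[OF 2])
  moreover have "(\<Sum>a<A. K * (B * (1 / 2) ^ a + D)) = K * (B * (\<Sum>a<A. (1 / 2) ^ a) + A * D)" for K B D :: real
    by (simp add: sum.distrib sum_distrib_left[symmetric])
  ultimately show ?thesis by simp
qed

context dominated
begin

text \<open>The items with coefficients in a dyadic band are counted; there are about \<open>2 * Ph m\<close> bands.\<close>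

lemma node_decay:
  assumes us: "us \<noteq> []" "sorted_wrt vec_before us" "\<And>u. u \<in> set us \<Longrightarrow> MR u" and E: "nat_interval E"
    and l: "Ph m \<le> lf (real (length us))"
  shows "\<bar>pairing (avg us) (restr E c)\<bar> \<le> om m * H E"
proof -
  define p f where "p = Ph m" and "f = lf (real (length us))"
  \<comment> \<open>After \<open>2 * p\<close> halvings the coefficients are small enough to
    outweigh \<open>Ph (Suc m) = 2 ^ p\<close>, which enters the logarithm of the total number of
    items.\<close>
  define A where "A = 2 * p"
  define T where "T = (1 / f) * (1 / 2) ^ A"
  let ?H = "H E"
  have p1: "1048576 \<le> real p" using of_nat_mono[OF Ph_ge[of m], where 'a = real] by (simp add: p_def)
  have pf: "real p \<le> f" using l by (simp add: p_def f_def)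
  have f1: "1048576 \<le> f" using p1 pf by linarith
  have l1: "1 \<le> real (length us)" using us(1) by (cases us) auto
  have T0: "0 < T" using f1 by (simp add: T_def)
  have H0: "0 \<le> ?H" by (rule H_nonneg)
  have logl: "log 2 (real (length us)) \<le> f" unfolding f_def using us(1) by (intro log2_le_lf) simp
  have Ph': "real (Ph (Suc m)) = 2 ^ p" unfolding p_def Ph_def add_Suc tw.simps by simp
  define ks where "ks = map (\<lambda>u. (1 / f, u)) us"
  obtain qs where qs: "items E qs" "\<And>i. i \<in> set qs \<Longrightarrow> fst i \<le> 1 / f"
    "(\<Sum>k\<leftarrow>ks. fst k * \<bar>pairing (snd k) (restr E c)\<bar>) \<le> (\<Sum>i\<leftarrow>qs. wt m T i)"
    "\<And>s. T \<le> s \<Longrightarrow> real (length (filter (\<lambda>i. s \<le> fst i) qs)) \<le> (\<Sum>k\<leftarrow>ks. if s \<le> fst k then 2 powr (3 * fst k / s) else 0)"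
    "real (length qs) \<le> (\<Sum>k\<leftarrow>ks. if T \<le> fst k then 2 powr (4 * Ph (Suc m) * (1 - log 2 (T / fst k))) else 1)"
  proof -
    have "0 < fst k \<and> fst k \<le> 1 / f \<and> MR (snd k)" if "k \<in> set ks" for k using that us(3) f1 by (auto simp: ks_def)
    moreover have "sorted_wrt vec_before (map snd ks)" using us(2) by (simp add: ks_def o_def)
    ultimately show ?thesis using that combine[of ks "1 / f", OF _ _ T0 E] by blast
  qed
  define Fs where "Fs s = map snd (filter (\<lambda>i. s \<le> fst i) qs)" for s
  have qF: "F \<in> set (map snd qs) \<Longrightarrow> nat_interval F \<and> F \<subseteq> E" for F using qs(1) by (auto simp: items_def)
  have FsF: "F \<in> set (Fs s) \<Longrightarrow> nat_interval F \<and> F \<subseteq> E" for F s using qs(1) by (auto simp: items_def Fs_def)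
  have Fs_sorted: "sorted_wrt set_before (Fs s)" for s
    using qs(1) unfolding items_def Fs_def sorted_wrt_map by (intro sorted_wrt_filter) auto
  have "\<bar>pairing (avg us) (restr E c)\<bar> \<le> (\<Sum>u\<leftarrow>us. \<bar>pairing u (restr E c)\<bar>) / f"
    unfolding f_def by (rule abs_pairing_avg_le[OF us(1)])
  also have "\<dots> = (\<Sum>k\<leftarrow>ks. fst k * \<bar>pairing (snd k) (restr E c)\<bar>)"
    unfolding ks_def by (simp add: o_def sum_list_const_mult[symmetric] divide_inverse mult.commute sum_list_mult_const)
  also have "\<dots> \<le> (\<Sum>i\<leftarrow>qs. wt m T i)" by (rule qs(3))
  also have "\<dots> \<le> (\<Sum>i\<leftarrow>qs. T * H (snd i) + (\<Sum>a<A. 1 / f * (1 / 2) ^ a *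
      (if 1 / f * (1 / 2) ^ Suc a \<le> fst i then om (Suc m) * H (snd i) + sg (snd i) else 0)))"
  proof (rule sum_list_mono)
    fix i assume i: "i \<in> set qs"
    let ?g = "om (Suc m) * H (snd i) + sg (snd i)"
    let ?b = "\<lambda>a. 1 / f * (1 / 2) ^ a * (if 1 / f * (1 / 2) ^ Suc a \<le> fst i then ?g else 0)"
    have i0: "0 \<le> fst i" using qs(1) i by (auto simp: items_def)
    have g0: "0 \<le> ?g" using om_nonneg H_nonneg sg_nonneg by (intro add_nonneg_nonneg mult_nonneg_nonneg) auto
    have b0: "0 \<le> ?b a" for a using g0 f1 by simp
    have TH: "0 \<le> T * H (snd i)" using T0 H_nonneg by simp
    show "wt m T i \<le> T * H (snd i) + (\<Sum>a<A. ?b a)"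
    proof (cases "fst i < T")
      case True
      then have "wt m T i \<le> T * H (snd i)" using H_nonneg by (simp add: wt_def mult_right_mono)
      then show ?thesis using b0 by (simp add: add_increasing2 sum_nonneg)
    next
      case False
      have ex: "\<exists>a<A'. 1 / f * (1 / 2) ^ Suc a \<le> fst i \<and> fst i \<le> 1 / f * (1 / 2) ^ a"
        if "1 / f * (1 / 2) ^ A' \<le> fst i" "0 < A'" for A'
        using that
      proof (induction A')
        case (Suc B)
        show ?case
        proof (cases "1 / f * (1 / 2) ^ B \<le> fst i \<and> 0 < B")
          case True
          then show ?thesis using Suc.IH less_Suc_eq by blast
        next
          case False
          then have "fst i \<le> 1 / f * (1 / 2) ^ B" using qs(2)[OF i] by (cases "B = 0") auto
          then show ?thesis using Suc.prems by blast
        qed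
      qed simp
      have "1 / f * (1 / 2) ^ A \<le> fst i" "0 < A" using False p1 by (auto simp: T_def A_def)
      from ex[OF this] obtain a where a: "a < A" "1 / f * (1 / 2) ^ Suc a \<le> fst i" "fst i \<le> 1 / f * (1 / 2) ^ a" by auto
      have "wt m T i = fst i * ?g" using False by (simp add: wt_def)
      also have "\<dots> \<le> 1 / f * (1 / 2) ^ a * ?g" using a(3) g0 by (rule mult_right_mono)
      also have "\<dots> = ?b a" using a(2) by simp
      also have "\<dots> \<le> (\<Sum>a<A. ?b a)" using a(1) b0 by (intro member_le_sum) auto
      finally show ?thesis using TH by linarith
    qed
  qed
  also have "\<dots> = T * (\<Sum>F\<leftarrow>map snd qs. H F) + (\<Sum>a<A. 1 / f * (1 / 2) ^ a *
      (om (Suc m) * (\<Sum>F\<leftarrow>Fs (1 / f * (1 / 2) ^ Suc a). H F) + (\<Sum>F\<leftarrow>Fs (1 / f * (1 / 2) ^ Suc a). sg F)))"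
    unfolding Fs_def sum_list_bands by (simp add: o_def)
  also have "\<dots> \<le> T * ((4 * 2 ^ p * (1 + A) + f + 1) * ?H) + (\<Sum>a<A. 1 / f * (1 / 2) ^ a *
      (om (Suc m) * ((f + 6 * 2 ^ a + 1) * ?H) + 1 / tw m * (f + 6 * 2 ^ a + p) * ?H))"
  proof (intro add_mono mult_left_mono sum_mono)
    have "real (length qs) \<le> real (length us) * 2 powr (4 * 2 ^ p * (1 + A))"
    proof -
      have "T \<le> 1 / f" unfolding T_def using f1 by (simp add: power_le_one divide_le_cancel)
      moreover have "log 2 (T / (1 / f)) = - real A" unfolding T_def using f1 by (simp add: log_nat_power log_divide)
      ultimately show ?thesis using qs(5) unfolding ks_def by (simp add: o_def sum_list_triv Ph' distrib_left)
    qed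
    then have lq: "real (length qs) \<le> real (length us) * 2 powr (4 * 2 ^ p * (1 + A))" .
    show "(\<Sum>F\<leftarrow>map snd qs. H F) \<le> (4 * 2 ^ p * (1 + A) + f + 1) * ?H"
    proof (cases "qs = []")
      case False
      then have q1: "1 \<le> real (length qs)" by (cases qs) auto
      have "(\<Sum>F\<leftarrow>map snd qs. H F) \<le> lf (real (length (map snd qs))) * ?H"
        using qs(1) False E qF by (intro H_sum) (auto simp: items_def)
      also have "lf (real (length (map snd qs))) \<le> log 2 (real (length qs)) + 1" using lf_le_log[OF q1] by simp
      also have "log 2 (real (length qs)) \<le> log 2 (real (length us) * 2 powr (4 * 2 ^ p * (1 + A)))"
        using lq q1 by (subst log_le_cancel_iff) linarith+
      also have "\<dots> = log 2 (real (length us)) + 4 * 2 ^ p * (1 + A)" using us(1) by (simp add: log_mult)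
      also have "log 2 (real (length us)) \<le> f" by (rule logl)
      finally show ?thesis using H0 by (simp add: mult_right_mono algebra_simps)
    qed (use H0 f1 in simp)
    show "0 \<le> T" using T0 by simp
    fix a assume a: "a \<in> {..<A}"
    define s where "s = 1 / f * (1 / 2) ^ Suc a"
    let ?n = "real (length (Fs s))"
    have Ts: "T \<le> s"
    proof -
      have "(1 / 2 :: real) ^ A \<le> (1 / 2) ^ Suc a" using a by (intro power_decreasing) auto
      then show ?thesis unfolding T_def s_def using f1 by (intro mult_left_mono) auto
    qed
    have s0: "0 < s" using f1 by (simp add: s_def)
    \<comment> \<open>The logarithm of the count up to band \<open>a\<close> is at most
      \<open>f + 6 * 2 ^ a\<close>, while the coefficients in the band are at most
      \<open>(1 / 2) ^ a / f\<close>. The growing part therefore contributes a constant times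
      \<open>1 / f\<close> per band, and there are only \<open>2 * p\<close>, at most
      \<open>2 * f\<close>, bands.\<close>
    have n1: "?n \<le> real (length us) * 2 powr (6 * 2 ^ a)"
    proof -
      have "s \<le> 1 / f" unfolding s_def using f1 power_le_one[of "1/2::real" "Suc a"] by (intro mult_left_le) auto
      moreover have "3 * (1 / f) / s = 6 * 2 ^ a" unfolding s_def using f1 by (simp add: power_one_over)
      ultimately show ?thesis using qs(4)[OF Ts] unfolding ks_def Fs_def by (simp add: o_def sum_list_triv)
    qed
    show "0 \<le> 1 / f * (1 / 2) ^ a" "0 \<le> om (Suc m)" using f1 om_nonneg by auto
    have logn: "log 2 ?n \<le> f + 6 * 2 ^ a" if "Fs s \<noteq> []"
    proof -
      have "1 \<le> ?n" using that by (cases "Fs s") auto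
      then have "log 2 ?n \<le> log 2 (real (length us) * 2 powr (6 * 2 ^ a))" using n1 by (subst log_le_cancel_iff) linarith+
      also have "\<dots> = log 2 (real (length us)) + 6 * 2 ^ a" using us(1) by (simp add: log_mult)
      finally show ?thesis using logl by simp
    qed
    show "(\<Sum>F\<leftarrow>Fs (1 / f * (1 / 2) ^ Suc a). H F) \<le> (f + 6 * 2 ^ a + 1) * ?H"
      unfolding s_def[symmetric]
    proof (cases "Fs s = []")
      case False
      then have q1: "1 \<le> ?n" by (cases "Fs s") auto
      have "(\<Sum>F\<leftarrow>Fs s. H F) \<le> lf ?n * ?H" using False E FsF Fs_sorted by (intro H_sum) auto
      also have "lf ?n \<le> f + 6 * 2 ^ a + 1" using lf_le_log[OF q1] logn[OF False] by simp
      finally show "(\<Sum>F\<leftarrow>Fs s. H F) \<le> (f + 6 * 2 ^ a + 1) * ?H" using H0 by (simp add: mult_right_mono)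
    qed (use H0 f1 in simp)
    show "(\<Sum>F\<leftarrow>Fs (1 / f * (1 / 2) ^ Suc a). sg F) \<le> 1 / tw m * (f + 6 * 2 ^ a + p) * ?H"
      unfolding s_def[symmetric]
    proof (cases "Fs s = []")
      case False
      have "(\<Sum>F\<leftarrow>Fs s. sg F) \<le> 1 / tw m * (log 2 ?n + p) * ?H"
        unfolding p_def using False E FsF Fs_sorted by (intro sum_sg_le) auto
      also have "\<dots> \<le> 1 / tw m * (f + 6 * 2 ^ a + p) * ?H"
        using logn[OF False] H0 by (intro mult_right_mono mult_left_mono) auto
      finally show "(\<Sum>F\<leftarrow>Fs s. sg F) \<le> 1 / tw m * (f + 6 * 2 ^ a + p) * ?H" .
    qed (use H0 f1 in \<open>auto intro!: mult_nonneg_nonneg add_nonneg_nonneg\<close>)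
  qed
  also have "\<dots> \<le> om m * ?H"
  proof -
    let ?\<theta> = "1 / real (tw m)" and ?w = "om (Suc m)"
    have \<theta>: "0 \<le> ?\<theta>" by simp
    have half: "(\<Sum>a<n. (1 / 2 :: real) ^ a) \<le> 2" for n
    proof -
      have "(\<Sum>a<n. (1 / 2 :: real) ^ a) = 2 - 2 * (1 / 2) ^ n" by (induction n) auto
      then show ?thesis by simp
    qed
    have "(\<Sum>a<A. 1 / f * (1 / 2) ^ a * (?w * ((f + 6 * 2 ^ a + 1) * ?H) + ?\<theta> * (f + 6 * 2 ^ a + p) * ?H)) =
      1 / f * ?H * ((?w * (f + 1) + ?\<theta> * (f + p)) * (\<Sum>a<A. (1 / 2) ^ a) + A * (6 * (?w + ?\<theta>)))"
      by (rule sum_bands_eq)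
    also have "\<dots> \<le> 1 / f * ?H * ((?w * (f + 1) + ?\<theta> * (f + p)) * 2 + A * (6 * (?w + ?\<theta>)))"
      using half[of A] H0 f1 om_nonneg \<theta> p1
      by (intro mult_left_mono add_right_mono) (auto intro!: add_nonneg_nonneg mult_nonneg_nonneg)
    also have "\<dots> \<le> 1 / f * ?H * ((16 * ?w + 16 * ?\<theta>) * f)"
    proof (intro mult_left_mono)
      have "?w * (f + 1) * 2 + A * (6 * ?w) = ?w * (2 * f + 2 + 12 * p)" by (simp add: A_def algebra_simps)
      also have "\<dots> \<le> ?w * (16 * f)" using pf f1 om_nonneg by (intro mult_left_mono) auto
      finally have 1: "?w * (f + 1) * 2 + A * (6 * ?w) \<le> 16 * ?w * f" by simp
      have "t * (f + p) * 2 + A * (6 * t) = t * (2 * f + 2 * p + 12 * p)" for t :: real by (simp add: A_def algebra_simps)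
      then have "?\<theta> * (f + p) * 2 + A * (6 * ?\<theta>) = ?\<theta> * (2 * f + 2 * p + 12 * p)" .
      also have "\<dots> \<le> ?\<theta> * (16 * f)" using pf f1 \<theta> by (intro mult_left_mono) auto
      finally show "(?w * (f + 1) + ?\<theta> * (f + p)) * 2 + A * (6 * (?w + ?\<theta>)) \<le> (16 * ?w + 16 * ?\<theta>) * f"
        using 1 by (simp add: algebra_simps)
    qed (use H0 f1 in simp)
    also have "\<dots> = (16 * ?w + 16 * ?\<theta>) * ?H" using f1 by simp
    finally have S: "(\<Sum>a<A. 1 / f * (1 / 2) ^ a * (?w * ((f + 6 * 2 ^ a + 1) * ?H) + ?\<theta> * (f + 6 * 2 ^ a + p) * ?H))
      \<le> (16 * ?w + 16 * ?\<theta>) * ?H" .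
    have t0: "1 \<le> real (tw m)" "1 \<le> tw m" using tw_ge[of m] by auto
    have q: "16 * (tw m)\<^sup>2 \<le> tw (Suc m)"
      using tw_ge[of m] exp_ge_quadratic[of "tw m"] by (simp add: tw.simps)
    then have "real (16 * (tw m)\<^sup>2) \<le> real (tw (Suc m))" by (rule of_nat_mono)
    moreover have "64 * real (tw m) \<le> 16 * (real (tw m))\<^sup>2" using tw_ge[of m] by (simp add: power2_eq_square)
    ultimately have t: "64 * real (tw m) \<le> real (tw (Suc m))" by simp
    have w: "16 * ?w \<le> 10 * ?\<theta>" using t t0 by (simp add: om_def field_simps)
    have "T * (4 * 2 ^ p * (1 + A) + f + 1) \<le> 14 / 2 ^ p"
    proof -
      have "T * (4 * 2 ^ p * (1 + A) + f + 1) = (1 / 2) ^ A * ((4 * 2 ^ p * (1 + 2 * real p) + f + 1) / f)" by (simp add: T_def A_def field_simps)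
      also have "\<dots> \<le> (1 / 2) ^ A * (14 * 2 ^ p)"
      proof (rule mult_left_mono)
        have "4 * 2 ^ p * (1 + 2 * real p) \<le> 4 * 2 ^ p * (3 * f)" using pf p1 by (intro mult_left_mono) auto
        moreover have "f + 1 \<le> 2 ^ p * (2 * f)"
        proof -
          have "1 * (f + 1) \<le> 2 ^ p * (2 * f)" using f1 by (intro mult_mono) (auto intro: one_le_power)
          then show ?thesis by simp
        qed
        ultimately have "4 * 2 ^ p * (1 + 2 * real p) + f + 1 \<le> 14 * 2 ^ p * f" by (simp add: algebra_simps)
        then show "(4 * 2 ^ p * (1 + 2 * real p) + f + 1) / f \<le> 14 * 2 ^ p" using f1 by (simp add: divide_le_eq)
      qed simp
      also have "\<dots> = 14 / 2 ^ p" by (simp add: A_def power_one_over mult_2 power_add)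
      finally show ?thesis .
    qed
    moreover have "14 / 2 ^ p \<le> 10 * ?\<theta>"
    proof -
      have "tw (Suc m) \<le> tw (Suc (m + 9))" by (rule tw_mono) simp
      then have "real (tw (Suc m)) \<le> 2 ^ p" using of_nat_mono[of "tw (Suc m)" "tw (Suc (m + 9))", where 'a = real]
        by (simp only: p_def Ph_def tw.simps of_nat_power of_nat_numeral)
      then have "64 * real (tw m) \<le> 2 ^ p" using t by linarith
      then show ?thesis using t0 by (simp add: field_simps)
    qed
    ultimately have "T * (4 * 2 ^ p * (1 + A) + f + 1) \<le> 10 * ?\<theta>" by linarith
    then have "T * (4 * 2 ^ p * (1 + A) + f + 1) * ?H \<le> 10 * ?\<theta> * ?H" using H0 by (rule mult_right_mono)
    moreover have "(16 * ?w + 16 * ?\<theta>) * ?H \<le> 26 * ?\<theta> * ?H" using w H0 by (intro mult_right_mono) auto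
    ultimately have "T * ((4 * 2 ^ p * (1 + A) + f + 1) * ?H) + (\<Sum>a<A. 1 / f * (1 / 2) ^ a * (?w * ((f + 6 * 2 ^ a + 1) * ?H) + ?\<theta> * (f + 6 * 2 ^ a + p) * ?H))
      \<le> 36 * ?\<theta> * ?H" using S by linarith
    also have "\<dots> \<le> om m * ?H" using H0 t0 by (intro mult_right_mono) (simp_all add: om_def divide_right_mono)
    finally show ?thesis .
  qed
  finally show ?thesis .
qed

end

lemma length_le_2_powr: "lf (real n) \<le> B \<Longrightarrow> real n \<le> 2 powr B"
  using le_two_powr_lf[of n] powr_mono[of "lf (real n)" B 2] by linarith

lemma tw_Suc_powr: "real (tw (Suc k)) = 2 powr real (tw k)"
  by (simp only: tw.simps powr_realpow zero_less_numeral of_nat_power of_nat_numeral)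

section \<open>Stability of the decompositions under averages, special functionals and convex
  combinations\<close>

context dominated
begin

text \<open>Long averages are one item by \<open>node_decay\<close>. For the others both counts
  reproduce themselves. An item above \<open>s\<close> forces \<open>f <= 1 / s\<close>, and then
  \<open>f + 3 / (f * s) <= 3 / s\<close> because \<open>f\<close> is at least
  \<open>19 / 12\<close>. In the total count \<open>log 2 f >= 1 / 4\<close> lowers the exponent by
  at least \<open>P\<close>, which pays for \<open>f\<close>. A single term has
  \<open>f = 1\<close>, where nothing is gained and nothing lost.\<close>

lemma node_dec:
  assumes us: "us \<noteq> []" "sorted_wrt vec_before us" "\<And>u. u \<in> set us \<Longrightarrow> MR u" and E: "nat_interval E"
    and t: "0 < t" "t \<le> 1"
  shows "dec m t E (avg us)"
proof (cases "Ph (Suc m) \<le> lf (real (length us))")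
  case True
  then show ?thesis by (intro dec_single node_decay us E t)
next
  case False
  define f P where "f = lf (real (length us))" and "P = real (Ph (Suc m))"
  have f1: "1 \<le> f" unfolding f_def using us(1) by (rule lf_length_ge_1)
  have fP: "f \<le> P" using False by (simp add: f_def P_def)
  have l: "real (length us) \<le> 2 powr f" unfolding f_def by (rule le_two_powr_lf)
  have l2: "length us = 1 \<and> f = 1 \<or> 19 / 12 \<le> f"
  proof (cases "length us = 1")
    case False
    then have "2 \<le> length us" using us(1) by (cases us) (auto simp: Suc_le_eq)
    then show ?thesis unfolding f_def using lf_ge_2[of "real (length us)"] by simp
  qed (simp add: f_def)
  have logt: "log 2 t \<le> 0" using t by simp
  define ks where "ks = map (\<lambda>u. (1 / f, u)) us"
  obtain qs where qs: "items E qs" "\<And>i. i \<in> set qs \<Longrightarrow> fst i \<le> 1 / f"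
    "(\<Sum>k\<leftarrow>ks. fst k * \<bar>pairing (snd k) (restr E c)\<bar>) \<le> (\<Sum>i\<leftarrow>qs. wt m t i)"
    "\<And>s. t \<le> s \<Longrightarrow> real (length (filter (\<lambda>i. s \<le> fst i) qs)) \<le> (\<Sum>k\<leftarrow>ks. if s \<le> fst k then 2 powr (3 * fst k / s) else 0)"
    "real (length qs) \<le> (\<Sum>k\<leftarrow>ks. if t \<le> fst k then 2 powr (4 * Ph (Suc m) * (1 - log 2 (t / fst k))) else 1)"
  proof -
    have "0 < fst k \<and> fst k \<le> 1 / f \<and> MR (snd k)" if "k \<in> set ks" for k using that us(3) f1 by (auto simp: ks_def)
    moreover have "sorted_wrt vec_before (map snd ks)" using us(2) by (simp add: ks_def o_def)
    ultimately show ?thesis using that combine[of ks "1 / f", OF _ _ t(1) E] by blast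
  qed
  have "\<bar>pairing (avg us) (restr E c)\<bar> \<le> (\<Sum>u\<leftarrow>us. \<bar>pairing u (restr E c)\<bar>) / f"
    unfolding f_def by (rule abs_pairing_avg_le[OF us(1)])
  also have "\<dots> = (\<Sum>k\<leftarrow>ks. fst k * \<bar>pairing (snd k) (restr E c)\<bar>)"
    unfolding ks_def by (simp add: o_def sum_list_const_mult[symmetric] divide_inverse mult.commute sum_list_mult_const)
  finally have v: "\<bar>pairing (avg us) (restr E c)\<bar> \<le> (\<Sum>i\<leftarrow>qs. wt m t i)" using qs(3) by linarith
  have "fst i \<le> 1" if "i \<in> set qs" for i
  proof -
    have "1 / f \<le> 1" using f1 by simp
    then show ?thesis using qs(2)[OF that] by linarith
  qed
  moreover have "real (length (filter (\<lambda>i. s \<le> fst i) qs)) \<le> 2 powr (3 / s)" if s: "t \<le> s" for s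
  proof (cases "s \<le> 1 / f")
    case True
    have s0: "0 < s" using s t by simp
    have "real (length (filter (\<lambda>i. s \<le> fst i) qs)) \<le> real (length us) * 2 powr (3 * (1 / f) / s)"
      using qs(4)[OF s] True unfolding ks_def by (simp add: o_def sum_list_triv)
    also have "\<dots> \<le> 2 powr (3 / s)"
      using l2
    proof
      assume f: "19 / 12 \<le> f"
      have "real (length us) * 2 powr (3 * (1 / f) / s) \<le> 2 powr f * 2 powr (3 * (1 / f) / s)" using l by (rule mult_right_mono) simp
      also have "\<dots> = 2 powr (f + 3 * (1 / f) / s)" by (simp add: powr_add)
      also have "\<dots> \<le> 2 powr (3 / s)"
      proof (rule powr_mono)
        have 1: "f \<le> 1 / s" using True s0 f1 by (simp add: field_simps)
        have "3 * (1 / f) / s \<le> 3 * (12 / 19) / s" using f s0 by (intro divide_right_mono mult_left_mono) (auto simp: field_simps)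
        also have "\<dots> = 36 / 19 * (1 / s)" by simp
        finally have "f + 3 * (1 / f) / s \<le> 1 / s + 36 / 19 * (1 / s)" using 1 by linarith
        also have "\<dots> \<le> 3 * (1 / s)" using s0 by (simp add: field_simps)
        finally show "f + 3 * (1 / f) / s \<le> 3 / s" by simp
      qed simp
      finally show ?thesis .
    qed simp
    finally show ?thesis .
  next
    case False
    then have "real (length (filter (\<lambda>i. s \<le> fst i) qs)) \<le> 0"
      using qs(4)[OF s] unfolding ks_def by (simp add: o_def)
    then show ?thesis by (rule order_trans) simp
  qed
  moreover have "real (length qs) \<le> 2 powr (4 * Ph (Suc m) * (1 - log 2 t))"
  proof (cases "t \<le> 1 / f")
    case True
    have "real (length qs) \<le> real (length us) * 2 powr (4 * P * (1 - log 2 (t / (1 / f))))"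
      using qs(5) True unfolding ks_def P_def by (simp add: o_def sum_list_triv)
    also have "log 2 (t / (1 / f)) = log 2 t + log 2 f" using t f1 by (simp add: log_mult)
    also have "real (length us) * 2 powr (4 * P * (1 - (log 2 t + log 2 f))) \<le> 2 powr (4 * P * (1 - log 2 t))"
      using l2
    proof
      assume f: "19 / 12 \<le> f"
      have "1 \<le> 4 * log 2 f"
      proof -
        have "(2::real) \<le> (19 / 12) ^ 4" by (simp add: power4_eq_xxxx)
        also have "\<dots> \<le> f ^ 4" using f by (intro power_mono) auto
        finally have "log 2 2 \<le> log 2 (f ^ 4)" using f by (subst log_le_cancel_iff) auto
        then show ?thesis using f by (simp add: log_nat_power)
      qed
      then have "P * 1 \<le> P * (4 * log 2 f)" using fP f1 by (intro mult_left_mono) auto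
      then have "f + 4 * P * (1 - (log 2 t + log 2 f)) \<le> 4 * P * (1 - log 2 t)" using fP by (simp add: algebra_simps)
      then have "2 powr (f + 4 * P * (1 - (log 2 t + log 2 f))) \<le> 2 powr (4 * P * (1 - log 2 t))" by (rule powr_mono) simp
      moreover have "real (length us) * 2 powr (4 * P * (1 - (log 2 t + log 2 f))) \<le> 2 powr f * 2 powr (4 * P * (1 - (log 2 t + log 2 f)))"
        using l by (rule mult_right_mono) simp
      moreover have "2 powr (f + 4 * P * (1 - (log 2 t + log 2 f))) = 2 powr f * 2 powr (4 * P * (1 - (log 2 t + log 2 f)))" by (rule powr_add)
      ultimately show ?thesis by linarith
    qed simp
    finally show ?thesis by (simp add: P_def)
  next
    case False
    have "real (length qs) \<le> real (length us)"
      using qs(5) False unfolding ks_def by (simp add: o_def sum_list_triv)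
    also have "\<dots> \<le> 2 powr f" by (rule l)
    also have "\<dots> \<le> 2 powr (4 * P * (1 - log 2 t))"
    proof (rule powr_mono)
      have "4 * P * 1 \<le> 4 * P * (1 - log 2 t)" using logt fP f1 by (intro mult_left_mono) auto
      then show "f \<le> 4 * P * (1 - log 2 t)" using fP f1 by linarith
    qed simp
    finally show ?thesis by (simp add: P_def)
  qed
  ultimately show ?thesis unfolding dec_def using qs(1) v by blast
qed

definition groups :: "(nat \<Rightarrow> real) list list \<Rightarrow> bool"
  where "groups uss \<longleftrightarrow> (\<forall>us\<in>set uss. us \<noteq> [] \<and> sorted_wrt vec_before us \<and> (\<forall>u\<in>set us. MR u)) \<and>
    length ` set uss \<subseteq> J \<and> sorted_wrt vec_before (concat uss) \<and> (\<forall>m. length (filter (\<lambda>us. length us = m) uss) \<le> 2)"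

lemma groups_filter: "groups uss \<Longrightarrow> groups (filter p uss)"
  unfolding groups_def
proof (elim conjE, intro conjI ballI allI)
  fix m assume "\<forall>m. length (filter (\<lambda>us. length us = m) uss) \<le> 2"
  then show "length (filter (\<lambda>us. length us = m) (filter p uss)) \<le> 2"
    using length_filter_filter[of "\<lambda>us. length us = m" p uss] order_trans by blast
qed (auto intro: sorted_wrt_concat_filter)

text \<open>A length with \<open>r\<close> smaller ones before it has \<open>lf\<close> at least
  \<open>Ph (m + r)\<close>, so \<open>node_decay\<close> applies with \<open>m + r\<close>. The
  factors \<open>om (m + r)\<close> sum to at most \<open>2 * om m\<close>, and every length occurs
  at most twice.\<close>

lemma sum_heavy_le:
  assumes uss: "groups uss" "\<And>us. us \<in> set uss \<Longrightarrow> Ph m \<le> lf (real (length us))" and E: "nat_interval E"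
  shows "(\<Sum>us\<leftarrow>uss. \<bar>pairing (avg us) (restr E c)\<bar>) \<le> 4 * om m * H E"
proof -
  define S where "S = length ` set uss"
  define r where "r n = card {k\<in>S. k < n}" for n
  have S: "finite S" "S \<subseteq> J" using uss(1) by (auto simp: S_def groups_def)
  have g: "real (tw (m + 9 + Suc k)) \<le> 2 powr (2 powr (2 powr real (tw (m + 9 + k))))" for k
  proof -
    have x: "x \<le> 2 powr x" if "1 \<le> x" for x :: real using two_powr_ge[OF that] by simp
    have "real (tw (m + 9 + Suc k)) = 2 powr real (tw (m + 9 + k))" by (simp only: add_Suc_right tw_Suc_powr)
    also have "\<dots> \<le> 2 powr (2 powr real (tw (m + 9 + k)))" by (intro x) (simp add: ge_one_powr_ge_zero)
    also have "\<dots> \<le> 2 powr (2 powr (2 powr real (tw (m + 9 + k))))" by (intro x) (simp add: ge_one_powr_ge_zero)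
    finally show ?thesis .
  qed
  have rk: "Ph (m + r n) \<le> lf (real n)" if "n \<in> S" for n
  proof -
    have "real (tw (m + 9 + 0)) \<le> lf (real k)" if "k \<in> S" for k using that uss(2) by (auto simp: S_def Ph_def)
    from rank_lf_ge[OF J S, of "\<lambda>k. real (tw (m + 9 + k))", OF this g that]
    show ?thesis by (simp add: Ph_def r_def add_ac)
  qed
  have "(\<Sum>us\<leftarrow>uss. \<bar>pairing (avg us) (restr E c)\<bar>) \<le> (\<Sum>us\<leftarrow>uss. om (m + r (length us)) * H E)"
  proof (rule sum_list_mono)
    fix us assume us: "us \<in> set uss"
    show "\<bar>pairing (avg us) (restr E c)\<bar> \<le> om (m + r (length us)) * H E"
      using us uss(1) rk[of "length us"] E by (intro node_decay) (auto simp: groups_def S_def)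
  qed
  also have "\<dots> \<le> 2 * (\<Sum>n\<in>S. om (m + r n) * H E)" unfolding S_def
    using uss(1) H_nonneg om_nonneg by (intro sum_list_le_twice) (auto simp: groups_def)
  also have "(\<Sum>n\<in>S. om (m + r n) * H E) = (\<Sum>k<card S. om (m + k) * H E)"
    unfolding r_def by (rule sum_rank[OF S(1)])
  also have "\<dots> = (\<Sum>k<card S. om (m + k)) * H E" by (simp add: sum_distrib_right)
  also have "\<dots> \<le> 2 * om m * H E" by (intro mult_right_mono sum_om_le H_nonneg)
  finally show ?thesis by simp
qed

text \<open>Elements of \<open>J\<close> are three exponentials apart while \<open>Ph 0\<close> is
  only \<open>tw 9\<close>. So at most four different lengths lie below it, each occurring at most
  twice.\<close>

lemma length_light_le:
  assumes uss: "groups uss" "\<And>us. us \<in> set uss \<Longrightarrow> lf (real (length us)) < Ph 0"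
  shows "real (length uss) \<le> 8"
proof -
  define S where "S = length ` set uss"
  \<comment> \<open>As \<open>tw 0 = 2 ^ 20\<close>, the value 20 acts as the step before
    \<open>tw 0\<close>. Then \<open>g 1\<close>, \<open>g 2\<close>, \<open>g 3\<close>,
    \<open>g 4\<close> are \<open>tw 2\<close>, \<open>tw 5\<close>, \<open>tw 8\<close>,
    \<open>tw 11\<close>, and the fifth length is out of range.\<close>
  define g where "g k = (if k = 0 then 20 else real (tw (3 * k - 1)))" for k
  have S: "finite S" "S \<subseteq> J" using uss(1) by (auto simp: S_def groups_def)
  have g: "g (Suc k) \<le> 2 powr (2 powr (2 powr g k))" for k
  proof (cases k)
    case 0
    have "real (tw 2) = 2 powr (2 powr (2 powr 20))"
    proof -
      have "tw 2 = tw (Suc (Suc 0))" by (simp only: numeral_2_eq_2)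
      then have "real (tw 2) = 2 powr (2 powr real (tw 0))" by (simp only: tw_Suc_powr)
      also have "real (tw 0) = 2 powr 20" by (simp add: tw.simps)
      finally show ?thesis .
    qed
    moreover have "g (Suc 0) = real (tw 2)" "g 0 = 20" by (simp_all add: g_def numeral_2_eq_2)
    ultimately show ?thesis unfolding 0 by (simp only: order_refl)
  next
    case (Suc j)
    have "real (tw (Suc (Suc (Suc a)))) = 2 powr (2 powr (2 powr real (tw a)))" for a
      by (simp only: tw_Suc_powr)
    moreover have "3 * Suc k - 1 = Suc (Suc (Suc (3 * k - 1)))" using Suc by simp
    moreover have "g (Suc k) = real (tw (3 * Suc k - 1))" "g k = real (tw (3 * k - 1))" using Suc by (simp_all add: g_def)
    ultimately show ?thesis by (simp only: order_refl)
  qed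
  have "card S \<le> 4"
  proof (rule ccontr)
    assume c: "\<not> card S \<le> 4"
    then have "S \<noteq> {}" by auto
    define n where "n = Max S"
    have n: "n \<in> S" unfolding n_def using S(1) \<open>S \<noteq> {}\<close> by (rule Max_in)
    have "{k\<in>S. k < n} = S - {n}" using S(1) unfolding n_def by (auto intro: le_neq_trans)
    then have r: "4 \<le> card {k\<in>S. k < n}" using c n S(1) by simp
    have "g 0 \<le> lf (real k)" if "k \<in> S" for k using GM_index_ge[OF J, of k] that S by (auto simp: g_def)
    from rank_lf_ge[OF J S, of g, OF this g n] have "g (card {k\<in>S. k < n}) \<le> lf (real n)" .
    moreover have "real (tw 9) \<le> g j" if "4 \<le> j" for j using that by (auto simp: g_def intro: tw_mono)
    from this[OF r] have "real (tw 9) \<le> g (card {k\<in>S. k < n})" .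
    moreover have "lf (real n) < real (tw 9)" using n uss(2) by (auto simp: S_def Ph_def)
    ultimately show False by linarith
  qed
  moreover have "(\<Sum>us\<leftarrow>uss. 1 :: real) \<le> 2 * (\<Sum>n\<in>S. 1)" unfolding S_def
    using uss(1) sum_list_le_twice[of uss "\<lambda>_. 1"] by (simp add: groups_def)
  ultimately show ?thesis by (simp add: sum_list_triv)
qed

text \<open>At most 8 light groups contribute \<open>H E\<close> each, and all heavy groups together
  contribute at most \<open>H E\<close>. The total of 9 is outweighed by the factor
  \<open>1 / 16\<close>, that is, by \<open>f (min J) >= 256\<close>.\<close>

lemma spec_bound:
  assumes uss: "groups uss" and a: "0 \<le> a" "a \<le> 1 / 16" and E: "nat_interval E"
  shows "\<bar>pairing (\<lambda>n. a * (\<Sum>us\<leftarrow>uss. avg us n)) (restr E c)\<bar> \<le> H E"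
proof -
  let ?w = "\<lambda>us. \<bar>pairing (avg us) (restr E c)\<bar>"
  let ?l = "filter (\<lambda>us. lf (real (length us)) < Ph 0) uss" and ?h = "filter (\<lambda>us. \<not> lf (real (length us)) < Ph 0) uss"
  have "(\<Sum>us\<leftarrow>?l. ?w us) \<le> (\<Sum>us\<leftarrow>?l. H E)"
    using uss E by (intro sum_list_mono node_bound) (auto simp: groups_def)
  also have "\<dots> = real (length ?l) * H E" by (simp add: sum_list_triv)
  also have "\<dots> \<le> 8 * H E" using groups_filter[OF uss] by (intro mult_right_mono length_light_le H_nonneg) auto
  finally have l: "(\<Sum>us\<leftarrow>?l. ?w us) \<le> 8 * H E" .
  have "(\<Sum>us\<leftarrow>?h. ?w us) \<le> 4 * om 0 * H E"
    using groups_filter[OF uss] E by (intro sum_heavy_le) auto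
  also have "\<dots> \<le> 1 * H E" by (intro mult_right_mono H_nonneg) (simp add: om_def tw.simps)
  finally have h: "(\<Sum>us\<leftarrow>?h. ?w us) \<le> H E" by simp
  have "(\<Sum>us\<leftarrow>uss. ?w us) = (\<Sum>us\<leftarrow>?l. ?w us) + (\<Sum>us\<leftarrow>?h. ?w us)" by (induction uss) auto
  then have s: "(\<Sum>us\<leftarrow>uss. ?w us) \<le> 9 * H E" using l h by linarith
  have "\<bar>pairing (\<lambda>n. a * (\<Sum>us\<leftarrow>uss. avg us n)) (restr E c)\<bar> = a * \<bar>\<Sum>us\<leftarrow>uss. pairing (avg us) (restr E c)\<bar>"
    using a by (simp add: pairing_scale_left pairing_sum_list abs_mult)
  also have "\<dots> \<le> 1 / 16 * (9 * H E)"
    using a s abs_sum_list_le[of "\<lambda>us. pairing (avg us) (restr E c)" uss] H_nonneg[of E]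
    by (intro mult_mono) auto
  finally show ?thesis using H_nonneg[of E] by linarith
qed

text \<open>The terms get the coefficients \<open>1 / (8 * f us)\<close>. The number of groups that
  matter is controlled by their lengths, since each length occurs at most twice; the large weights
  in \<open>J\<close> pay for it.\<close>

lemma light_dec:
  assumes uss: "groups uss" "\<And>us. us \<in> set uss \<Longrightarrow> lf (real (length us)) \<le> Ph (Suc m)"
    and E: "nat_interval E" and t: "0 < t" "t \<le> 1"
    and v: "\<bar>pairing v (restr E c)\<bar> \<le> 1 / 8 * (\<Sum>us\<leftarrow>uss. \<bar>pairing (avg us) (restr E c)\<bar>)"
  shows "dec m t E v"
proof -
  define f where "f us = lf (real (length us))" for us :: "(nat \<Rightarrow> real) list"
  define P where "P = real (Ph (Suc m))"
  have P4: "real (4 * Ph (Suc m)) = 4 * P" by (simp add: P_def)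
  define W where "W = 4 * P * (1 - log 2 t)"
  have P1: "1 \<le> P" using Ph_ge[of "Suc m"] by (simp add: P_def)
  have logt: "log 2 t \<le> 0" using t by simp
  have f256: "256 \<le> f us" if "us \<in> set uss" for us
    unfolding f_def using that uss(1) by (intro GM_index_ge[OF J]) (auto simp: groups_def)
  have ne: "us \<noteq> []" if "us \<in> set uss" for us using that uss(1) by (auto simp: groups_def)
  define ks where "ks = concat (map (\<lambda>us. map (\<lambda>u. (1 / (8 * f us), u)) us) uss)"
  have sum_ks: "(\<Sum>k\<leftarrow>ks. \<phi> (fst k)) = (\<Sum>us\<leftarrow>uss. real (length us) * \<phi> (1 / (8 * f us)))" for \<phi> :: "real \<Rightarrow> real"
    unfolding ks_def sum_list_map_concat by (simp add: o_def sum_list_triv)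
  obtain qs where qs: "items E qs" "\<And>i. i \<in> set qs \<Longrightarrow> fst i \<le> 1"
    "(\<Sum>k\<leftarrow>ks. fst k * \<bar>pairing (snd k) (restr E c)\<bar>) \<le> (\<Sum>i\<leftarrow>qs. wt m t i)"
    "\<And>s. t \<le> s \<Longrightarrow> real (length (filter (\<lambda>i. s \<le> fst i) qs)) \<le> (\<Sum>k\<leftarrow>ks. if s \<le> fst k then 2 powr (3 * fst k / s) else 0)"
    "real (length qs) \<le> (\<Sum>k\<leftarrow>ks. if t \<le> fst k then 2 powr (4 * Ph (Suc m) * (1 - log 2 (t / fst k))) else 1)"
  proof -
    have "0 < fst k \<and> fst k \<le> 1 \<and> MR (snd k)" if k: "k \<in> set ks" for k
    proof -
      obtain us u where u: "us \<in> set uss" "u \<in> set us" "k = (1 / (8 * f us), u)" using k by (auto simp: ks_def)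
      have "MR u" using u uss(1) by (auto simp: groups_def)
      then show ?thesis using u(3) f256[OF u(1)] by simp
    qed
    moreover have "sorted_wrt vec_before (map snd ks)"
      using uss(1) by (simp add: ks_def map_concat o_def groups_def)
    ultimately show ?thesis using that combine[of ks 1, OF _ _ t(1) E] by blast
  qed
  have "1 / 8 * (\<Sum>us\<leftarrow>uss. \<bar>pairing (avg us) (restr E c)\<bar>) \<le> (\<Sum>us\<leftarrow>uss. \<Sum>u\<leftarrow>us. 1 / (8 * f us) * \<bar>pairing u (restr E c)\<bar>)"
    unfolding sum_list_const_mult[symmetric]
  proof (rule sum_list_mono)
    fix us assume us: "us \<in> set uss"
    have "\<bar>pairing (avg us) (restr E c)\<bar> \<le> (\<Sum>u\<leftarrow>us. \<bar>pairing u (restr E c)\<bar>) / f us"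
      unfolding f_def by (rule abs_pairing_avg_le[OF ne[OF us]])
    then have "1 / 8 * \<bar>pairing (avg us) (restr E c)\<bar> \<le> 1 / 8 * ((\<Sum>u\<leftarrow>us. \<bar>pairing u (restr E c)\<bar>) / f us)" by simp
    also have "\<dots> = 1 / (8 * f us) * (\<Sum>u\<leftarrow>us. \<bar>pairing u (restr E c)\<bar>)" by simp
    finally show "1 / 8 * \<bar>pairing (avg us) (restr E c)\<bar> \<le> (\<Sum>u\<leftarrow>us. 1 / (8 * f us) * \<bar>pairing u (restr E c)\<bar>)"
      by (simp only: sum_list_const_mult)
  qed
  also have "\<dots> = (\<Sum>k\<leftarrow>ks. fst k * \<bar>pairing (snd k) (restr E c)\<bar>)"
    unfolding ks_def sum_list_map_concat by (simp add: o_def)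
  finally have v': "\<bar>pairing v (restr E c)\<bar> \<le> (\<Sum>i\<leftarrow>qs. wt m t i)" using qs(3) v by linarith
  have mult: "length (filter (\<lambda>us. length us = m) uss) \<le> 2" for m using uss(1) by (simp add: groups_def)
  have "real (length (filter (\<lambda>i. s \<le> fst i) qs)) \<le> 2 powr (3 / s)" if s: "t \<le> s" for s
  proof -
    \<comment> \<open>Only groups with \<open>f us <= X\<close> yield items of coefficient at least
      \<open>s\<close>. Their lengths, and hence half their number, are at most
      \<open>2 powr X\<close>, and each of their terms yields at most \<open>2 powr X\<close> items;
      the total exponent \<open>1 + 3 * X\<close> is far below \<open>3 / s = 24 * X\<close>. For
      \<open>X < 256\<close> there is no such group.\<close>
    define X where "X = 1 / (8 * s)"
    define h where "h n = real n * (if s \<le> 1 / (8 * lf (real n)) then 2 powr (3 * (1 / (8 * lf (real n))) / s) else 0)" for n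
    have s0: "0 < s" using s t by simp
    have "real (length (filter (\<lambda>i. s \<le> fst i) qs)) \<le> (\<Sum>us\<leftarrow>uss. h (length us))"
      using qs(4)[OF s] unfolding sum_ks[of "\<lambda>b. if s \<le> b then 2 powr (3 * b / s) else 0"] h_def f_def .
    also have "\<dots> \<le> 2 powr (3 / s)"
    proof (cases "256 \<le> X")
      case True
      have "(\<Sum>us\<leftarrow>uss. h (length us)) \<le> 2 * (2 powr X * (2 powr X * 2 powr X))"
      proof (rule sum_list_bounded_lengths[OF mult])
        show "0 \<le> h n" for n by (simp add: h_def)
        fix us assume us: "us \<in> set uss" "h (length us) \<noteq> 0"
        then have sf: "s \<le> 1 / (8 * f us)" by (auto simp: h_def f_def split: if_splits)
        then have fX: "f us \<le> X" using s0 f256[OF us(1)] by (simp add: X_def field_simps)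
        then have lX: "real (length us) \<le> 2 powr X" unfolding f_def by (rule length_le_2_powr)
        have "3 * (1 / (8 * f us)) / s = 3 * X * (1 / f us)" by (simp add: X_def)
        also have "\<dots> \<le> 3 * X * (1 / 256)" using f256[OF us(1)] True by (intro mult_left_mono) (auto simp: field_simps)
        also have "\<dots> \<le> X" using True by simp
        finally have "2 powr (3 * (1 / (8 * f us)) / s) \<le> 2 powr X" by (rule powr_mono) simp
        then have "h (length us) \<le> 2 powr X * 2 powr X"
          using sf lX unfolding h_def f_def by (auto intro!: mult_mono)
        then show "h (length us) \<le> 2 powr X * 2 powr X \<and> 1 \<le> length us \<and> real (length us) \<le> 2 powr X"
          using lX ne[OF us(1)] by (simp add: Suc_le_eq)
      qed auto
      also have "\<dots> = 2 powr (1 + X + X + X)" by (simp only: powr_add) simp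
      also have "\<dots> \<le> 2 powr (3 / s)"
      proof (rule powr_mono)
        have "3 / s = 24 * X" by (simp add: X_def)
        then show "1 + X + X + X \<le> 3 / s" using True by simp
      qed simp
      finally show ?thesis .
    next
      case False
      have "h (length us) = 0" if us: "us \<in> set uss" for us
      proof -
        have "s * 256 \<le> s * f us" using f256[OF us] s0 by (intro mult_left_mono) auto
        moreover have "1 < 2048 * s" using False s0 by (simp add: X_def field_simps)
        ultimately have "1 < s * (8 * f us)" by linarith
        then have "\<not> s \<le> 1 / (8 * f us)" using f256[OF us] by (simp add: pos_le_divide_eq)
        then show ?thesis by (simp add: h_def f_def)
      qed
      then have "(\<Sum>us\<leftarrow>uss. h (length us)) = (\<Sum>us\<leftarrow>uss. 0)" by (intro arg_cong[of _ _ sum_list] map_cong) auto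
      then show ?thesis by simp
    qed
    finally show ?thesis .
  qed
  moreover have "real (length qs) \<le> 2 powr W"
  proof -
    \<comment> \<open>Passing to threshold \<open>t * (8 * f us)\<close> lowers the exponent
      \<open>W\<close> by at least \<open>4 * P\<close>. This pays for the length of a group and for
      the number of groups, which are at most \<open>2 powr P\<close> and twice that.\<close>
    define h where "h n = real n * (if t \<le> 1 / (8 * lf (real n)) then 2 powr (4 * P * (1 - log 2 (t / (1 / (8 * lf (real n)))))) else 1)" for n
    have "real (length qs) \<le> (\<Sum>us\<leftarrow>uss. h (length us))"
      using qs(5) unfolding P4 sum_ks[of "\<lambda>b. if t \<le> b then 2 powr (4 * P * (1 - log 2 (t / b))) else 1"] h_def f_def .
    also have "\<dots> \<le> 2 * (2 powr P * (2 powr P * 2 powr (W - 4 * P)))"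
    proof (rule sum_list_bounded_lengths[OF mult])
      show "0 \<le> h n" for n by (simp add: h_def)
      fix us assume us: "us \<in> set uss"
      have lP: "real (length us) \<le> 2 powr P" unfolding P_def using uss(2)[OF us] by (rule length_le_2_powr)
      have W: "0 \<le> W - 4 * P"
      proof -
        have "4 * P * 1 \<le> 4 * P * (1 - log 2 t)" using logt P1 by (intro mult_left_mono) auto
        then show ?thesis by (simp add: W_def)
      qed
      have "h (length us) \<le> 2 powr P * 2 powr (W - 4 * P)"
        unfolding h_def f_def[symmetric]
      proof (intro mult_mono lP)
        show "(if t \<le> 1 / (8 * f us) then 2 powr (4 * P * (1 - log 2 (t / (1 / (8 * f us))))) else 1) \<le> 2 powr (W - 4 * P)"
        proof (cases "t \<le> 1 / (8 * f us)")
          case True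
          have f8: "2 \<le> 8 * f us" using f256[OF us] by simp
          then have "log 2 2 \<le> log 2 (8 * f us)" by (subst log_le_cancel_iff) auto
          then have "1 \<le> log 2 (8 * f us)" by simp
          moreover have "log 2 (t / (1 / (8 * f us))) = log 2 t + log 2 (8 * f us)"
            using t f8 log_mult[of 2 t "8 * f us"] by simp
          ultimately have "4 * P * (1 - log 2 (t / (1 / (8 * f us)))) \<le> 4 * P * (- log 2 t)"
            using P1 by (intro mult_left_mono) auto
          also have "\<dots> = W - 4 * P" by (simp add: W_def algebra_simps)
          finally show ?thesis using True by simp
        next
          case False
          then show ?thesis using W by (simp add: ge_one_powr_ge_zero)
        qed
      qed auto
      then show "h (length us) \<le> 2 powr P * 2 powr (W - 4 * P) \<and> 1 \<le> length us \<and> real (length us) \<le> 2 powr P"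
        using lP ne[OF us] by (simp add: Suc_le_eq)
    qed auto
    also have "\<dots> = 2 powr (1 + P + P + (W - 4 * P))" by (simp only: powr_add) simp
    also have "\<dots> \<le> 2 powr W" using P1 by (intro powr_mono) auto
    finally show ?thesis .
  qed
  ultimately show ?thesis unfolding dec_def P4 W_def[symmetric] using qs(1,2) v' by blast
qed

text \<open>With the factor \<open>1 / 16\<close> the value is at most \<open>1 / 8\<close> of the
  larger of the light and the heavy sum, so only one of them has to be decomposed. If it is the
  heavy one, \<open>sum_heavy_le\<close> makes the whole functional a single small item.\<close>

lemma spec_dec:
  assumes uss: "groups uss" and a: "0 \<le> a" "a \<le> 1 / 16" and E: "nat_interval E" and t: "0 < t" "t \<le> 1"
  shows "dec m t E (\<lambda>n. a * (\<Sum>us\<leftarrow>uss. avg us n))"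
proof -
  let ?v = "\<lambda>n. a * (\<Sum>us\<leftarrow>uss. avg us n)"
  let ?w = "\<lambda>us. \<bar>pairing (avg us) (restr E c)\<bar>"
  let ?p = "\<lambda>us :: (nat \<Rightarrow> real) list. lf (real (length us)) \<le> Ph (Suc m)"
  have "\<bar>pairing ?v (restr E c)\<bar> = a * \<bar>\<Sum>us\<leftarrow>uss. pairing (avg us) (restr E c)\<bar>"
    using a by (simp add: pairing_scale_left pairing_sum_list abs_mult)
  also have "\<dots> \<le> 1 / 16 * (\<Sum>us\<leftarrow>uss. ?w us)"
    using a abs_sum_list_le[of "\<lambda>us. pairing (avg us) (restr E c)" uss] by (intro mult_mono) auto
  also have "(\<Sum>us\<leftarrow>uss. ?w us) = (\<Sum>us\<leftarrow>filter ?p uss. ?w us) + (\<Sum>us\<leftarrow>filter (\<lambda>us. \<not> ?p us) uss. ?w us)" by (induction uss) auto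
  finally have v: "\<bar>pairing ?v (restr E c)\<bar> \<le> 1 / 16 * ((\<Sum>us\<leftarrow>filter ?p uss. ?w us) + (\<Sum>us\<leftarrow>filter (\<lambda>us. \<not> ?p us) uss. ?w us))" .
  have small: "r \<le> 1 / 8 * x" if "y \<le> x" "r \<le> 1 / 16 * (x + y)" for r x y :: real using that by simp
  have large: "r \<le> w" if "\<not> y \<le> x" "r \<le> 1 / 16 * (x + y)" "y \<le> 4 * w" "0 \<le> w" for r x y w :: real using that by simp
  show ?thesis
  proof (cases "(\<Sum>us\<leftarrow>filter (\<lambda>us. \<not> ?p us) uss. ?w us) \<le> (\<Sum>us\<leftarrow>filter ?p uss. ?w us)")
    case True
    then have "\<bar>pairing ?v (restr E c)\<bar> \<le> 1 / 8 * (\<Sum>us\<leftarrow>filter ?p uss. ?w us)" using v by (rule small)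
    then show ?thesis using groups_filter[OF uss] E t by (intro light_dec) auto
  next
    case False
    have "(\<Sum>us\<leftarrow>filter (\<lambda>us. \<not> ?p us) uss. ?w us) \<le> 4 * om (Suc m) * H E"
      using groups_filter[OF uss] E by (intro sum_heavy_le) auto
    then have "(\<Sum>us\<leftarrow>filter (\<lambda>us. \<not> ?p us) uss. ?w us) \<le> 4 * (om (Suc m) * H E)" by (simp only: mult.assoc)
    moreover have "0 \<le> om (Suc m) * H E" using om_nonneg H_nonneg by simp
    ultimately have "\<bar>pairing ?v (restr E c)\<bar> \<le> om (Suc m) * H E" by (rule large[OF False v])
    then show ?thesis using E t by (intro dec_single)
  qed
qed

lemma dec_mono: "dec m t E w \<Longrightarrow> \<bar>pairing v (restr E c)\<bar> \<le> \<bar>pairing w (restr E c)\<bar> \<Longrightarrow> dec m t E v"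
  unfolding dec_def by (meson order_trans)

lemma dec_zero: "0 < t \<Longrightarrow> pairing v (restr E c) = 0 \<Longrightarrow> dec m t E v"
  unfolding dec_def by (intro exI[of _ "[]"]) (auto simp: items_def)

text \<open>For a fixed vector a convex combination is dominated by one of its terms. The
  decomposition of that term can be used for the combination, so item counts are not added
  up.\<close>

lemma convex_max:
  fixes a x :: "nat \<Rightarrow> real"
  assumes "(\<Sum>i=1..l. \<bar>a i\<bar>) \<le> 1" "1 \<le> l"
  shows "\<exists>j\<in>{1..l}. \<bar>\<Sum>i=1..l. a i * x i\<bar> \<le> \<bar>x j\<bar>"
proof -
  have "Max ((\<lambda>i. \<bar>x i\<bar>) ` {1..l}) \<in> (\<lambda>i. \<bar>x i\<bar>) ` {1..l}" using assms(2) by (intro Max_in) auto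
  then obtain j where j1: "j \<in> {1..l}" "Max ((\<lambda>i. \<bar>x i\<bar>) ` {1..l}) = \<bar>x j\<bar>" by (rule imageE)
  have j: "j \<in> {1..l}" "\<And>i. i \<in> {1..l} \<Longrightarrow> \<bar>x i\<bar> \<le> \<bar>x j\<bar>"
    using j1 unfolding j1(2)[symmetric] by (auto intro!: Max_ge)
  have "\<bar>\<Sum>i=1..l. a i * x i\<bar> \<le> (\<Sum>i=1..l. \<bar>a i\<bar> * \<bar>x i\<bar>)" using sum_abs[of "\<lambda>i. a i * x i"] by (simp add: abs_mult)
  also have "\<dots> \<le> (\<Sum>i=1..l. \<bar>a i\<bar> * \<bar>x j\<bar>)" using j by (intro sum_mono mult_left_mono) auto
  also have "\<dots> = (\<Sum>i=1..l. \<bar>a i\<bar>) * \<bar>x j\<bar>" by (simp add: sum_distrib_right)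
  also have "\<dots> \<le> 1 * \<bar>x j\<bar>" using assms(1) by (rule mult_right_mono) simp
  finally show ?thesis using j(1) by auto
qed

lemma relG_MR: "v \<in> relG J \<Longrightarrow> MR v"
proof (induction rule: relG.induct)
  case (base a k)
  let ?v = "\<lambda>i. if i = k then a else 0 :: real"
  have p: "pairing ?v (restr E c) = (if k \<in> E then a * c k else 0)" for E
  proof -
    have "pairing ?v (restr E c) = (\<Sum>i\<in>supp (restr E c). if i = k then a * restr E c i else 0)"
      unfolding pairing_def by (intro sum.cong) auto
    also have "\<dots> = (if k \<in> E then a * c k else 0)"
      using restr_c00[OF c, of E] by (auto simp: c00_def supp_def restr_def)
    finally show ?thesis .
  qed
  have ac: "\<bar>a * c k\<bar> \<le> \<bar>c k\<bar>" unfolding abs_mult using base mult_right_mono[of "\<bar>a\<bar>" 1 "\<bar>c k\<bar>"] by simp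
  have "\<bar>pairing ?v (restr E c)\<bar> \<le> H E" for E
  proof (cases "k \<in> E")
    case True
    then show ?thesis using p[of E] ac c_le[OF True] by simp
  qed (use p[of E] H_nonneg[of E] in simp)
  \<comment> \<open>A unit functional has no smallness to offer; the term \<open>sg\<close> in the
    weight of a singleton was made for it.\<close>
  moreover have "dec m t E ?v" if t: "0 < t" "t \<le> 1" for m t E
  proof (cases "k \<in> E")
    case True
    have "log 2 t \<le> 0" using t by simp
    then have "0 \<le> 4 * real (Ph (Suc m)) * (1 - log 2 t)" by (intro mult_nonneg_nonneg) auto
    then have "1 \<le> 2 powr (4 * Ph (Suc m) * (1 - log 2 t))" by (simp add: ge_one_powr_ge_zero)
    moreover have "1 \<le> 2 powr (3 / s)" if "t \<le> s" for s :: real using that t by (simp add: ge_one_powr_ge_zero)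
    moreover have "\<bar>a * c k\<bar> \<le> om (Suc m) * H {k} + \<bar>c k\<bar>" using ac om_nonneg[of "Suc m"] H_nonneg[of "{k}"] by (simp add: add_increasing)
    ultimately show ?thesis using t True p[of E] unfolding dec_def
      by (intro exI[of _ "[(1, {k})]"]) (auto simp: items_def wt_def sg_def)
  qed (use p[of E] t dec_zero in simp)
  ultimately show ?case unfolding MR_def by blast
next
  case (conv l w a)
  let ?v = "\<lambda>n. \<Sum>i=1..l. a i * w i n"
  show ?case
  proof (cases "1 \<le> l")
    case True
    have ex: "\<exists>j\<in>{1..l}. \<bar>pairing ?v (restr E c)\<bar> \<le> \<bar>pairing (w j) (restr E c)\<bar>" for E
      unfolding pairing_sum_left using convex_max[OF conv.hyps(2) True, of "\<lambda>i. pairing (w i) (restr E c)"] .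
    show ?thesis unfolding MR_def
    proof (intro conjI allI impI)
      fix E :: "nat set" assume E: "nat_interval E"
      obtain j where "j \<in> {1..l}" "\<bar>pairing ?v (restr E c)\<bar> \<le> \<bar>pairing (w j) (restr E c)\<bar>" using ex by blast
      then show "\<bar>pairing ?v (restr E c)\<bar> \<le> H E" using conv.IH[of j] E unfolding MR_def by fastforce
    next
      fix m t and E :: "nat set" assume t: "0 < t" "t \<le> (1::real)" and E: "nat_interval E"
      obtain j where j: "j \<in> {1..l}" "\<bar>pairing ?v (restr E c)\<bar> \<le> \<bar>pairing (w j) (restr E c)\<bar>" using ex by blast
      have "dec m t E (w j)" using conv.IH[OF j(1)] t E unfolding MR_def by blast
      then show "dec m t E ?v" using j(2) by (rule dec_mono)
    qed
  next
    case False
    then have "pairing ?v (restr E c) = 0" for E unfolding pairing_sum_left by simp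
    then show ?thesis unfolding MR_def using H_nonneg dec_zero by simp
  qed
next
  case (node us)
  then show ?case unfolding MR_def[of "avg us"] using node_bound[of us] node_dec[of us] by blast
next
  case (spec uss a)
  have "groups uss" unfolding groups_def
  proof (intro conjI ballI allI)
    fix us assume us: "us \<in> set uss"
    have "length us \<in> J" using us spec.hyps(2) by auto
    then show "us \<noteq> []" using GM_index_gt[OF J, of "length us"] by auto
    show "sorted_wrt vec_before us" using sorted_wrt_concat_elem[OF spec.hyps(3) us] .
    show "MR u" if "u \<in> set us" for u using spec.IH[OF us that] .
  qed (use spec.hyps in auto)
  then show ?case unfolding MR_def[of "\<lambda>n. a * (\<Sum>us\<leftarrow>uss. avg us n)"]
    using spec_bound[of uss a] spec_dec[of uss a] spec.hyps(5,6) by blast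
qed

end

section \<open>The operator on finitely supported sequences\<close>

context GM
begin

lemma nrm_unitv_le: "nrm (unitv n) \<le> 1"
proof (rule nrm_le)
  fix z assume "z \<in> GMs J \<sigma>"
  then have "\<bar>z n\<bar> \<le> 1" by (intro relG_abs_le[OF GMs_relG J])
  then show "pairing z (unitv n) \<le> 1" by (simp add: pairing_unitv)
qed

lemma nrm_scale: "x \<in> c00 \<Longrightarrow> nrm (\<lambda>i. a * x i) \<le> \<bar>a\<bar> * nrm x"
proof (rule nrm_le)
  fix z assume x: "x \<in> c00" and z: "z \<in> GMs J \<sigma>"
  have "pairing z (\<lambda>i. a * x i) \<le> \<bar>a\<bar> * \<bar>pairing z x\<bar>" using pairing_scale[OF x] abs_ge_self by (simp add: abs_mult[symmetric])
  also have "\<dots> \<le> \<bar>a\<bar> * nrm x" using nrm_ge[OF z] by (intro mult_left_mono) auto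
  finally show "pairing z (\<lambda>i. a * x i) \<le> \<bar>a\<bar> * nrm x" .
qed

lemma nrm_initial_le:
  assumes x: "x \<in> c00" "\<And>n. n < p \<Longrightarrow> \<bar>x n\<bar> \<le> e"
  shows "nrm (restr {..<p} x) \<le> p * e"
proof -
  have "restr {..<p} x = (\<lambda>i. \<Sum>n<p. x n * unitv n i)"
    by (auto simp: restr_def unitv_def fun_eq_iff if_distrib cong: if_cong)
  then have "nrm (restr {..<p} x) \<le> (\<Sum>n<p. nrm (\<lambda>i. x n * unitv n i))"
    using nrm_sum[of "{..<p}" "\<lambda>n i. x n * unitv n i"] c00_scale[OF unitv_c00] by simp
  also have "\<dots> \<le> (\<Sum>n<p. e)"
  proof (rule sum_mono)
    fix n assume "n \<in> {..<p}"
    have "nrm (\<lambda>i. x n * unitv n i) \<le> \<bar>x n\<bar> * nrm (unitv n)" by (rule nrm_scale[OF unitv_c00])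
    also have "\<dots> \<le> e * 1" using x(2)[of n] \<open>n \<in> {..<p}\<close> nrm_unitv_le nrm_nonneg by (intro mult_mono) auto
    finally show "nrm (\<lambda>i. x n * unitv n i) \<le> e" by simp
  qed
  finally show ?thesis by simp
qed

text \<open>With \<open>n\<close> successive vectors and at most \<open>n\<close> successive
  functionals only about \<open>2 * n\<close> pairs can meet, and each contributes at most
  \<open>b\<close>.\<close>

lemma pieces_sum_le:
  assumes y: "\<And>i. i \<in> {1..n} \<Longrightarrow> y i \<in> c00 \<and> nrm (y i) \<le> b"
    "\<And>i j. i \<in> {1..n} \<Longrightarrow> j \<in> {1..n} \<Longrightarrow> i < j \<Longrightarrow> vec_before (y i) (y j)"
    and ws: "set ws \<subseteq> GMs J \<sigma>" "sorted_wrt vec_before ws" "length ws \<le> n" and b: "0 \<le> b"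
  shows "(\<Sum>w\<leftarrow>ws. \<bar>pairing w (\<lambda>t. \<Sum>i=1..n. y i t)\<bar>) \<le> 2 * real n * b"
proof -
  have "(\<Sum>w\<leftarrow>ws. \<bar>pairing w (\<lambda>t. \<Sum>i=1..n. y i t)\<bar>) \<le> (\<Sum>w\<leftarrow>ws. b * real (card (touch y n (piece UNIV w))))"
  proof (rule sum_list_mono)
    fix w assume w: "w \<in> set ws"
    have "\<bar>pairing w (\<lambda>t. \<Sum>i=1..n. y i t)\<bar> = \<bar>\<Sum>i=1..n. pairing w (y i)\<bar>"
      using y(1) pairing_sum[of "{1..n}" y w] by simp
    also have "(\<Sum>i=1..n. pairing w (y i)) = (\<Sum>i\<in>touch y n (piece UNIV w). pairing w (y i))"
    proof (rule sum.mono_neutral_right)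
      show "\<forall>i\<in>{1..n} - touch y n (piece UNIV w). pairing w (y i) = 0"
      proof
        fix i assume "i \<in> {1..n} - touch y n (piece UNIV w)"
        then have "supp w \<inter> supp (y i) = {}" using ihull_superset[of "supp w"] by (auto simp: touch_def piece_def)
        then show "pairing w (y i) = 0" by (rule pairing_eq_0)
      qed
    qed (auto simp: touch_def)
    also have "\<bar>\<dots>\<bar> \<le> (\<Sum>i\<in>touch y n (piece UNIV w). b)"
    proof (rule order_trans[OF sum_abs sum_mono])
      fix i assume "i \<in> touch y n (piece UNIV w)"
      then have "nrm (y i) \<le> b" using y(1) by (auto simp: touch_def)
      moreover have "\<bar>pairing w (y i)\<bar> \<le> nrm (y i)" using ws(1) w by (intro nrm_ge) auto
      ultimately show "\<bar>pairing w (y i)\<bar> \<le> b" by linarith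
    qed
    finally show "\<bar>pairing w (\<lambda>t. \<Sum>i=1..n. y i t)\<bar> \<le> b * real (card (touch y n (piece UNIV w)))" by (simp add: mult.commute)
  qed
  also have "\<dots> = b * real (\<Sum>F\<leftarrow>map (piece UNIV) ws. card (touch y n F))"
    by (induction ws) (auto simp: algebra_simps)
  also have "\<dots> \<le> b * real (card (touch y n UNIV) + length (map (piece UNIV) ws))"
    using b ws(2) by (intro mult_left_mono of_nat_mono sum_card_touch y(2) sorted_piece) auto
  also have "\<dots> \<le> b * real (n + n)"
    using b ws(3) card_touch_le[of y n UNIV] by (intro mult_left_mono of_nat_mono add_mono) auto
  finally show ?thesis by (simp add: algebra_simps)
qed

text \<open>
  If no group of \<open>n ^ Suc j\<close> consecutive vectors is an \<open>\<ell>\<^sub>1\<close>-average of its \<open>n\<close> subgroups, the norms lose a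
  factor 2 at each of the \<open>k\<close> levels, against the lower bound \<open>n ^ k / (2 * lf (n ^ k))\<close>.
\<close>

lemma l1_average:
  assumes s: "\<And>i. s i < s (Suc i)" and u: "\<And>i. supp (u i) \<subseteq> {s i..<s (Suc i)}" "\<And>i. u i \<in> c00"
    "\<And>i. 1 / 2 \<le> nrm (u i)" "\<And>i. nrm (u i) \<le> 2" and n: "1 \<le> n"
  shows "\<exists>a j. j < n + 16 \<and> 1 / 2 \<le> nrm (\<lambda>t. \<Sum>i\<in>{a..<a + n ^ Suc j}. u i t) \<and>
    (\<forall>ws. set ws \<subseteq> GMs J \<sigma> \<longrightarrow> sorted_wrt vec_before ws \<longrightarrow> length ws \<le> n \<longrightarrow>
      (\<Sum>w\<leftarrow>ws. \<bar>pairing w (\<lambda>t. \<Sum>i\<in>{a..<a + n ^ Suc j}. u i t)\<bar>) \<le> 4 * nrm (\<lambda>t. \<Sum>i\<in>{a..<a + n ^ Suc j}. u i t))"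
proof -
  define Y where "Y a l = (\<lambda>t. \<Sum>i\<in>{a..<a + l}. u i t)" for a l
  define V where "V a l = nrm (Y a l)" for a l
  have sm: "i \<le> j \<Longrightarrow> s i \<le> s j" for i j by (rule lift_Suc_mono_le[of s]) (use s less_imp_le in blast)+
  have Yc: "Y a l \<in> c00" for a l unfolding Y_def using u(2) by (intro c00_sum)
  have sY: "supp (Y a l) \<subseteq> {s a..<s (a + l)}" for a l
  proof
    fix t assume "t \<in> supp (Y a l)"
    then have "(\<Sum>i\<in>{a..<a + l}. u i t) \<noteq> 0" by (simp add: supp_def Y_def)
    then obtain i where i: "i \<in> {a..<a + l}" "u i t \<noteq> 0" by (meson sum.not_neutral_contains_not_neutral)
    then have "t \<in> {s i..<s (Suc i)}" using u(1)[of i] by (auto simp: supp_def)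
    then show "t \<in> {s a..<s (a + l)}" using sm[of a i] sm[of "Suc i" "a + l"] i by auto
  qed
  have rY: "restr {s i..<s (Suc i)} (Y a l) = u i" if "a \<le> i" "i < a + l" for a l i
  proof
    fix t
    have z: "u k t = 0" if "k \<noteq> i" "t \<in> {s i..<s (Suc i)}" for k
    proof -
      have "t \<notin> {s k..<s (Suc k)}" using that sm[of "Suc k" i] sm[of "Suc i" k] by (cases "k < i") auto
      then show ?thesis using u(1)[of k] by (auto simp: supp_def)
    qed
    show "restr {s i..<s (Suc i)} (Y a l) t = u i t"
    proof (cases "t \<in> {s i..<s (Suc i)}")
      case True
      have "Y a l t = (\<Sum>k\<in>{a..<a + l}. if k = i then u i t else 0)" unfolding Y_def using z True by (intro sum.cong) auto
      then show ?thesis using that True by (simp add: restr_def)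
    next
      case False
      then show ?thesis using u(1)[of i] by (auto simp: restr_def supp_def)
    qed
  qed
  have Vge: "1 / 2 \<le> V a l" if "1 \<le> l" for a l
  proof -
    have "nrm (u a) = nrm (restr {s a..<s (Suc a)} (Y a l))" using rY[of a a l] that by simp
    also have "\<dots> \<le> nrm (restr UNIV (Y a l))" by (intro nrm_restr_mono Yc) auto
    finally show ?thesis using u(3)[of a] by (simp add: V_def)
  qed
  have low: "real l / 2 \<le> lf (real l) * V 0 l" if "1 \<le> l" for l
  proof -
    define Es where "Es = map (\<lambda>i. {s i..<s (Suc i)}) [0..<l]"
    have "real l / 2 = (\<Sum>i\<leftarrow>[0..<l]. 1 / 2)" by (simp add: sum_list_triv)
    also have "\<dots> \<le> (\<Sum>E\<leftarrow>Es. nrm (restr E (Y 0 l)))"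
      unfolding Es_def using rY[of 0 _ l] u(3) by (simp add: o_def) (intro sum_list_mono, simp)
    also have "\<dots> \<le> lf (real (length Es)) * nrm (restr UNIV (Y 0 l))"
    proof (rule sum_list_nrm_le)
      show "sorted_wrt set_before Es" unfolding Es_def sorted_wrt_map
      proof (rule sorted_wrt_mono_rel[of _ "(<)"])
        fix i j assume "i < (j::nat)"
        then show "set_before {s i..<s (Suc i)} {s j..<s (Suc j)}" using sm[of "Suc i" j] by (auto simp: set_before_def)
      qed simp
    qed (use that Yc in \<open>auto simp: Es_def\<close>)
    finally show ?thesis by (simp add: Es_def V_def)
  qed
  \<comment> \<open>Large enough for \<open>4 * (k * n + 1) < 2 ^ k\<close>, which contradicts the
    comparison of the two bounds below.\<close>
  define k where "k = n + 16"
  have "\<exists>a j. j < k \<and> (\<forall>i<n. V (a + i * n ^ j) (n ^ j) \<le> 2 / n * V a (n ^ Suc j))"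
  proof (rule ccontr)
    assume "\<not> ?thesis"
    then have no: "\<exists>i<n. 2 / n * V a (n ^ Suc j) < V (a + i * n ^ j) (n ^ j)" if "j < k" for a j using that by (meson not_le)
    have "\<forall>a. V a (n ^ j) \<le> (n / 2) ^ j * 2" if "j \<le> k" for j using that
    proof (induction j)
      case 0
      have "Y a 1 = u a" for a by (simp add: Y_def)
      then show ?case using u(4) by (simp add: V_def)
    next
      case (Suc j)
      show ?case
      proof
        fix a
        obtain i where "2 / n * V a (n ^ Suc j) < V (a + i * n ^ j) (n ^ j)" using no[of j a] Suc.prems by auto
        also have "\<dots> \<le> (n / 2) ^ j * 2" using Suc by simp
        finally show "V a (n ^ Suc j) \<le> (n / 2) ^ Suc j * 2" using n by (simp add: field_simps)
      qed
    qed
    from this[OF order_refl] have up: "V 0 (n ^ k) \<le> (n / 2) ^ k * 2" by blast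
    have nk: "1 \<le> n ^ k" using n by simp
    from of_nat_mono[OF nk, where 'a = real] have L: "1 \<le> real (n ^ k)" by (simp only: of_nat_1)
    have "real (n ^ k) / 2 \<le> lf (real (n ^ k)) * V 0 (n ^ k)" by (rule low[OF nk])
    also have "\<dots> \<le> lf (real (n ^ k)) * ((n / 2) ^ k * 2)" using up lf_ge_1[OF L] by (intro mult_left_mono) auto
    finally have "real n ^ k / 2 \<le> lf (real (n ^ k)) * 2 / 2 ^ k * real n ^ k" by (simp add: power_divide)
    then have "2 ^ k \<le> 4 * lf (real (n ^ k))" using n by (simp add: field_simps)
    also have "lf (real (n ^ k)) \<le> log 2 (real (n ^ k)) + 1" using L by (rule lf_le_log)
    also have "log 2 (real (n ^ k)) = k * log 2 (real n)" using n by (simp add: log_nat_power)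
    also have "log 2 (real n) \<le> real n"
    proof -
      have "real n \<le> 2 powr real n" using less_exp[of n] of_nat_mono[of n "2 ^ n", where 'a = real] by (simp add: powr_realpow)
      then have "log 2 (real n) \<le> log 2 (2 powr real n)" using n by (subst log_le_cancel_iff) auto
      then show ?thesis by simp
    qed
    finally have "2 ^ k \<le> 4 * (real k * real n + 1)" by (simp add: mult_left_mono)
    then have "real (2 ^ k) \<le> real (4 * (k * n + 1))" by simp
    then have "2 ^ k \<le> 4 * (k * n + 1)" by (simp only: of_nat_le_iff)
    moreover have "16 * k\<^sup>2 \<le> 2 ^ k" by (rule exp_ge_quadratic) (simp add: k_def)
    moreover have "4 * (k * n + 1) < 16 * k\<^sup>2"
    proof -
      have "k * n \<le> k * k" by (intro mult_left_mono) (simp_all add: k_def)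
      moreover have "1 \<le> k * k" by (simp add: k_def)
      ultimately show ?thesis unfolding power2_eq_square distrib_left by linarith
    qed
    ultimately show False by linarith
  qed
  then obtain a j where j: "j < k" and small: "\<And>i. i < n \<Longrightarrow> V (a + i * n ^ j) (n ^ j) \<le> 2 / n * V a (n ^ Suc j)" by blast
  define y where "y i = Y (a + (i - 1) * n ^ j) (n ^ j)" for i
  have Yy: "Y a (n ^ Suc j) = (\<lambda>t. \<Sum>i=1..n. y i t)"
  proof
    fix t
    have "(\<Sum>i\<in>{a..<a + m * l}. u i t) = (\<Sum>i=1..m. \<Sum>r\<in>{a + (i - 1) * l..<a + (i - 1) * l + l}. u r t)" for m l
    proof (induction m)
      case (Suc m)
      have "(\<Sum>i\<in>{a..<a + Suc m * l}. u i t) = (\<Sum>i\<in>{a..<a + m * l}. u i t) + (\<Sum>i\<in>{a + m * l..<a + m * l + l}. u i t)"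
        by (subst sum.atLeastLessThan_concat) (auto simp: add_ac)
      then show ?case using Suc by simp
    qed simp
    from this[of n "n ^ j"] show "Y a (n ^ Suc j) t = (\<Sum>i=1..n. y i t)" by (simp add: Y_def y_def)
  qed
  have "(\<Sum>w\<leftarrow>ws. \<bar>pairing w (Y a (n ^ Suc j))\<bar>) \<le> 4 * V a (n ^ Suc j)"
    if ws: "set ws \<subseteq> GMs J \<sigma>" "sorted_wrt vec_before ws" "length ws \<le> n" for ws
  proof -
    have "(\<Sum>w\<leftarrow>ws. \<bar>pairing w (Y a (n ^ Suc j))\<bar>) \<le> 2 * real n * (2 / n * V a (n ^ Suc j))"
      unfolding Yy
    proof (rule pieces_sum_le[OF _ _ ws])
      fix i assume i: "i \<in> {1..n}"
      then show "y i \<in> c00 \<and> nrm (y i) \<le> 2 / n * V a (n ^ Suc j)"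
        using small[of "i - 1"] Yc by (auto simp: y_def V_def)
    next
      fix i i' assume i: "i \<in> {1..n}" "i' \<in> {1..n}" "i < i'"
      have "(i - 1) * n ^ j + n ^ j = i * n ^ j" using i by (cases i) auto
      also have "\<dots> \<le> (i' - 1) * n ^ j" using i by (intro mult_right_mono) auto
      finally have "s (a + (i - 1) * n ^ j + n ^ j) \<le> s (a + (i' - 1) * n ^ j)" by (intro sm) simp
      then show "vec_before (y i) (y i')" unfolding y_def by (rule vec_before_atLeastLessThan[OF sY sY])
    next
      show "0 \<le> 2 / n * V a (n ^ Suc j)" using nrm_nonneg by (simp add: V_def)
    qed
    then show ?thesis using n by simp
  qed
  moreover have "1 / 2 \<le> V a (n ^ Suc j)" using n by (intro Vge) simp
  ultimately show ?thesis using j unfolding k_def V_def Y_def by blast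
qed

end

section \<open>Boundedness and smallness of the operator\<close>

context blocks
begin

definition T0 :: "(nat \<Rightarrow> real) \<Rightarrow> nat \<Rightarrow> real" where "T0 x = (\<lambda>n. pairing (bz n) x)"

lemma T0_apply: "T0 x n = pairing (bz n) x"
  by (simp add: T0_def)

lemma T0_eq_0:
  assumes "supp x \<subseteq> {Q h..}" "n < h"
  shows "T0 x n = 0"
proof -
  have "supp (bz n) \<inter> supp x = {}" using supp_z[of n] Q_mono[of "Suc n" h] assms by fastforce
  then show ?thesis by (simp add: T0_def pairing_eq_0)
qed

lemma T0_c00: "x \<in> c00 \<Longrightarrow> T0 x \<in> c00"
proof -
  assume x: "x \<in> c00"
  have "supp (T0 x) \<subseteq> {..Max (insert 0 (supp x))}"
  proof
    fix n assume "n \<in> supp (T0 x)"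
    then have "supp (bz n) \<inter> supp x \<noteq> {}" using pairing_eq_0[of "bz n" x] by (auto simp: supp_def T0_def)
    then obtain i where i: "i \<in> supp x" "i \<in> supp (bz n)" by auto
    then have "Q n \<le> i" using supp_z[of n] by auto
    then have "n \<le> i" using Q_ge[of n] by simp
    also have "i \<le> Max (insert 0 (supp x))" using x i by (intro Max_ge) (auto simp: c00_def)
    finally show "n \<in> {..Max (insert 0 (supp x))}" by simp
  qed
  then show ?thesis unfolding c00_def using finite_subset by auto
qed

lemma T0_dominated: "x \<in> c00 \<Longrightarrow> dominated J (T0 x) (\<lambda>E. nrm (restr (blk E) x))"
proof
  show "(\<Sum>n\<in>A. \<bar>T0 x n\<bar>) \<le> 1 / tw m * (log 2 (card A) + Ph m) * nrm (restr (blk E) x)"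
    if "x \<in> c00" "nat_interval E" "finite A" "A \<noteq> {}" "A \<subseteq> E" for E A m
    using sum_coeff_le[OF that] by (simp add: T0_def Ph_def)
  show "(\<Sum>E\<leftarrow>Es. nrm (restr (blk E) x)) \<le> lf (real (length Es)) * nrm (restr (blk P) x)"
    if "x \<in> c00" "\<And>E. E \<in> set Es \<Longrightarrow> nat_interval E \<and> E \<subseteq> P" "sorted_wrt set_before Es" "Es \<noteq> []" "nat_interval P" for Es P
    using that by (intro sum_blk_le)
qed (auto simp: J T0_c00 nrm_nonneg coeff_le T0_apply)

lemma blk_UNIV: "blk UNIV = UNIV"
  using block_of by (auto simp: blk_def)

lemma T0_bound: "x \<in> c00 \<Longrightarrow> nrm (T0 x) \<le> nrm x"
proof (rule nrm_le)
  fix v assume x: "x \<in> c00" and v: "v \<in> GMs J \<sigma>"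
  interpret D: dominated J "T0 x" "\<lambda>E. nrm (restr (blk E) x)" using x by (rule T0_dominated)
  have "\<bar>pairing v (restr UNIV (T0 x))\<bar> \<le> nrm (restr (blk UNIV) x)"
    using D.relG_MR[OF GMs_relG[OF v]] unfolding D.MR_def by (meson nat_interval_UNIV)
  then show "pairing v (T0 x) \<le> nrm x" by (simp add: blk_UNIV)
qed

lemma norming:
  assumes "nat_interval P"
  shows "\<exists>w. w \<in> GMs J \<sigma> \<and> supp w \<subseteq> P \<and> (x \<in> c00 \<longrightarrow> nrm (restr P x) \<le> 2 * \<bar>pairing w x\<bar>)"
proof (cases "0 < nrm (restr P x)")
  case True
  then obtain z where z: "z \<in> GMs J \<sigma>" "nrm (restr P x) - nrm (restr P x) / 2 \<le> pairing z (restr P x)"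
    using nrm_approx[of "nrm (restr P x) / 2" "restr P x"] by auto
  have "nrm (restr P x) \<le> 2 * \<bar>pairing (restr P z) x\<bar>" if "x \<in> c00"
    unfolding pairing_restr[OF that] using z(2) by linarith
  then show ?thesis using GMs_restr[OF z(1) assms] by (intro exI[of _ "restr P z"]) (auto simp: supp_restr)
next
  case False
  then show ?thesis using zero_in_GMs by (intro exI[of _ "\<lambda>i. 0"]) (auto simp: supp_def)
qed

text \<open>The items of \<open>dec\<close> are converted into functionals at \<open>x\<close>: each
  \<open>H F\<close> is normed up to a factor 2 on the blocks of \<open>F\<close>, and single
  coordinates are expanded by \<open>coeff_pieces\<close>. All these families are successive and of
  bounded length, so \<open>B\<close> controls them and only small coefficients remain. The
  condition on the support of \<open>x\<close> removes the shallow \<open>bz n\<close>, which have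
  no such expansion.\<close>

lemma T0_small:
  assumes e: "0 < e"
  shows "\<exists>h N. \<forall>x\<in>c00. \<forall>B. supp x \<subseteq> {Q h..} \<longrightarrow>
    (\<forall>ws. set ws \<subseteq> GMs J \<sigma> \<longrightarrow> sorted_wrt vec_before ws \<longrightarrow> length ws \<le> N \<longrightarrow> (\<Sum>w\<leftarrow>ws. \<bar>pairing w x\<bar>) \<le> B) \<longrightarrow>
    nrm (T0 x) \<le> e * B"
proof -
  \<comment> \<open>The three contributions \<open>2 * t\<close>, \<open>2 * om (Suc m)\<close> and
    \<open>1 / tw m\<close> are each to be at most \<open>e / 3\<close>; the 240 is 6 times the 40
    in \<open>om\<close>.\<close>
  obtain m :: nat where m: "240 / e < real m" using reals_Archimedean2 by blast
  define t where "t = min 1 (e / 6)"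
  have t: "0 < t" "t \<le> 1" "2 * t \<le> e / 3" using e by (auto simp: t_def)
  have small: "40 / real (tw k) \<le> e / 6" if "m \<le> k" for k
  proof -
    have "240 / e \<le> real (tw k)" using m tw_ge[of k] that by linarith
    then show ?thesis using e tw_ge[of k] by (simp add: field_simps)
  qed
  have w: "2 * om (Suc m) \<le> e / 3" using small[of "Suc m"] by (simp add: om_def)
  have \<theta>: "1 / tw m \<le> e / 3" using small[of m] e tw_ge[of m] by (simp add: field_simps)
  define N where "N = nat \<lfloor>2 powr (4 * Ph (Suc m) * (1 - log 2 t))\<rfloor>"
  define h where "h = (m + 8) div 6"
  let ?N = "N * 2 ^ (tw (m + 9) div 4)"
  have "nrm (T0 x) \<le> e * B"
    if x: "x \<in> c00" "supp x \<subseteq> {Q h..}"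
      and B: "\<And>ws. set ws \<subseteq> GMs J \<sigma> \<Longrightarrow> sorted_wrt vec_before ws \<Longrightarrow> length ws \<le> ?N \<Longrightarrow> (\<Sum>w\<leftarrow>ws. \<bar>pairing w x\<bar>) \<le> B" for x B
  proof (rule nrm_le)
    fix v assume v: "v \<in> GMs J \<sigma>"
    interpret D: dominated J "T0 x" "\<lambda>E. nrm (restr (blk E) x)" using x(1) by (rule T0_dominated)
    let ?H = "\<lambda>E. nrm (restr (blk E) x)"
    have B0: "0 \<le> B" using B[of "[]"] by simp
    have "D.dec m t UNIV v" using D.relG_MR[OF GMs_relG[OF v]] t unfolding D.MR_def by simp
    then obtain qs where qs: "D.items UNIV qs" "\<forall>i\<in>set qs. fst i \<le> 1"
      "\<bar>pairing v (restr UNIV (T0 x))\<bar> \<le> (\<Sum>i\<leftarrow>qs. D.wt m t i)"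
      "real (length qs) \<le> 2 powr (4 * Ph (Suc m) * (1 - log 2 t))" unfolding D.dec_def by blast
    have lq: "length qs \<le> N" using qs(4) unfolding N_def by (simp add: le_nat_floor)
    define Fs where "Fs = map snd qs"
    have Fs: "sorted_wrt set_before Fs" "\<And>F. F \<in> set Fs \<Longrightarrow> nat_interval F" "length Fs \<le> N"
      using qs(1) lq by (auto simp: D.items_def Fs_def)
    have "\<bar>pairing v (T0 x)\<bar> \<le> (\<Sum>i\<leftarrow>qs. D.wt m t i)" using qs(3) by simp
    also have "\<dots> \<le> (\<Sum>i\<leftarrow>qs. (t + om (Suc m)) * ?H (snd i) + D.sg (snd i))"
    proof (rule sum_list_mono)
      fix i assume i: "i \<in> set qs"
      have k: "0 \<le> fst i" "fst i \<le> 1" using qs(1,2) i by (auto simp: D.items_def)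
      have H: "0 \<le> ?H (snd i)" "0 \<le> om (Suc m) * ?H (snd i)" "0 \<le> D.sg (snd i)" "0 \<le> t * ?H (snd i)"
        using nrm_nonneg om_nonneg D.sg_nonneg t by auto
      show "D.wt m t i \<le> (t + om (Suc m)) * ?H (snd i) + D.sg (snd i)"
      proof (cases "fst i < t")
        case True
        then have "fst i * ?H (snd i) \<le> t * ?H (snd i)" using H(1) by (intro mult_right_mono) auto
        then show ?thesis using True H by (simp add: D.wt_def algebra_simps)
      next
        case False
        have "fst i * (om (Suc m) * ?H (snd i) + D.sg (snd i)) \<le> 1 * (om (Suc m) * ?H (snd i) + D.sg (snd i))"
          using k H by (intro mult_right_mono) auto
        then show ?thesis using False H by (simp add: D.wt_def algebra_simps)
      qed
    qed
    also have "\<dots> = (t + om (Suc m)) * (\<Sum>F\<leftarrow>Fs. ?H F) + (\<Sum>F\<leftarrow>Fs. D.sg F)"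
      unfolding Fs_def by (simp add: sum_list_addf sum_list_const_mult o_def)
    also have "\<dots> \<le> (t + om (Suc m)) * (2 * B) + 1 / tw m * B"
    proof (intro add_mono mult_left_mono)
      show "0 \<le> t + om (Suc m)" using t om_nonneg[of "Suc m"] by linarith
      have "\<forall>F\<in>set Fs. \<exists>w. w \<in> GMs J \<sigma> \<and> supp w \<subseteq> blk F \<and> ?H F \<le> 2 * \<bar>pairing w x\<bar>"
        using norming[OF nat_interval_blk[OF Fs(2)], of _ x] x(1) by blast
      from bchoice[OF this] obtain w where w: "\<And>F. F \<in> set Fs \<Longrightarrow> w F \<in> GMs J \<sigma> \<and> supp (w F) \<subseteq> blk F \<and> ?H F \<le> 2 * \<bar>pairing (w F) x\<bar>" by blast
      have "(\<Sum>F\<leftarrow>Fs. ?H F) \<le> (\<Sum>F\<leftarrow>Fs. 2 * \<bar>pairing (w F) x\<bar>)" using w by (intro sum_list_mono) auto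
      also have "\<dots> = 2 * (\<Sum>u\<leftarrow>map w Fs. \<bar>pairing u x\<bar>)" by (simp add: sum_list_const_mult o_def)
      also have "\<dots> \<le> 2 * B"
      proof (intro mult_left_mono B)
        show "set (map w Fs) \<subseteq> GMs J \<sigma>" using w by auto
        show "sorted_wrt vec_before (map w Fs)" unfolding sorted_wrt_map
        proof (rule sorted_wrt_mono_rel[OF _ Fs(1)])
          fix F G assume "F \<in> set Fs" "G \<in> set Fs" "set_before F G"
          then show "vec_before (w F) (w G)" unfolding vec_before_def
            using set_before_blk[of F G] w[of F] w[of G] by (auto intro: set_before_mono)
        qed
        have "N * 1 \<le> ?N" by (intro mult_left_mono) auto
        then show "length (map w Fs) \<le> ?N" using Fs(3) unfolding length_map by linarith
      qed simp
      finally show "(\<Sum>F\<leftarrow>Fs. ?H F) \<le> 2 * B" .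
      define Gs where "Gs = filter (\<lambda>F. card F = 1) Fs"
      have d: "distinct (map Min Gs)" unfolding Gs_def using Fs(1) by (rule distinct_singletons)
      define A where "A = {n \<in> set (map Min Gs). h \<le> n}"
      have cA: "card A \<le> N"
      proof -
        have "card A \<le> card (set (map Min Gs))" unfolding A_def by (intro card_mono) auto
        also have "\<dots> \<le> length Gs" using card_length[of "map Min Gs"] by simp
        also have "\<dots> \<le> length Fs" unfolding Gs_def by simp
        finally show ?thesis using Fs(3) by simp
      qed
      have "(\<Sum>F\<leftarrow>Fs. D.sg F) = (\<Sum>F\<leftarrow>Gs. \<bar>T0 x (Min F)\<bar>)" unfolding Gs_def by (induction Fs) (auto simp: D.sg_def)
      also have "\<dots> = (\<Sum>n\<leftarrow>map Min Gs. \<bar>T0 x n\<bar>)" by (simp add: o_def)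
      also have "\<dots> = (\<Sum>n\<in>set (map Min Gs). \<bar>T0 x n\<bar>)" by (rule sum_list_distinct_conv_sum_set[OF d])
      also have "\<dots> = (\<Sum>n\<in>A. \<bar>T0 x n\<bar>)"
        unfolding A_def using T0_eq_0[OF x(2)] by (intro sum.mono_neutral_right) (auto intro!: leI)
      also have "\<dots> \<le> 1 / tw m * B"
      proof -
        have "finite A" by (simp add: A_def)
        moreover have "\<And>n. n \<in> A \<Longrightarrow> (m + 8) div 6 \<le> n" by (simp add: A_def h_def)
        ultimately obtain ws where ws: "set ws \<subseteq> GMs J \<sigma>" "sorted_wrt vec_before ws"
          "length ws \<le> card A * 2 ^ (tw (m + 9) div 4)"
          "\<And>x. x \<in> c00 \<Longrightarrow> (\<Sum>n\<in>A. \<bar>pairing (bz n) x\<bar>) \<le> 1 / tw m * (\<Sum>w\<leftarrow>ws. \<bar>pairing w x\<bar>)"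
          using coeff_pieces[of A m] by blast
        have "length ws \<le> ?N" using ws(3) mult_right_mono[OF cA, of "2 ^ (tw (m + 9) div 4)"] by linarith
        then have "(\<Sum>w\<leftarrow>ws. \<bar>pairing w x\<bar>) \<le> B" by (intro B ws)
        then have "1 / tw m * (\<Sum>w\<leftarrow>ws. \<bar>pairing w x\<bar>) \<le> 1 / tw m * B" by (intro mult_left_mono) auto
        then show ?thesis using ws(4)[OF x(1)] unfolding T0_def by linarith
      qed
      finally show "(\<Sum>F\<leftarrow>Fs. D.sg F) \<le> 1 / tw m * B" .
    qed
    also have "\<dots> = (2 * t + 2 * om (Suc m) + 1 / tw m) * B" by (simp add: algebra_simps)
    also have "\<dots> \<le> e * B" using t w \<theta> B0 by (intro mult_right_mono) linarith+
    finally show "pairing v (T0 x) \<le> e * B" by linarith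
  qed
  then show ?thesis by (intro exI[of _ h] exI[of _ ?N]) blast
qed

lemma T0_bx: "T0 (bx n) = unitv n"
proof
  fix k
  have "supp (bz k) \<inter> supp (bx n) = {}" if "k \<noteq> n"
    using that supp_z[of k] supp_x[of n] Q_mono[of "Suc k" n] Q_mono[of "Suc n" k] by (cases "k < n") fastforce+
  then show "T0 (bx n) k = unitv n k" using zx[of n] pairing_eq_0[of "bz k" "bx n"] by (auto simp: T0_def unitv_def)
qed

lemma bx_c00: "bx n \<in> c00"
  using finite_subset[OF supp_x[of n]] by (simp add: c00_def)

lemma nrm_bx: "nrm (bx n) \<le> 2"
  using x_norm[OF GMs_relG] abs_ge_self order_trans by (intro nrm_le) blast

end

section \<open>Passage to the completion\<close>

lemma infinite_dimensional_kernel: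
  assumes f: "linear (f :: 'a::real_vector \<Rightarrow> real)" and M: "subspace M" "infinite_dimensional M"
  shows "subspace {y\<in>M. f y = 0} \<and> infinite_dimensional {y\<in>M. f y = 0}"
proof
  show "subspace {y\<in>M. f y = 0}"
    using M(1) linear_add[OF f] linear_scale[OF f] linear_0[OF f] by (auto simp: subspace_def)
  show "infinite_dimensional {y\<in>M. f y = 0}"
  proof (rule ccontr)
    assume "\<not> ?thesis"
    then obtain B where B: "finite B" "{y\<in>M. f y = 0} \<subseteq> span B" by (auto simp: infinite_dimensional_def)
    have "\<exists>B. finite B \<and> M \<subseteq> span B"
    proof (cases "\<exists>y0\<in>M. f y0 \<noteq> 0")
      case True
      then obtain y0 where y0: "y0 \<in> M" "f y0 \<noteq> 0" by blast
      have "M \<subseteq> span (insert y0 B)"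
      proof
        fix y assume y: "y \<in> M"
        let ?r = "f y / f y0"
        have "y - ?r *\<^sub>R y0 \<in> {y\<in>M. f y = 0}"
          using M(1) y y0 linear_diff[OF f] linear_scale[OF f] by (simp add: subspace_diff subspace_scale)
        then have "y - ?r *\<^sub>R y0 \<in> span (insert y0 B)" using B(2) span_mono[of B "insert y0 B"] by blast
        moreover have "?r *\<^sub>R y0 \<in> span (insert y0 B)" by (intro span_scale span_base) simp
        ultimately have "(y - ?r *\<^sub>R y0) + ?r *\<^sub>R y0 \<in> span (insert y0 B)" by (rule span_add)
        then show "y \<in> span (insert y0 B)" by simp
      qed
      then show ?thesis using B(1) by blast
    next
      case False
      then show ?thesis using B by blast
    qed
    then show False using M(2) by (simp add: infinite_dimensional_def)
  qed
qed

lemma infinite_dimensional_kernels: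
  fixes f :: "nat \<Rightarrow> 'a::real_vector \<Rightarrow> real"
  assumes f: "\<And>n. linear (f n)" and M: "subspace M" "infinite_dimensional M"
  shows "\<exists>y\<in>M. y \<noteq> 0 \<and> (\<forall>n<p. f n y = 0)"
proof -
  have "subspace {y\<in>M. \<forall>n<p. f n y = 0} \<and> infinite_dimensional {y\<in>M. \<forall>n<p. f n y = 0}"
  proof (induction p)
    case (Suc p)
    have eq: "{y\<in>M. \<forall>n<Suc p. f n y = 0} = {y\<in>{y\<in>M. \<forall>n<p. f n y = 0}. f p y = 0}" by (auto simp: less_Suc_eq)
    show ?case unfolding eq using Suc by (intro infinite_dimensional_kernel f) auto
  qed (use M in simp)
  then have "\<not> {y\<in>M. \<forall>n<p. f n y = 0} \<subseteq> span {}" unfolding infinite_dimensional_def by (meson finite.emptyI)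
  then show ?thesis by auto
qed

text \<open>The constant comes from continuity of \<open>S\<close> at 0 with tolerance 1: a unit
  vector of \<open>M\<close> with too small an image would be returned by \<open>S\<close> with norm
  below 1.\<close>

lemma homeomorphism_bounded_below:
  fixes T :: "'a::real_normed_vector \<Rightarrow> 'b::real_normed_vector"
  assumes T: "linear T" and M: "subspace M" and S: "homeomorphism M (T ` M) T S"
  shows "\<exists>c>0. \<forall>y\<in>M. c * norm y \<le> norm (T y)"
proof -
  have ST: "\<And>y. y \<in> M \<Longrightarrow> S (T y) = y" and cont: "continuous_on (T ` M) S" using S by (auto simp: homeomorphism_def)
  have M0: "0 \<in> M" using M by (rule subspace_0)
  have T0: "T 0 = 0" using T by (rule linear_0)
  have S0: "S 0 = 0" using ST[OF M0] T0 by simp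
  have "0 \<in> T ` M" using M0 T0 by force
  from cont[unfolded continuous_on_iff, rule_format, OF this, of 1] S0
  obtain d where d: "0 < d" "\<And>w. w \<in> T ` M \<Longrightarrow> norm w < d \<Longrightarrow> norm (S w) < 1" by auto
  have "d / 2 * norm y \<le> norm (T y)" if y: "y \<in> M" for y
  proof (rule ccontr)
    assume c: "\<not> ?thesis"
    then have y0: "0 < norm y" by auto
    define y' where "y' = (1 / norm y) *\<^sub>R y"
    have y'M: "y' \<in> M" unfolding y'_def using M y by (rule subspace_scale)
    have "norm (T y') = norm (T y) / norm y" unfolding y'_def linear_scale[OF T] using y0 by simp
    also have "\<dots> < d / 2" using c y0 by (simp add: divide_less_eq)
    also have "\<dots> < d" using d(1) by simp
    finally have "norm (S (T y')) < 1" using y'M by (intro d) auto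
    then show False using ST[OF y'M] y0 by (simp add: y'_def)
  qed
  then show ?thesis using d(1) by (intro exI[of _ "d / 2"]) auto
qed

section \<open>Extension to the completion, strict singularity and failure of compactness\<close>

locale GM_space = blocks +
  fixes \<iota> :: "(nat \<Rightarrow> real) \<Rightarrow> 'a::banach"
  assumes completion: "GM_completion J \<sigma> \<iota>"
begin

lemma \<iota>_lin: "x \<in> c00 \<Longrightarrow> y \<in> c00 \<Longrightarrow> \<iota> (\<lambda>i. a * x i + b * y i) = a *\<^sub>R \<iota> x + b *\<^sub>R \<iota> y"
  and \<iota>_norm: "x \<in> c00 \<Longrightarrow> norm (\<iota> x) = nrm x"
  and \<iota>_dense: "closure (\<iota> ` c00) = UNIV"
  using completion by (auto simp: GM_completion_def)

lemma \<iota>_add: "x \<in> c00 \<Longrightarrow> y \<in> c00 \<Longrightarrow> \<iota> (\<lambda>i. x i + y i) = \<iota> x + \<iota> y"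
  using \<iota>_lin[of x y 1 1] by simp

lemma \<iota>_scale: "x \<in> c00 \<Longrightarrow> \<iota> (\<lambda>i. a * x i) = a *\<^sub>R \<iota> x"
  using \<iota>_lin[of x x a 0] by simp

lemma \<iota>_zero: "\<iota> (\<lambda>i. 0) = 0"
  using \<iota>_scale[OF c00_zero, of 0] by simp

lemma \<iota>_sum: "finite I \<Longrightarrow> (\<And>i. i \<in> I \<Longrightarrow> y i \<in> c00) \<Longrightarrow> \<iota> (\<lambda>n. \<Sum>i\<in>I. y i n) = (\<Sum>i\<in>I. \<iota> (y i))"
proof (induction I rule: finite_induct)
  case (insert i I)
  then show ?case using \<iota>_add[of "y i" "\<lambda>n. \<Sum>i\<in>I. y i n"] c00_sum[of I y] by simp
qed (simp add: \<iota>_zero)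

lemma extension:
  fixes f :: "(nat \<Rightarrow> real) \<Rightarrow> 'b::banach"
  assumes lin: "\<And>x y a b. x \<in> c00 \<Longrightarrow> y \<in> c00 \<Longrightarrow> f (\<lambda>i. a * x i + b * y i) = a *\<^sub>R f x + b *\<^sub>R f y"
    and bd: "\<And>x. x \<in> c00 \<Longrightarrow> norm (f x) \<le> nrm x"
  shows "\<exists>F. bounded_linear F \<and> (\<forall>y. norm (F y) \<le> norm y) \<and> (\<forall>x\<in>c00. F (\<iota> x) = f x)"
proof -
  let ?D = "\<iota> ` c00"
  have fdist: "norm (f x - f y) \<le> norm (\<iota> x - \<iota> y)" if "x \<in> c00" "y \<in> c00" for x y
  proof -
    have "f (\<lambda>i. 1 * x i + (-1) * y i) = 1 *\<^sub>R f x + (-1) *\<^sub>R f y" using that by (rule lin)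
    then have "f x - f y = f (\<lambda>i. 1 * x i + (-1) * y i)" by simp
    also have "norm \<dots> \<le> nrm (\<lambda>i. 1 * x i + (-1) * y i)" using that by (intro bd c00_lincomb)
    also have "\<dots> = norm (\<iota> (\<lambda>i. 1 * x i + (-1) * y i))" using that by (intro \<iota>_norm[symmetric] c00_lincomb)
    also have "\<dots> = norm (\<iota> x - \<iota> y)" unfolding \<iota>_lin[OF that] by simp
    finally show ?thesis .
  qed
  \<comment> \<open>A preimage under \<iota> is chosen arbitrarily; \<open>fdist\<close> shows that
    \<open>f\<close> has the same value at all of them.\<close>
  define g where "g d = f (SOME x. x \<in> c00 \<and> \<iota> x = d)" for d
  have g: "g (\<iota> x) = f x" if "x \<in> c00" for x
  proof -
    have "\<exists>y. y \<in> c00 \<and> \<iota> y = \<iota> x" using that by blast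
    from someI_ex[OF this] fdist[OF _ that] show ?thesis unfolding g_def by fastforce
  qed
  have "uniformly_continuous_on ?D g" unfolding uniformly_continuous_on_def
  proof (intro allI impI)
    fix e :: real assume e: "0 < e"
    have "dist (g x') (g x) < e" if "x \<in> ?D" "x' \<in> ?D" "dist x' x < e" for x x'
    proof -
      from that obtain u u' where u: "u \<in> c00" "u' \<in> c00" "x = \<iota> u" "x' = \<iota> u'" by blast
      show ?thesis using fdist[OF u(2,1)] that(3) by (simp add: u g dist_norm)
    qed
    then show "\<exists>d>0. \<forall>x\<in>?D. \<forall>x'\<in>?D. dist x' x < d \<longrightarrow> dist (g x') (g x) < e" using e by blast
  qed
  from uniformly_continuous_on_extension_on_closure[OF this]
  obtain F where F: "uniformly_continuous_on (closure ?D) F" "\<And>x. x \<in> ?D \<Longrightarrow> g x = F x" by metis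
  have Ff: "F (\<iota> x) = f x" if "x \<in> c00" for x using F(2)[of "\<iota> x"] g that by simp
  have cF: "continuous_on A F" for A
    using uniformly_continuous_imp_continuous[OF F(1)] unfolding \<iota>_dense by (rule continuous_on_subset) simp
  have cFc: "continuous_on A (\<lambda>x. F (h x))" if "continuous_on A h" for A and h :: "'a \<Rightarrow> 'a"
    using continuous_on_compose2[OF cF that] by blast
  have eq: "\<phi> x = (0 :: 'b)" if "continuous_on UNIV \<phi>" "\<And>u. u \<in> c00 \<Longrightarrow> \<phi> (\<iota> u) = 0" for \<phi> x
    using continuous_constant_on_closure[of ?D \<phi> 0 x] that unfolding \<iota>_dense by blast
  have lin_comb: "F (a *\<^sub>R x + b *\<^sub>R y) = a *\<^sub>R F x + b *\<^sub>R F y" for a b x y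
  proof -
    have 1: "F (a *\<^sub>R z + b *\<^sub>R \<iota> v) - (a *\<^sub>R F z + b *\<^sub>R F (\<iota> v)) = 0" if v: "v \<in> c00" for z v
    proof (rule eq[of "\<lambda>z. F (a *\<^sub>R z + b *\<^sub>R \<iota> v) - (a *\<^sub>R F z + b *\<^sub>R F (\<iota> v))"])
      show "continuous_on UNIV (\<lambda>z. F (a *\<^sub>R z + b *\<^sub>R \<iota> v) - (a *\<^sub>R F z + b *\<^sub>R F (\<iota> v)))"
        by (intro continuous_intros cFc cF)
      fix u assume u: "u \<in> c00"
      have "F (a *\<^sub>R \<iota> u + b *\<^sub>R \<iota> v) = f (\<lambda>i. a * u i + b * v i)"
        unfolding \<iota>_lin[OF u v, symmetric] using u v by (intro Ff c00_lincomb)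
      then show "F (a *\<^sub>R \<iota> u + b *\<^sub>R \<iota> v) - (a *\<^sub>R F (\<iota> u) + b *\<^sub>R F (\<iota> v)) = 0"
        using lin[OF u v] Ff u v by simp
    qed
    have "F (a *\<^sub>R x + b *\<^sub>R y) - (a *\<^sub>R F x + b *\<^sub>R F y) = 0"
      by (rule eq[of "\<lambda>y. F (a *\<^sub>R x + b *\<^sub>R y) - (a *\<^sub>R F x + b *\<^sub>R F y)"])
        (intro continuous_intros cFc cF, rule 1)
    then show ?thesis by simp
  qed
  have "norm (F y) \<le> norm y" for y
  proof -
    have "0 \<le> norm y - norm (F y)"
    proof (rule continuous_ge_on_closure[of ?D "\<lambda>y. norm y - norm (F y)"])
      show "continuous_on (closure ?D) (\<lambda>y. norm y - norm (F y))" by (intro continuous_intros cF)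
      show "y \<in> closure ?D" using \<iota>_dense by simp
      show "0 \<le> norm d - norm (F d)" if "d \<in> ?D" for d using that Ff bd \<iota>_norm by auto
    qed
    then show ?thesis by simp
  qed
  moreover from this have "bounded_linear F"
    using lin_comb[of 1 _ 1] lin_comb[of _ _ 0] by (intro bounded_linear_intro[of F 1]) auto
  ultimately show ?thesis using Ff by blast
qed

definition T where "T = (SOME F. bounded_linear F \<and> (\<forall>y. norm (F y) \<le> norm y) \<and> (\<forall>x\<in>c00. F (\<iota> x) = \<iota> (T0 x)))"

lemma T: "bounded_linear T" "norm (T y) \<le> norm y" "x \<in> c00 \<Longrightarrow> T (\<iota> x) = \<iota> (T0 x)"
proof -
  have "\<exists>F. bounded_linear F \<and> (\<forall>y. norm (F y) \<le> norm y) \<and> (\<forall>x\<in>c00. F (\<iota> x) = \<iota> (T0 x))"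
  proof (rule extension)
    fix x y :: "nat \<Rightarrow> real" and a b assume xy: "x \<in> c00" "y \<in> c00"
    have "T0 (\<lambda>i. a * x i + b * y i) = (\<lambda>n. a * T0 x n + b * T0 y n)"
      unfolding T0_def by (simp add: pairing_add[OF xy])
    then show "\<iota> (T0 (\<lambda>i. a * x i + b * y i)) = a *\<^sub>R \<iota> (T0 x) + b *\<^sub>R \<iota> (T0 y)"
      using \<iota>_lin[OF T0_c00[OF xy(1)] T0_c00[OF xy(2)]] by simp
  next
    fix x assume "x \<in> c00"
    then show "norm (\<iota> (T0 x)) \<le> nrm x" using T0_bound \<iota>_norm[OF T0_c00] by simp
  qed
  from someI_ex[OF this] show "bounded_linear T" "norm (T y) \<le> norm y" "x \<in> c00 \<Longrightarrow> T (\<iota> x) = \<iota> (T0 x)"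
    unfolding T_def by blast+
qed

lemma coordinate_functionals:
  "\<exists>g. (\<forall>n. linear (g n)) \<and> (\<forall>n y. \<bar>g n y\<bar> \<le> norm y) \<and> (\<forall>n. \<forall>x\<in>c00. g n (\<iota> x) = x n)"
proof -
  have "\<exists>F :: 'a \<Rightarrow> real. bounded_linear F \<and> (\<forall>y. norm (F y) \<le> norm y) \<and> (\<forall>x\<in>c00. F (\<iota> x) = x n)" for n
    by (rule extension) (auto simp: nrm_coord)
  then have "\<exists>g. \<forall>n. bounded_linear (g n) \<and> (\<forall>y. norm (g n y :: real) \<le> norm y) \<and> (\<forall>x\<in>c00. g n (\<iota> x) = x n)"
    by (intro choice) blast
  then show ?thesis by (auto intro: bounded_linear.linear)
qed

text \<open>A unit vector of \<open>M\<close> annihilated by the first \<open>p\<close> coordinate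
  functionals is approximated within \<open>d / (1 + p)\<close>. The approximant has small first
  coordinates, and removing all \<open>p\<close> of them costs \<open>p\<close> times that error at
  most.\<close>

lemma block_approximation:
  assumes M: "subspace M" "infinite_dimensional M" and d: "0 < d" "d \<le> 1 / 2"
  shows "\<exists>q U u. p < q \<and> U \<in> M \<and> norm U = 1 \<and> u \<in> c00 \<and> supp u \<subseteq> {p..<q} \<and> norm (\<iota> u - U) \<le> d"
proof -
  obtain g where g: "\<And>n. linear (g n)" "\<And>n y. \<bar>g n y\<bar> \<le> norm y" "\<And>n x. x \<in> c00 \<Longrightarrow> g n (\<iota> x) = x n"
    using coordinate_functionals by blast
  from infinite_dimensional_kernels[of g M p, OF g(1) M]
  obtain y where y: "y \<in> M" "y \<noteq> 0 \<and> (\<forall>n<p. g n y = 0)" by (rule bexE)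
  define U where "U = (1 / norm y) *\<^sub>R y"
  have U: "U \<in> M" "norm U = 1" "\<And>n. n < p \<Longrightarrow> g n U = 0"
    using y subspace_scale[OF M(1)] by (auto simp: U_def linear_scale[OF g(1)])
  define e where "e = d / (1 + p)"
  have e: "0 < e" using d by (simp add: e_def add_pos_nonneg)
  have "U \<in> closure (\<iota> ` c00)" using \<iota>_dense by simp
  then obtain x where x: "x \<in> c00" "norm (\<iota> x - U) < e" using e unfolding closure_approachable dist_norm by blast
  have small: "\<bar>x n\<bar> \<le> e" if "n < p" for n
  proof -
    have "x n = g n (\<iota> x - U)" using g(3)[OF x(1)] U(3)[OF that] linear_diff[OF g(1)] by simp
    then show ?thesis using g(2)[of n "\<iota> x - U"] x(2) by simp
  qed
  define u where "u = restr {p..} x"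
  have u: "u \<in> c00" unfolding u_def using x(1) by (rule restr_c00)
  have r: "restr {..<p} x \<in> c00" using x(1) by (rule restr_c00)
  have "x = (\<lambda>i. restr {..<p} x i + u i)" by (auto simp: u_def restr_def fun_eq_iff)
  then have "\<iota> x = \<iota> (restr {..<p} x) + \<iota> u" using \<iota>_add[OF r u] by simp
  then have "\<iota> u - U = (\<iota> x - U) - \<iota> (restr {..<p} x)" by simp
  then have "norm (\<iota> u - U) \<le> norm (\<iota> x - U) + norm (\<iota> (restr {..<p} x))" by (simp only: norm_triangle_ineq4)
  also have "\<dots> \<le> e + p * e"
    using x(2) nrm_initial_le[OF x(1) small, of p] \<iota>_norm[OF r] by simp
  also have "\<dots> = (1 + real p) * e" by (simp add: distrib_right)
  also have "\<dots> = d" unfolding e_def using of_nat_0_le_iff[of p, where 'a = real] by simp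
  finally have n: "norm (\<iota> u - U) \<le> d" .
  have "finite (supp u)" using u by (simp add: c00_def)
  then obtain q0 where "supp u \<subseteq> {..<q0}" using finite_nat_bounded by blast
  then have "supp u \<subseteq> {p..<max q0 (Suc p)}" by (auto simp: u_def supp_restr)
  then show ?thesis using U u n by (intro exI[of _ "max q0 (Suc p)"]) auto
qed

lemma T_strictly_singular: "strictly_singular T"
  unfolding strictly_singular_def
proof (rule notI, elim exE conjE)
  fix M S assume M: "subspace M" "infinite_dimensional M" and S: "homeomorphism M (T ` M) T S"
  have Tl: "linear T" using T(1) by (rule bounded_linear.linear)
  obtain c where c: "0 < c" "\<And>y. y \<in> M \<Longrightarrow> c * norm y \<le> norm (T y)"
    using homeomorphism_bounded_below[OF Tl M(1) S] by blast
  \<comment> \<open>The average found below has constant 4, so this yields \<open>c / 4\<close>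
    times its norm; another \<open>c / 4\<close> is reserved for the approximation error.\<close>
  have "0 < c / 16" using c(1) by simp
  from T0_small[OF this] obtain h N where small: "\<forall>x\<in>c00. \<forall>B. supp x \<subseteq> {Q h..} \<longrightarrow>
    (\<forall>ws. set ws \<subseteq> GMs J \<sigma> \<longrightarrow> sorted_wrt vec_before ws \<longrightarrow> length ws \<le> N \<longrightarrow> (\<Sum>w\<leftarrow>ws. \<bar>pairing w x\<bar>) \<le> B) \<longrightarrow>
    nrm (T0 x) \<le> c / 16 * B" by (elim exE) (rule that)
  have hN: "nrm (T0 x) \<le> c / 16 * B"
    if "x \<in> c00" "supp x \<subseteq> {Q h..}"
      "\<And>ws. set ws \<subseteq> GMs J \<sigma> \<Longrightarrow> sorted_wrt vec_before ws \<Longrightarrow> length ws \<le> N \<Longrightarrow> (\<Sum>w\<leftarrow>ws. \<bar>pairing w x\<bar>) \<le> B" for x B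
    using bspec[OF small that(1)] that(2,3) by blast
  define n where "n = Suc N"
  \<comment> \<open>Bounds the number of summands for every \<open>j\<close> that
    \<open>l1_average\<close> may return, because the accuracy \<open>d\<close> has to be fixed
    before \<open>j\<close> is known.\<close>
  define L where "L = n ^ (n + 16)"
  define r where "r = min (1 / 4) (c / 4)"
  define d where "d = r / (2 * L)"
  have n: "1 \<le> n" by (simp add: n_def)
  have L: "1 \<le> L" using n by (simp add: L_def)
  have r: "0 < r" "r \<le> 1 / 4" "r \<le> c / 4" using c(1) by (auto simp: r_def)
  have d: "0 < d" "d \<le> 1 / 2" "real L * d \<le> r / 2" using r L by (auto simp: d_def field_simps)
  define P where "P i p q Uu \<longleftrightarrow> fst Uu \<in> M \<and> norm (fst Uu) = 1 \<and> snd Uu \<in> c00 \<and> supp (snd Uu) \<subseteq> {p..<q} \<and>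
    norm (\<iota> (snd Uu) - fst Uu) \<le> d" for i :: nat and p q and Uu :: "'a \<times> (nat \<Rightarrow> real)"
  have "\<exists>q Uu. p < q \<and> P i p q Uu" for i p
    unfolding P_def using block_approximation[OF M d(1,2), of p] by auto
  from chain_exists[of P, OF this, of "Q h"] obtain s Y where s0: "s 0 = Q h"
    and sY: "\<And>i. s i < s (Suc i) \<and> P i (s i) (s (Suc i)) (Y i)" by auto
  define U u where "U i = fst (Y i)" and "u i = snd (Y i)" for i
  have Uu: "U i \<in> M" "norm (U i) = 1" "u i \<in> c00" "supp (u i) \<subseteq> {s i..<s (Suc i)}" "norm (\<iota> (u i) - U i) \<le> d" for i
    using sY[of i] by (auto simp: P_def U_def u_def)
  have sm: "i \<le> j \<Longrightarrow> s i \<le> s j" for i j by (rule lift_Suc_mono_le[of s]) (use sY less_imp_le in blast)+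
  have nu: "1 / 2 \<le> nrm (u i)" "nrm (u i) \<le> 2" for i
  proof -
    have "\<bar>norm (\<iota> (u i)) - norm (U i)\<bar> \<le> d" using norm_triangle_ineq3[of "\<iota> (u i)" "U i"] Uu(5)[of i] by linarith
    then show "1 / 2 \<le> nrm (u i)" "nrm (u i) \<le> 2" using Uu(2)[of i] \<iota>_norm[OF Uu(3)[of i]] d(2) by linarith+
  qed
  obtain a j where j: "j < n + 16" and low: "1 / 2 \<le> nrm (\<lambda>t. \<Sum>i\<in>{a..<a + n ^ Suc j}. u i t)"
    and l1: "\<And>ws. set ws \<subseteq> GMs J \<sigma> \<Longrightarrow> sorted_wrt vec_before ws \<Longrightarrow> length ws \<le> n \<Longrightarrow>
      (\<Sum>w\<leftarrow>ws. \<bar>pairing w (\<lambda>t. \<Sum>i\<in>{a..<a + n ^ Suc j}. u i t)\<bar>) \<le> 4 * nrm (\<lambda>t. \<Sum>i\<in>{a..<a + n ^ Suc j}. u i t)"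
    using l1_average[of s u n] sY Uu nu n by blast
  define I where "I = {a..<a + n ^ Suc j}"
  define x where "x = (\<lambda>t. \<Sum>i\<in>I. u i t)"
  define X where "X = (\<Sum>i\<in>I. U i)"
  have xc: "x \<in> c00" unfolding x_def using Uu(3) by (rule c00_sum)
  have XM: "X \<in> M" unfolding X_def using Uu(1) by (intro subspace_sum M)
  have sx: "supp x \<subseteq> {Q h..}"
  proof
    fix t assume "t \<in> supp x"
    then have "(\<Sum>i\<in>I. u i t) \<noteq> 0" by (simp add: supp_def x_def)
    then obtain i where "u i t \<noteq> 0" by (meson sum.not_neutral_contains_not_neutral)
    then have "t \<in> {s i..<s (Suc i)}" using Uu(4)[of i] by (auto simp: supp_def)
    then show "t \<in> {Q h..}" using sm[of 0 i] s0 by simp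
  qed
  have T0x: "nrm (T0 x) \<le> c / 16 * (4 * nrm x)"
    using l1 by (intro hN[OF xc sx]) (auto simp: x_def I_def n_def)
  have near: "norm (\<iota> x - X) \<le> r * nrm x"
  proof -
    have "\<iota> x - X = (\<Sum>i\<in>I. \<iota> (u i) - U i)" unfolding x_def X_def using Uu(3) by (simp add: \<iota>_sum I_def sum_subtractf)
    also have "norm \<dots> \<le> (\<Sum>i\<in>I. d)" using Uu(5) by (intro sum_norm_le)
    finally have "norm (\<iota> x - X) \<le> (\<Sum>i\<in>I. d)" .
    also have "\<dots> = real (n ^ Suc j) * d" by (simp add: I_def)
    also have "\<dots> \<le> real L * d"
    proof (intro mult_right_mono of_nat_mono)
      show "n ^ Suc j \<le> L" unfolding L_def using n j by (intro power_increasing) auto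
    qed (use d in simp)
    also have "\<dots> \<le> r * (1 / 2)" using d(3) by simp
    also have "\<dots> \<le> r * nrm x" using r low by (intro mult_left_mono) (auto simp: x_def I_def)
    finally show ?thesis .
  qed
  have nx: "norm (\<iota> x) = nrm x" using xc by (rule \<iota>_norm)
  have x2: "1 / 2 \<le> nrm x" using low by (simp add: x_def I_def)
  have "c * norm X \<le> norm (T X)" using XM by (rule c(2))
  also have "T X = T (\<iota> x) - T (\<iota> x - X)" by (simp add: linear_diff[OF Tl])
  also have "norm \<dots> \<le> norm (T (\<iota> x)) + norm (T (\<iota> x - X))" by (rule norm_triangle_ineq4)
  also have "\<dots> \<le> c / 4 * nrm x + r * nrm x"
    using T0x near T(2)[of "\<iota> x - X"] T(3)[OF xc] \<iota>_norm[OF T0_c00[OF xc]] by simp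
  also have "\<dots> \<le> c / 4 * nrm x + c / 4 * nrm x" using r x2 by (intro add_left_mono mult_right_mono) auto
  finally have up: "c * norm X \<le> c / 2 * nrm x" by simp
  have "r * nrm x \<le> 1 / 4 * nrm x" using r x2 by (intro mult_right_mono) auto
  then have "3 / 4 * nrm x \<le> norm X" using norm_triangle_ineq2[of "\<iota> x" X] near nx by linarith
  then have "c * (3 / 4 * nrm x) \<le> c * norm X" using c(1) by (intro mult_left_mono) auto
  with up have "c * nrm x \<le> 0" by simp
  then show False using c(1) x2 by (simp add: mult_le_0_iff)
qed

lemma T_not_compact: "\<not> compact_operator T"
proof
  assume "compact_operator T"
  then have "seq_compact (closure (T ` cball 0 1))" by (simp add: compact_operator_def compact_imp_seq_compact)
  \<comment> \<open>The factor \<open>1 / 2\<close> brings the preimages \<open>bx n\<close>, of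
    norm at most 2, into the unit ball.\<close>
  moreover define e where "e n = (1 / 2) *\<^sub>R \<iota> (unitv n)" for n
  have "e n \<in> closure (T ` cball 0 1)" for n
  proof -
    have "norm ((1 / 2) *\<^sub>R \<iota> (bx n)) \<le> 1" using nrm_bx[of n] \<iota>_norm[OF bx_c00] by simp
    moreover have "T ((1 / 2) *\<^sub>R \<iota> (bx n)) = e n"
      using linear_scale[OF bounded_linear.linear[OF T(1)]] T(3)[OF bx_c00] T0_bx by (simp add: e_def)
    ultimately have "e n \<in> T ` cball 0 1" by (metis image_eqI mem_cball_0)
    then show ?thesis by (rule subsetD[OF closure_subset])
  qed
  ultimately obtain l \<phi> where \<phi>: "strict_mono \<phi>" "(e \<circ> \<phi>) \<longlonglongrightarrow> l" unfolding seq_compact_def by blast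
  have "Cauchy (e \<circ> \<phi>)" using \<phi>(2) by (rule LIMSEQ_imp_Cauchy)
  then obtain K where K: "\<And>m n. K \<le> m \<Longrightarrow> K \<le> n \<Longrightarrow> norm (e (\<phi> m) - e (\<phi> n)) < 1 / 2"
    unfolding Cauchy_iff by (metis comp_apply half_gt_zero zero_less_one)
  have "\<phi> K \<noteq> \<phi> (Suc K)" using strict_mono_less[OF \<phi>(1), of K "Suc K"] by simp
  moreover have "1 / 2 \<le> norm (e m - e n)" if "m \<noteq> n" for m n
  proof -
    let ?x = "\<lambda>i. 1 / 2 * unitv m i + (- 1 / 2) * unitv n i"
    have xc: "?x \<in> c00" by (intro c00_lincomb unitv_c00)
    have "1 / 2 = \<bar>?x m\<bar>" using that by (simp add: unitv_def)
    also have "\<dots> \<le> nrm ?x" using xc by (rule nrm_coord)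
    also have "\<dots> = norm (e m - e n)"
      using \<iota>_norm[OF xc] \<iota>_lin[OF unitv_c00 unitv_c00, of "1 / 2" m "- 1 / 2" n] by (simp add: e_def)
    finally show ?thesis .
  qed
  ultimately show False using K[of K "Suc K"] by fastforce
qed

end

theorem theorem1p1:
  fixes J :: "nat set"
    and \<sigma> :: "(nat \<Rightarrow> real) list \<Rightarrow> nat"
    and \<iota> :: "(nat \<Rightarrow> real) \<Rightarrow> 'a::banach"
  assumes "GM_index_set J"
    and "GM_coding J \<sigma>"
    and "GM_completion J \<sigma> \<iota>"
  shows "\<exists>T :: 'a \<Rightarrow> 'a. bounded_linear T \<and> strictly_singular T \<and> \<not> compact_operator T"
proof -
  interpret GM J \<sigma> using assms by unfold_locales
  obtain Q bx bz where "blocks J \<sigma> Q bx bz" using blocks_exist by blast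
  then have "GM_space J \<sigma> Q bx bz \<iota>" using assms(3) by (simp add: GM_space_def GM_space_axioms_def)
  then interpret GM_space J \<sigma> Q bx bz \<iota> .
  show ?thesis using T(1) T_strictly_singular T_not_compact by blast
qed

end
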